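(* Let $\Gamma$ be the group defined below. Then $\Gamma$ has the unique trace property, but $\Gamma$ is not $C^*$-simple.
   Context: For a discrete group $G$, $C^*_r(G)$ denotes the reduced group $C^*$-algebra (generated by the left regular representation on $\ell^2(G)$). $G$ is $C^*$-simple if $C^*_r(G)$ has no nontrivial proper closed two-sided ideals, and $G$ has the unique trace property if the canonical trace $\tau(a)=\langle a\delta_e,\delta_e\rangle$ is the only tracial state on $C^*_r(G)$. Definition of $\Gamma$: write $\oplus$ for addition modulo $2$. Let $H$ be the group with generators $h(i_1,\dots,i_n)$, one for each $n\ge 1$ and each sequence $(i_1,\dots,i_n)\in\{0,1\}^n$, subject to the relations $h(i_1,\dots,i_n)^2=e$ for all such sequences, and, for all sequences $(i_1,\dots,i_k)$ and $(j_1,\dots,j_n)$ with $n\ge k$: $h(i_1,\dots,i_k)h(j_1,\dots,j_n)h(i_1,\dots,i_k)=h(j_1,\dots,j_k,j_{k+1}\oplus 1,j_{k+2},\dots,j_n)$ if $n>k$ and $i_\ell=j_\ell$ for all $1\le\ell\le k$, and $=h(j_1,\dots,j_n)$ otherwise. Let $\Gamma$ be the group generated by all the $h(i_1,\dots,i_n)$ together with two further generators $g_0,g_1$, subject to the relations of $H$ and the additional relations $g_0^2=g_1^2=e$, $(g_0h(1))^3=e$, $(g_1h(0))^3=e$, and, for all $n\ge 2$ and $i_3,\dots,i_n\in\{0,1\}$: $g_0h(1,0,i_3,\dots,i_n)g_0=h(0,i_3,\dots,i_n)$, $g_0h(1,1,i_3,\dots,i_n)g_0=h(1,1,i_3,\dots,i_n)$,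 $g_1h(0,0,i_3,\dots,i_n)g_1=h(0,0,i_3,\dots,i_n)$, $g_1h(0,1,i_3,\dots,i_n)g_1=h(1,i_3,\dots,i_n)$. Writing $H$ also for the subgroup of $\Gamma$ generated by the $h$'s, and $G_0=\langle H\cup\{g_0\}\rangle$, $G_1=\langle H\cup\{g_1\}\rangle$, one has $\Gamma=G_0*_HG_1$. *)

theory Defs
  imports "HOL-Algebra.Group" "HOL-Analysis.Analysis"
begin

definition l2 :: "('a, 'b) monoid_scheme \<Rightarrow> ('a \<Rightarrow> complex) set" where
  "l2 G = {f. (\<forall>x. x \<notin> carrier G \<longrightarrow> f x = 0) \<and> (\<lambda>x. (cmod (f x))^2) summable_on UNIV}"

definition l2norm :: "('a \<Rightarrow> complex) \<Rightarrow> real" where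
  "l2norm f = sqrt (infsum (\<lambda>x. (cmod (f x))^2) UNIV)"

definition l2inner :: "('a \<Rightarrow> complex) \<Rightarrow> ('a \<Rightarrow> complex) \<Rightarrow> complex" where
  "l2inner f h = infsum (\<lambda>x. f x * cnj (h x)) UNIV"

type_synonym 'a op = "('a \<Rightarrow> complex) \<Rightarrow> ('a \<Rightarrow> complex)"

text \<open>Bounded linear operators on l2(G); normalised to be 0 outside l2(G), so that
  an operator is determined by its action on l2(G).\<close>
definition bounded_op :: "('a, 'b) monoid_scheme \<Rightarrow> 'a op \<Rightarrow> bool" where
  "bounded_op G T \<longleftrightarrow>
     (\<forall>f. f \<notin> l2 G \<longrightarrow> T f = (\<lambda>x. 0)) \<and>
     (\<forall>f\<in>l2 G. T f \<in> l2 G) \<and>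
     (\<forall>f\<in>l2 G. \<forall>h\<in>l2 G. \<forall>c. T (\<lambda>x. f x + c * h x) = (\<lambda>x. T f x + c * T h x)) \<and>
     (\<exists>K. \<forall>f\<in>l2 G. l2norm (T f) \<le> K * l2norm f)"

definition opnorm :: "('a, 'b) monoid_scheme \<Rightarrow> 'a op \<Rightarrow> real" where
  "opnorm G T = Sup {l2norm (T f) | f. f \<in> l2 G \<and> l2norm f \<le> 1}"

definition lreg :: "('a, 'b) monoid_scheme \<Rightarrow> 'a \<Rightarrow> 'a op" where
  "lreg G g f = (if f \<in> l2 G
      then (\<lambda>x. if x \<in> carrier G then f (inv\<^bsub>G\<^esub> g \<otimes>\<^bsub>G\<^esub> x) else 0)
      else (\<lambda>x. 0))"

definition group_alg :: "('a, 'b) monoid_scheme \<Rightarrow> 'a op set" where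
  "group_alg G = {T. \<exists>S c. finite S \<and> S \<subseteq> carrier G \<and>
                     T = (\<lambda>f x. \<Sum>g\<in>S. c g * lreg G g f x)}"

definition Cstar_r :: "('a, 'b) monoid_scheme \<Rightarrow> 'a op set" where
  "Cstar_r G = {T. bounded_op G T \<and>
      (\<forall>\<epsilon>>0. \<exists>S\<in>group_alg G. opnorm G (\<lambda>f x. T f x - S f x) < \<epsilon>)}"

definition zero_op :: "'a op" where
  "zero_op = (\<lambda>f x. 0)"

definition closed_ideal :: "('a, 'b) monoid_scheme \<Rightarrow> 'a op set \<Rightarrow> bool" where
  "closed_ideal G I \<longleftrightarrow>
     I \<subseteq> Cstar_r G \<and> zero_op \<in> I \<and>
     (\<forall>a\<in>I. \<forall>b\<in>I. (\<lambda>f x. a f x + b f x) \<in> I) \<and>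
     (\<forall>a\<in>I. \<forall>c::complex. (\<lambda>f x. c * a f x) \<in> I) \<and>
     (\<forall>a\<in>Cstar_r G. \<forall>x\<in>I. a \<circ> x \<in> I \<and> x \<circ> a \<in> I) \<and>
     (\<forall>T\<in>Cstar_r G. (\<forall>\<epsilon>>0. \<exists>x\<in>I. opnorm G (\<lambda>f y. T f y - x f y) < \<epsilon>) \<longrightarrow> T \<in> I)"

definition Cstar_simple :: "('a, 'b) monoid_scheme \<Rightarrow> bool" where
  "Cstar_simple G \<longleftrightarrow> (\<forall>I. closed_ideal G I \<longrightarrow> I = {zero_op} \<or> I = Cstar_r G)"

definition adj :: "('a, 'b) monoid_scheme \<Rightarrow> 'a op \<Rightarrow> 'a op" where
  "adj G T = (SOME S. bounded_op G S \<and>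
      (\<forall>f\<in>l2 G. \<forall>h\<in>l2 G. l2inner (T f) h = l2inner f (S h)))"

definition unit_op :: "('a, 'b) monoid_scheme \<Rightarrow> 'a op" where
  "unit_op G = lreg G \<one>\<^bsub>G\<^esub>"

definition tracial_state :: "('a, 'b) monoid_scheme \<Rightarrow> ('a op \<Rightarrow> complex) \<Rightarrow> bool" where
  "tracial_state G \<tau> \<longleftrightarrow>
     (\<forall>a\<in>Cstar_r G. \<forall>b\<in>Cstar_r G. \<forall>c. \<tau> (\<lambda>f x. a f x + c * b f x) = \<tau> a + c * \<tau> b) \<and>
     (\<forall>a\<in>Cstar_r G. Im (\<tau> (adj G a \<circ> a)) = 0 \<and> Re (\<tau> (adj G a \<circ> a)) \<ge> 0) \<and>
     \<tau> (unit_op G) = 1 \<and>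
     (\<forall>a\<in>Cstar_r G. \<forall>b\<in>Cstar_r G. \<tau> (a \<circ> b) = \<tau> (b \<circ> a))"

definition delta :: "'a \<Rightarrow> 'a \<Rightarrow> complex" where
  "delta g = (\<lambda>x. if x = g then 1 else 0)"

definition can_trace :: "('a, 'b) monoid_scheme \<Rightarrow> 'a op \<Rightarrow> complex" where
  "can_trace G a = l2inner (a (delta \<one>\<^bsub>G\<^esub>)) (delta \<one>\<^bsub>G\<^esub>)"

definition unique_trace :: "('a, 'b) monoid_scheme \<Rightarrow> bool" where
  "unique_trace G \<longleftrightarrow> tracial_state G (can_trace G) \<and>
     (\<forall>\<tau>. tracial_state G \<tau> \<longrightarrow> (\<forall>a\<in>Cstar_r G. \<tau> a = can_trace G a))"

text \<open>Hg s stands for h(s) (s a nonempty 0/1-sequence, True = 1); letters carry a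
  flag, True meaning the inverse of the generator.\<close>
datatype gen = Hg "bool list" | G0 | G1

type_synonym letter = "gen \<times> bool"

fun valid_gen :: "gen \<Rightarrow> bool" where
  "valid_gen (Hg s) = (s \<noteq> [])"
| "valid_gen G0 = True"
| "valid_gen G1 = True"

definition valid_word :: "letter list \<Rightarrow> bool" where
  "valid_word w \<longleftrightarrow> (\<forall>l\<in>set w. valid_gen (fst l))"

abbreviation gl :: "gen \<Rightarrow> letter" where "gl x \<equiv> (x, False)"
abbreviation gi :: "gen \<Rightarrow> letter" where "gi x \<equiv> (x, True)"

text \<open>Conjugation action h(i) h(j) h(i) in the relations of H.\<close>
definition hconj :: "bool list \<Rightarrow> bool list \<Rightarrow> bool list" where
  "hconj i j = (if length j > length i \<and> take (length i) j = i
                then j[length i := \<not> j ! length i] else j)"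

inductive_set relators :: "letter list set" where
  h_sq: "s \<noteq> [] \<Longrightarrow> [gl (Hg s), gl (Hg s)] \<in> relators"
| h_conj: "i \<noteq> [] \<Longrightarrow> length j \<ge> length i \<Longrightarrow>
     [gl (Hg i), gl (Hg j), gl (Hg i), gi (Hg (hconj i j))] \<in> relators"
| g0_sq: "[gl G0, gl G0] \<in> relators"
| g1_sq: "[gl G1, gl G1] \<in> relators"
| g0_h1: "[gl G0, gl (Hg [True]), gl G0, gl (Hg [True]), gl G0, gl (Hg [True])] \<in> relators"
| g1_h0: "[gl G1, gl (Hg [False]), gl G1, gl (Hg [False]), gl G1, gl (Hg [False])] \<in> relators"
| g0_10: "[gl G0, gl (Hg (True # False # r)), gl G0, gi (Hg (False # r))] \<in> relators"
| g0_11: "[gl G0, gl (Hg (True # True # r)), gl G0, gi (Hg (True # True # r))] \<in> relators"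
| g1_00: "[gl G1, gl (Hg (False # False # r)), gl G1, gi (Hg (False # False # r))] \<in> relators"
| g1_01: "[gl G1, gl (Hg (False # True # r)), gl G1, gi (Hg (True # r))] \<in> relators"

inductive weq :: "letter list \<Rightarrow> letter list \<Rightarrow> bool" where
  refl: "weq w w"
| sym: "weq v w \<Longrightarrow> weq w v"
| trans: "weq u v \<Longrightarrow> weq v w \<Longrightarrow> weq u w"
| cancel: "weq (u @ [(x, b), (x, \<not> b)] @ v) (u @ v)"
| rel: "r \<in> relators \<Longrightarrow> weq (u @ r @ v) (u @ v)"

definition wclass :: "letter list \<Rightarrow> letter list set" where
  "wclass w = {v. weq w v}"

definition Gamma :: "letter list set monoid" where
  "Gamma = \<lparr> carrier = {wclass w | w. valid_word w},
             monoid.mult = (\<lambda>A B. {w. \<exists>a\<in>A. \<exists>b\<in>B. weq (a @ b) w}),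
             monoid.one = wclass [] \<rparr>"

end

theory Submission
  imports Defs "HOL-Algebra.Generated_Groups" "HOL-Library.Stream"
begin

text \<open>
  The group acts on infinite binary sequences: \<open>h(s)\<close> flips the digit following the prefix \<open>s\<close>,
  \<open>g\<^sub>0\<close> exchanges \<open>0r\<close> with \<open>10r\<close> and fixes \<open>11r\<close>, \<open>g\<^sub>1\<close> exchanges \<open>1r\<close> with \<open>01r\<close> and fixes \<open>00r\<close>.
  This is the action on the boundary of the Bass-Serre tree, whose half-trees are the cones
  (sets of sequences with a fixed prefix) and their complements.

  Unique trace: the action is faithful, so any \<open>z \<noteq> 1\<close> moves some cone off itself, and the
  complement of that cone has infinitely many pairwise disjoint translates. By Powers' averaging
  argument, averages of conjugates of \<open>\<lambda>(z)\<close> tend to \<open>0\<close> in norm, hence every trace vanishes on \<open>\<lambda>(z)\<close>.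

  Failure of C*-simplicity: \<open>H\<close> is an increasing union of finite groups, and for every \<open>z\<close> one of
  \<open>z\<^sup>-\<^sup>1h(0)z\<close>, \<open>z\<^sup>-\<^sup>1h(1)z\<close> lies in \<open>H\<close>, because \<open>h(0)\<close> and \<open>h(1)\<close> fix complementary half-trees.
  So \<open>(1 - h(0))(1 - h(1))\<close> is a nonzero element killed by the representation on \<open>\<ell>\<^sup>2(\<Gamma>/H)\<close>,
  which factors through the reduced C*-algebra since \<open>H\<close> is amenable.
\<close>

section \<open>Square-summable functions\<close>

text \<open>The definition of a tracial state asks for linearity, positivity on
  \<open>adj G a \<circ> a\<close>, normalisation and the trace identity, but not for continuity,
  while Powers' averages tend to 0 only in norm. Continuity therefore has to be extracted from
  positivity: adjoints must exist inside the algebra, the algebra must be complete, and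
  \<open>1 - a\<close> must have a self-adjoint square root when \<open>a\<close> is self-adjoint of
  norm at most \<open>3/4\<close>. This yields \<open>cmod (\<tau> a) \<le> 3 * K\<close> for every
  positive bound \<open>K\<close> of \<open>a\<close>; any fixed constant would do in place of 3.

  On the group side the obstacle is that words modulo relations do not reveal which of them are
  nontrivial. Elements are only shown to have some alternating form over \<open>H\<close>; that they
  are nontrivial is then detected by the action, through a ping-pong argument outside
  \<open>H\<close> and through flipped digits inside \<open>H\<close>.

  Amenability of \<open>H\<close> enters in its most concrete form: averaging over the finite
  subgroups of an exhausting chain, with the passage to the union done by a limit of norms.\<close>

lemma summable_l2norm_le:
  assumes "0 \<le> K" and fin: "\<And>X. finite X \<Longrightarrow> L2_set (\<lambda>x. cmod (f x)) X \<le> K"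
  shows "(\<lambda>x. (cmod (f x))\<^sup>2) summable_on UNIV" and "l2norm f \<le> K"
proof -
  have *: "(\<Sum>x\<in>X. (cmod (f x))\<^sup>2) \<le> K\<^sup>2" if "finite X" for X
    using fin[OF that] \<open>0 \<le> K\<close> unfolding L2_set_def
    by (metis real_sqrt_le_iff real_sqrt_abs abs_of_nonneg)
  show s: "(\<lambda>x. (cmod (f x))\<^sup>2) summable_on UNIV"
    by (rule nonneg_bdd_above_summable_on) (auto intro!: bdd_aboveI[of _ "K\<^sup>2"] *)
  have "infsum (\<lambda>x. (cmod (f x))\<^sup>2) UNIV \<le> K\<^sup>2"
    by (rule infsum_le_finite_sums[OF s]) (use * in auto)
  then show "l2norm f \<le> K"
    unfolding l2norm_def using \<open>0 \<le> K\<close> real_le_lsqrt by blast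
qed

lemma l2norm_nonneg [simp]: "0 \<le> l2norm f"
  unfolding l2norm_def by (simp add: infsum_nonneg)

text \<open>An infinite \<open>X\<close> is harmless: there the sum, and with it
  \<open>L2_set\<close>, defaults to 0.\<close>

lemma L2_set_le_l2norm:
  assumes "f \<in> l2 G"
  shows "L2_set (\<lambda>x. cmod (f x)) X \<le> l2norm f"
proof (cases "finite X")
  case True
  have "(\<Sum>x\<in>X. (cmod (f x))\<^sup>2) \<le> infsum (\<lambda>x. (cmod (f x))\<^sup>2) UNIV"
    by (rule finite_sum_le_infsum) (use assms True in \<open>auto simp: l2_def\<close>)
  then show ?thesis
    unfolding L2_set_def l2norm_def by simp
qed simp

text \<open>Membership and the norm estimate come from one inequality on finite sets. The triangle
  inequality, restriction to a subset and pointwise limits of operators all enter l2 through this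
  door.\<close>

lemma l2_finite_boundI:
  assumes "0 \<le> K" "\<And>x. x \<notin> carrier G \<Longrightarrow> f x = 0"
    and "\<And>X. finite X \<Longrightarrow> L2_set (\<lambda>x. cmod (f x)) X \<le> K"
  shows "f \<in> l2 G" "l2norm f \<le> K"
  using summable_l2norm_le[of K f] assms unfolding l2_def by auto

lemma l2_outside: "f \<in> l2 G \<Longrightarrow> x \<notin> carrier G \<Longrightarrow> f x = 0"
  by (simp add: l2_def)

lemma cmod_le_l2norm: "f \<in> l2 G \<Longrightarrow> cmod (f x) \<le> l2norm f"
  using L2_set_le_l2norm[of f G "{x}"] by (simp add: L2_set_def)

lemma l2_lincomb:
  assumes "f \<in> l2 G" "h \<in> l2 G"
  shows "(\<lambda>x. f x + c * h x) \<in> l2 G"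
    and l2norm_lincomb: "l2norm (\<lambda>x. f x + c * h x) \<le> l2norm f + cmod c * l2norm h"
proof -
  have *: "L2_set (\<lambda>x. cmod (f x + c * h x)) X \<le> l2norm f + cmod c * l2norm h" for X
  proof -
    have "L2_set (\<lambda>x. cmod (f x + c * h x)) X \<le> L2_set (\<lambda>x. cmod (f x) + cmod c * cmod (h x)) X"
      by (rule L2_set_mono) (auto simp: norm_mult[symmetric] norm_triangle_ineq)
    also have "\<dots> \<le> L2_set (\<lambda>x. cmod (f x)) X + L2_set (\<lambda>x. cmod c * cmod (h x)) X"
      by (rule L2_set_triangle_ineq)
    also have "\<dots> = L2_set (\<lambda>x. cmod (f x)) X + cmod c * L2_set (\<lambda>x. cmod (h x)) X"
      by (simp add: L2_set_right_distrib)
    also have "\<dots> \<le> l2norm f + cmod c * l2norm h"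
      by (intro add_mono mult_left_mono L2_set_le_l2norm[OF assms(1)] L2_set_le_l2norm[OF assms(2)]) auto
    finally show ?thesis .
  qed
  show "(\<lambda>x. f x + c * h x) \<in> l2 G" "l2norm (\<lambda>x. f x + c * h x) \<le> l2norm f + cmod c * l2norm h"
    using l2_finite_boundI[OF _ _ *, of G] assms by (simp_all add: l2_def)
qed

lemma zero_l2 [simp]: "(\<lambda>x. 0) \<in> l2 G"
  by (simp add: l2_def)

lemma l2norm_zero [simp]: "l2norm (\<lambda>x. 0) = 0"
  by (simp add: l2norm_def)

lemma l2_scale: "f \<in> l2 G \<Longrightarrow> (\<lambda>x. c * f x) \<in> l2 G"
  using l2_lincomb(1)[of "\<lambda>x. 0" G f c] by simp

lemma l2norm_scale: "l2norm (\<lambda>x. c * f x) = cmod c * l2norm f"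
  unfolding l2norm_def by (simp add: norm_mult power_mult_distrib infsum_cmult_right' real_sqrt_mult)

lemma l2_add: "f \<in> l2 G \<Longrightarrow> h \<in> l2 G \<Longrightarrow> (\<lambda>x. f x + h x) \<in> l2 G"
  and l2norm_add: "f \<in> l2 G \<Longrightarrow> h \<in> l2 G \<Longrightarrow> l2norm (\<lambda>x. f x + h x) \<le> l2norm f + l2norm h"
  using l2_lincomb[of f G h 1] by simp_all

lemma l2_sum:
  assumes "finite S" "\<And>i. i \<in> S \<Longrightarrow> f i \<in> l2 G"
  shows "(\<lambda>x. \<Sum>i\<in>S. f i x) \<in> l2 G"
    and l2norm_sum: "l2norm (\<lambda>x. \<Sum>i\<in>S. f i x) \<le> (\<Sum>i\<in>S. l2norm (f i))"
proof -
  have "(\<lambda>x. \<Sum>i\<in>S. f i x) \<in> l2 G \<and> l2norm (\<lambda>x. \<Sum>i\<in>S. f i x) \<le> (\<Sum>i\<in>S. l2norm (f i))"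
    using assms
  proof (induction S)
    case (insert i S)
    then show ?case
      using l2_add[of "f i" G "\<lambda>x. \<Sum>i\<in>S. f i x"] l2norm_add[of "f i" G "\<lambda>x. \<Sum>i\<in>S. f i x"]
      by auto
  qed simp
  then show "(\<lambda>x. \<Sum>i\<in>S. f i x) \<in> l2 G" "l2norm (\<lambda>x. \<Sum>i\<in>S. f i x) \<le> (\<Sum>i\<in>S. l2norm (f i))"
    by auto
qed

lemma l2_finite_support:
  assumes "finite X" "X \<subseteq> carrier G" "\<And>x. x \<notin> X \<Longrightarrow> f x = 0"
  shows "f \<in> l2 G"
proof -
  have "(\<lambda>x. (cmod (f x))\<^sup>2) summable_on UNIV \<longleftrightarrow> (\<lambda>x. (cmod (f x))\<^sup>2) summable_on X"
    by (rule summable_on_cong_neutral) (use assms in auto)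
  then show ?thesis
    using assms by (auto simp: l2_def)
qed

lemma l2norm_finite_support:
  assumes "finite X" "\<And>x. x \<notin> X \<Longrightarrow> f x = 0"
  shows "l2norm f = L2_set (\<lambda>x. cmod (f x)) X"
proof -
  have "infsum (\<lambda>x. (cmod (f x))\<^sup>2) UNIV = infsum (\<lambda>x. (cmod (f x))\<^sup>2) X"
    by (rule infsum_cong_neutral) (use assms in auto)
  then show ?thesis
    using assms by (simp add: l2norm_def L2_set_def)
qed

lemma delta_l2: "g \<in> carrier G \<Longrightarrow> delta g \<in> l2 G"
  by (rule l2_finite_support[of "{g}"]) (auto simp: delta_def)

lemma l2norm_delta [simp]: "l2norm (delta g) = 1"
  by (subst l2norm_finite_support[of "{g}"]) (auto simp: delta_def L2_set_def)

subsection \<open>The inner product\<close>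

lemma l2inner_summable:
  assumes "f \<in> l2 G" "h \<in> l2 G"
  shows "(\<lambda>x. norm (f x * cnj (h x))) summable_on UNIV"
    and l2inner_Cauchy_Schwarz: "cmod (l2inner f h) \<le> l2norm f * l2norm h"
proof -
  have *: "(\<Sum>x\<in>X. norm (f x * cnj (h x))) \<le> l2norm f * l2norm h" for X
  proof -
    have "(\<Sum>x\<in>X. norm (f x * cnj (h x))) \<le> L2_set (\<lambda>x. cmod (f x)) X * L2_set (\<lambda>x. cmod (h x)) X"
      using L2_set_mult_ineq[of "\<lambda>x. cmod (f x)" "\<lambda>x. cmod (h x)" X] by (simp add: norm_mult)
    also have "\<dots> \<le> l2norm f * l2norm h"
      by (intro mult_mono L2_set_le_l2norm[OF assms(1)] L2_set_le_l2norm[OF assms(2)]) auto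
    finally show ?thesis .
  qed
  show s: "(\<lambda>x. norm (f x * cnj (h x))) summable_on UNIV"
    by (rule nonneg_bdd_above_summable_on) (auto intro!: bdd_aboveI[of _ "l2norm f * l2norm h"] *)
  have "cmod (l2inner f h) \<le> infsum (\<lambda>x. norm (f x * cnj (h x))) UNIV"
    unfolding l2inner_def by (rule norm_infsum_bound[OF s])
  also have "\<dots> \<le> l2norm f * l2norm h"
    by (rule infsum_le_finite_sums[OF s]) (rule *)
  finally show "cmod (l2inner f h) \<le> l2norm f * l2norm h" .
qed

lemma l2inner_lincomb_left:
  assumes "f \<in> l2 G" "k \<in> l2 G" "h \<in> l2 G"
  shows "l2inner (\<lambda>x. f x + c * k x) h = l2inner f h + c * l2inner k h"
proof -
  have "l2inner (\<lambda>x. f x + c * k x) h = infsum (\<lambda>x. f x * cnj (h x) + c * (k x * cnj (h x))) UNIV"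
    by (simp add: l2inner_def algebra_simps)
  also have "\<dots> = infsum (\<lambda>x. f x * cnj (h x)) UNIV + infsum (\<lambda>x. c * (k x * cnj (h x))) UNIV"
    using abs_summable_summable[OF l2inner_summable(1)[OF assms(1,3)]]
      abs_summable_summable[OF l2inner_summable(1)[OF assms(2,3)]]
    by (intro infsum_add summable_on_cmult_right)
  finally show ?thesis
    by (simp add: l2inner_def infsum_cmult_right')
qed

lemma l2inner_commute: "l2inner h f = cnj (l2inner f h)"
proof -
  have "cnj (l2inner f h) = infsum (\<lambda>x. cnj (f x * cnj (h x))) UNIV"
    unfolding l2inner_def by (rule infsum_cnj[symmetric])
  then show ?thesis
    by (simp add: l2inner_def mult.commute)
qed

lemma l2inner_lincomb_right:
  assumes "f \<in> l2 G" "k \<in> l2 G" "h \<in> l2 G"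
  shows "l2inner h (\<lambda>x. f x + c * k x) = l2inner h f + cnj c * l2inner h k"
  using l2inner_lincomb_left[OF assms, of c] l2inner_commute
  by (metis complex_cnj_add complex_cnj_mult complex_cnj_cnj)

lemma l2inner_self:
  assumes "f \<in> l2 G"
  shows "l2inner f f = complex_of_real ((l2norm f)\<^sup>2)"
proof -
  have "((\<lambda>x. (cmod (f x))\<^sup>2) has_sum infsum (\<lambda>x. (cmod (f x))\<^sup>2) UNIV) UNIV"
    using assms by (intro has_sum_infsum) (simp add: l2_def)
  then have "((\<lambda>x. complex_of_real ((cmod (f x))\<^sup>2)) has_sum
      complex_of_real (infsum (\<lambda>x. (cmod (f x))\<^sup>2) UNIV)) UNIV"
    by (simp only: has_sum_of_real_iff)
  moreover have "f x * cnj (f x) = complex_of_real ((cmod (f x))\<^sup>2)" for x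
    by (simp only: complex_norm_square)
  ultimately have "l2inner f f = complex_of_real (infsum (\<lambda>x. (cmod (f x))\<^sup>2) UNIV)"
    unfolding l2inner_def by (simp only: infsumI)
  then show ?thesis
    by (simp add: l2norm_def infsum_nonneg)
qed

lemma l2inner_delta: "l2inner f (delta y) = f y"
proof -
  have "l2inner f (delta y) = infsum (\<lambda>x. f x * cnj (delta y x)) {y}"
    unfolding l2inner_def by (rule infsum_cong_neutral) (auto simp: delta_def)
  then show ?thesis by (simp add: delta_def)
qed

section \<open>Bounded operators\<close>

text \<open>Estimates are carried by explicit constants: \<open>opnorm\<close> is a supremum,
  informative only once its set is known to be bounded, whereas these bounds combine by plain
  arithmetic.\<close>

definition bnd :: "('a, 'b) monoid_scheme \<Rightarrow> 'a op \<Rightarrow> real \<Rightarrow> bool" where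
  "bnd G T K \<longleftrightarrow> (\<forall>f\<in>l2 G. l2norm (T f) \<le> K * l2norm f)"

text \<open>One operation covers sums, differences and, with \<open>zero_op\<close> as first
  argument, scalar multiples, so that each closure property is proved once.\<close>

definition oplin :: "'a op \<Rightarrow> complex \<Rightarrow> 'a op \<Rightarrow> 'a op" where
  "oplin a c b = (\<lambda>f x. a f x + c * b f x)"

abbreviation opsub :: "'a op \<Rightarrow> 'a op \<Rightarrow> 'a op" where
  "opsub a b \<equiv> (\<lambda>f x. a f x - b f x)"

lemma opsub_oplin: "opsub a b = oplin a (-1) b"
  by (simp add: oplin_def)

lemma bndD: "bnd G T K \<Longrightarrow> f \<in> l2 G \<Longrightarrow> l2norm (T f) \<le> K * l2norm f"
  by (simp add: bnd_def)

lemma bnd_mono: "bnd G T K \<Longrightarrow> K \<le> L \<Longrightarrow> bnd G T L"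
  unfolding bnd_def by (meson l2norm_nonneg mult_right_mono order_trans)

text \<open>The second conclusion holds for every \<open>f\<close>, because operators are normalised
  to 0 outside l2 and 0 itself is in l2.\<close>

lemma bounded_opD:
  assumes "bounded_op G T"
  shows "f \<notin> l2 G \<Longrightarrow> T f = (\<lambda>x. 0)" and "T f \<in> l2 G"
    and "f \<in> l2 G \<Longrightarrow> h \<in> l2 G \<Longrightarrow> T (\<lambda>x. f x + c * h x) = (\<lambda>x. T f x + c * T h x)"
    and "\<exists>K\<ge>0. bnd G T K"
proof -
  show "f \<notin> l2 G \<Longrightarrow> T f = (\<lambda>x. 0)"
    "f \<in> l2 G \<Longrightarrow> h \<in> l2 G \<Longrightarrow> T (\<lambda>x. f x + c * h x) = (\<lambda>x. T f x + c * T h x)"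
    using assms unfolding bounded_op_def by blast+
  show "T f \<in> l2 G"
    using assms unfolding bounded_op_def by (cases "f \<in> l2 G") simp_all
  obtain K where "bnd G T K"
    using assms unfolding bounded_op_def bnd_def by blast
  then have "bnd G T \<bar>K\<bar>"
    by (rule bnd_mono) simp
  then show "\<exists>K\<ge>0. bnd G T K"
    by (meson abs_ge_zero)
qed

lemma bounded_op_zero: "bounded_op G T \<Longrightarrow> T (\<lambda>x. 0) = (\<lambda>x. 0)"
  using bounded_opD(3)[of G T "\<lambda>x. 0" "\<lambda>x. 0" "-1"] by auto

lemma bounded_op_scale: "bounded_op G T \<Longrightarrow> f \<in> l2 G \<Longrightarrow> T (\<lambda>x. c * f x) = (\<lambda>x. c * T f x)"
  using bounded_opD(3)[of G T "\<lambda>x. 0" f c] by (simp add: bounded_op_zero)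

lemma bounded_opI:
  assumes "\<And>f. f \<notin> l2 G \<Longrightarrow> T f = (\<lambda>x. 0)" "\<And>f. f \<in> l2 G \<Longrightarrow> T f \<in> l2 G"
    "\<And>f h c. f \<in> l2 G \<Longrightarrow> h \<in> l2 G \<Longrightarrow> T (\<lambda>x. f x + c * h x) = (\<lambda>x. T f x + c * T h x)"
    "bnd G T K"
  shows "bounded_op G T"
  unfolding bounded_op_def using assms(1,2,3) assms(4)[unfolded bnd_def] by blast

lemma bnd_oplin:
  assumes "bounded_op G a" "bounded_op G b" "bnd G a K" "bnd G b L"
  shows "bnd G (oplin a c b) (K + cmod c * L)"
  unfolding bnd_def oplin_def
proof
  fix f assume f: "f \<in> l2 G"
  have "l2norm (\<lambda>x. a f x + c * b f x) \<le> l2norm (a f) + cmod c * l2norm (b f)"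
    by (rule l2norm_lincomb[OF bounded_opD(2)[OF assms(1)] bounded_opD(2)[OF assms(2)]])
  also have "\<dots> \<le> K * l2norm f + cmod c * (L * l2norm f)"
    by (intro add_mono mult_left_mono bndD[OF assms(3) f] bndD[OF assms(4) f]) auto
  finally show "l2norm (\<lambda>x. a f x + c * b f x) \<le> (K + cmod c * L) * l2norm f"
    by (simp add: algebra_simps)
qed

lemma bounded_op_oplin:
  assumes "bounded_op G a" "bounded_op G b"
  shows "bounded_op G (oplin a c b)"
proof -
  obtain K L where "bnd G a K" "bnd G b L"
    using bounded_opD(4) assms by meson
  show ?thesis
    by (rule bounded_opI[OF _ _ _ bnd_oplin[OF assms \<open>bnd G a K\<close> \<open>bnd G b L\<close>]])
      (auto simp: oplin_def bounded_opD[OF assms(1)] bounded_opD[OF assms(2)] algebra_simps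
        intro!: l2_lincomb(1))
qed

lemma bnd_opsub:
  assumes "bounded_op G a" "bounded_op G b" "bnd G a K" "bnd G b L"
  shows "bnd G (opsub a b) (K + L)"
  using bnd_oplin[OF assms, of "-1"] by (simp add: opsub_oplin)

lemma bounded_op_opsub: "bounded_op G a \<Longrightarrow> bounded_op G b \<Longrightarrow> bounded_op G (opsub a b)"
  unfolding opsub_oplin by (rule bounded_op_oplin)

lemma bnd_comp:
  assumes "bounded_op G b" "bnd G a K" "bnd G b L" "0 \<le> K"
  shows "bnd G (a \<circ> b) (K * L)"
  unfolding bnd_def
proof
  fix f assume f: "f \<in> l2 G"
  have "l2norm (a (b f)) \<le> K * l2norm (b f)"
    by (rule bndD[OF assms(2) bounded_opD(2)[OF assms(1)]])
  also have "\<dots> \<le> K * (L * l2norm f)"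
    by (intro mult_left_mono bndD[OF assms(3) f] assms)
  finally show "l2norm ((a \<circ> b) f) \<le> K * L * l2norm f" by (simp add: mult.assoc)
qed

lemma bounded_op_comp:
  assumes "bounded_op G a" "bounded_op G b"
  shows "bounded_op G (a \<circ> b)"
proof -
  obtain K L where "0 \<le> K" "bnd G a K" "bnd G b L"
    using bounded_opD(4) assms by meson
  show ?thesis
    by (rule bounded_opI[OF _ _ _ bnd_comp[OF assms(2) \<open>bnd G a K\<close> \<open>bnd G b L\<close> \<open>0 \<le> K\<close>]])
      (auto simp: bounded_opD[OF assms(1)] bounded_opD[OF assms(2)] bounded_op_zero[OF assms(1)])
qed

lemma bounded_op_zero_op: "bounded_op G zero_op"
  by (rule bounded_opI[of _ _ 0]) (auto simp: zero_op_def bnd_def)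

lemma bnd_zero_op [simp]: "bnd G zero_op 0"
  by (auto simp: zero_op_def bnd_def)

section \<open>Operator norm versus explicit bounds\<close>

lemma opnorm_le:
  assumes "bnd G T K" "0 \<le> K"
  shows "opnorm G T \<le> K"
  unfolding opnorm_def
proof (rule cSup_least)
  show "{l2norm (T f) |f. f \<in> l2 G \<and> l2norm f \<le> 1} \<noteq> {}"
    using zero_l2 l2norm_zero by (metis (mono_tags, lifting) empty_Collect_eq zero_le_one)
  fix y assume "y \<in> {l2norm (T f) |f. f \<in> l2 G \<and> l2norm f \<le> 1}"
  then obtain f where f: "f \<in> l2 G" "l2norm f \<le> 1" "y = l2norm (T f)" by auto
  then have "y \<le> K * l2norm f" using bndD[OF assms(1)] by auto
  also have "\<dots> \<le> K" using f assms by (simp add: mult_left_le)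
  finally show "y \<le> K" .
qed

text \<open>Rescaling to the unit sphere. With \<open>opnorm_le\<close> this allows
  \<open>opnorm\<close> in the given definitions to be exchanged for \<open>bnd\<close>.\<close>

lemma bnd_opnorm:
  assumes "bounded_op G T"
  shows "bnd G T (opnorm G T)"
  unfolding bnd_def
proof
  fix f assume f: "f \<in> l2 G"
  obtain K where K: "0 \<le> K" "bnd G T K" using bounded_opD(4)[OF assms] by blast
  have bdd: "bdd_above {l2norm (T f) |f. f \<in> l2 G \<and> l2norm f \<le> 1}"
  proof (rule bdd_aboveI[of _ K])
    fix y assume "y \<in> {l2norm (T f) |f. f \<in> l2 G \<and> l2norm f \<le> 1}"
    then obtain f where f: "f \<in> l2 G" "l2norm f \<le> 1" "y = l2norm (T f)" by auto
    then have "y \<le> K * l2norm f" using bndD[OF K(2)] by auto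
    also have "\<dots> \<le> K" using f K by (simp add: mult_left_le)
    finally show "y \<le> K" .
  qed
  show "l2norm (T f) \<le> opnorm G T * l2norm f"
  proof (cases "l2norm f = 0")
    case True
    then show ?thesis using bndD[OF K(2) f] by simp
  next
    case False
    then have pos: "l2norm f > 0" using l2norm_nonneg[of f] by linarith
    define c where "c = complex_of_real (1 / l2norm f)"
    have c: "cmod c = 1 / l2norm f" using pos by (simp add: c_def norm_divide)
    have "l2norm (\<lambda>x. c * f x) = 1" using pos by (simp add: l2norm_scale c)
    then have "l2norm (T (\<lambda>x. c * f x)) \<le> opnorm G T"
      unfolding opnorm_def using l2_scale[OF f] by (intro cSup_upper[OF _ bdd]) auto
    then have "l2norm (T f) / l2norm f \<le> opnorm G T"
      by (simp add: bounded_op_scale[OF assms f] l2norm_scale c)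
    then show ?thesis using pos by (simp add: field_simps)
  qed
qed

lemma op_eqI:
  assumes "bounded_op G a" "bounded_op G b" "\<And>\<epsilon>. \<epsilon> > 0 \<Longrightarrow> bnd G (opsub a b) \<epsilon>"
  shows "a = b"
proof
  fix f
  show "a f = b f"
  proof (cases "f \<in> l2 G")
    case True
    have z: "l2norm (opsub a b f) \<le> 0"
    proof (rule field_le_epsilon)
      fix e :: real assume "e > 0"
      \<comment> \<open>The added 1 keeps the denominator positive when \<open>f\<close> has norm
        0.\<close>
      define \<epsilon> where "\<epsilon> = e / (l2norm f + 1)"
      have n: "0 < l2norm f + 1" using l2norm_nonneg[of f] by linarith
      then have "\<epsilon> > 0" using \<open>e > 0\<close> by (simp add: \<epsilon>_def)
      have "l2norm (opsub a b f) \<le> \<epsilon> * l2norm f" using bndD[OF assms(3)[OF \<open>\<epsilon> > 0\<close>] True] .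
      also have "\<dots> \<le> \<epsilon> * (l2norm f + 1)" using \<open>\<epsilon> > 0\<close> by simp
      also have "\<dots> = e" using n by (simp add: \<epsilon>_def)
      finally show "l2norm (opsub a b f) \<le> 0 + e" by simp
    qed
    show ?thesis
    proof
      fix x
      have "cmod (opsub a b f x) \<le> l2norm (opsub a b f)"
        by (rule cmod_le_l2norm[OF bounded_opD(2)[OF bounded_op_opsub[OF assms(1,2)]]])
      then have "cmod (opsub a b f x) \<le> 0" using z by linarith
      then show "a f x = b f x" by simp
    qed
  qed (simp add: bounded_opD(1)[OF assms(1)] bounded_opD(1)[OF assms(2)])
qed

section \<open>Adjoints of bounded operators\<close>

definition adjp :: "('a, 'b) monoid_scheme \<Rightarrow> 'a op \<Rightarrow> 'a op \<Rightarrow> bool" where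
  "adjp G a b \<longleftrightarrow> (\<forall>f\<in>l2 G. \<forall>h\<in>l2 G. l2inner (a f) h = l2inner f (b h))"

lemma adjp_sym:
  assumes "adjp G a b" shows "adjp G b a"
  unfolding adjp_def
proof (intro ballI)
  fix f h assume "f \<in> l2 G" "h \<in> l2 G"
  then have "l2inner (a h) f = l2inner h (b f)" using assms by (simp add: adjp_def)
  then show "l2inner (b f) h = l2inner f (a h)"
    using l2inner_commute by metis
qed

text \<open>Testing the adjoint relation at \<open>b h\<close> bounds the square of
  \<open>l2norm (b h)\<close> by \<open>K * l2norm (b h) * l2norm h\<close>, and one factor cancels.
  Hence adjoints of a Cauchy sequence are again Cauchy.\<close>

lemma bnd_adjp:
  assumes "bounded_op G a" "bounded_op G b" "adjp G a b" "bnd G a K"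
  shows "bnd G b K"
  unfolding bnd_def
proof
  fix h assume h: "h \<in> l2 G"
  have b: "b h \<in> l2 G" by (rule bounded_opD(2)[OF assms(2)])
  have "(l2norm (b h))\<^sup>2 = cmod (l2inner (b h) (b h))"
    by (simp only: l2inner_self[OF b] norm_of_real abs_of_nonneg zero_le_power2)
  also have "\<dots> = cmod (l2inner (a (b h)) h)"
    using assms(3) b h by (simp add: adjp_def)
  also have "\<dots> \<le> l2norm (a (b h)) * l2norm h"
    by (rule l2inner_Cauchy_Schwarz[OF bounded_opD(2)[OF assms(1)] h])
  also have "\<dots> \<le> K * l2norm (b h) * l2norm h"
    by (intro mult_right_mono bndD[OF assms(4) b]) simp
  finally have *: "l2norm (b h) * l2norm (b h) \<le> l2norm (b h) * (K * l2norm h)"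
    by (simp add: power2_eq_square algebra_simps)
  show "l2norm (b h) \<le> K * l2norm h"
  proof (cases "l2norm (b h) = 0")
    case True
    show ?thesis
    proof (cases "l2norm h = 0")
      case False
      \<comment> \<open>The sign of \<open>K\<close> is unknown, so
        \<open>0 \<le> K * l2norm h\<close> is read off from the bound on
        \<open>a h\<close>.\<close>
      have "0 \<le> l2norm (a h)" by simp
      also have "\<dots> \<le> K * l2norm h" by (rule bndD[OF assms(4) h])
      finally show ?thesis using True by simp
    qed (use True in simp)
  next
    case False
    then have "l2norm (b h) > 0" using l2norm_nonneg[of "b h"] by linarith
    then show ?thesis using * by (simp only: mult_le_cancel_left_pos)
  qed
qed

text \<open>Pairing with the vectors \<open>delta x\<close> recovers every coordinate of
  \<open>b h\<close>.\<close>

lemma adjp_unique: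
  assumes "bounded_op G b" "bounded_op G b'" "adjp G a b" "adjp G a b'"
  shows "b = b'"
proof
  fix h
  show "b h = b' h"
  proof (cases "h \<in> l2 G")
    case True
    show ?thesis
    proof
      fix x
      show "b h x = b' h x"
      proof (cases "x \<in> carrier G")
        case x: True
        have "l2inner (delta x) (b h) = l2inner (delta x) (b' h)"
          using assms(3,4) delta_l2[OF x] True by (auto simp: adjp_def)
        then show ?thesis using l2inner_delta l2inner_commute by metis
      next
        case False
        then show ?thesis
          using l2_outside bounded_opD(2) assms(1,2) by metis
      qed
    qed
  qed (simp add: bounded_opD(1)[OF assms(1)] bounded_opD(1)[OF assms(2)])
qed

text \<open>\<open>adj\<close> is a choice and says nothing until some bounded adjoint is exhibited;
  uniqueness then pins it down. All arguments up to that point use the relation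
  \<open>adjp\<close>.\<close>

lemma adj_eqI:
  assumes "bounded_op G b" "adjp G a b"
  shows "adj G a = b"
  unfolding adj_def
proof (rule some_equality)
  show "bounded_op G b \<and> (\<forall>f\<in>l2 G. \<forall>h\<in>l2 G. l2inner (a f) h = l2inner f (b h))"
    using assms by (auto simp: adjp_def)
  fix c assume "bounded_op G c \<and> (\<forall>f\<in>l2 G. \<forall>h\<in>l2 G. l2inner (a f) h = l2inner f (c h))"
  then show "c = b"
    using adjp_unique[of G c b a] assms unfolding adjp_def by blast
qed

lemma adjp_oplin:
  assumes "bounded_op G a" "bounded_op G b" "bounded_op G a'" "bounded_op G b'"
    "adjp G a a'" "adjp G b b'"
  shows "adjp G (oplin a c b) (oplin a' (cnj c) b')"
  unfolding adjp_def oplin_def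
proof (intro ballI)
  fix f h assume f: "f \<in> l2 G" and h: "h \<in> l2 G"
  show "l2inner (\<lambda>x. a f x + c * b f x) h = l2inner f (\<lambda>x. a' h x + cnj c * b' h x)"
    using assms(5,6) f h
    by (simp add: adjp_def l2inner_lincomb_left[OF bounded_opD(2)[OF assms(1)] bounded_opD(2)[OF assms(2)] h]
        l2inner_lincomb_right[OF bounded_opD(2)[OF assms(3)] bounded_opD(2)[OF assms(4)] f])
qed

lemma adjp_comp:
  assumes "bounded_op G b" "bounded_op G a'" "adjp G a a'" "adjp G b b'"
  shows "adjp G (a \<circ> b) (b' \<circ> a')"
  using assms bounded_opD(2)[OF assms(1)] bounded_opD(2)[OF assms(2)] unfolding adjp_def by auto

lemma adjp_limit:
  assumes "bounded_op G a" "bounded_op G b" "\<And>n. bounded_op G (A n)" "\<And>n. bounded_op G (B n)"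
    "\<And>n. adjp G (A n) (B n)"
    "\<And>n. bnd G (opsub a (A n)) (e n)" "\<And>n. bnd G (opsub b (B n)) (e n)" "e \<longlonglongrightarrow> 0"
  shows "adjp G a b"
  unfolding adjp_def
proof (intro ballI)
  fix f h assume f: "f \<in> l2 G" and h: "h \<in> l2 G"
  have "cmod (l2inner (a f) h - l2inner f (b h)) \<le> 2 * (l2norm f * l2norm h) * e n" for n
  proof -
    have 1: "l2inner (opsub a (A n) f) h = l2inner (a f) h - l2inner (A n f) h"
      using l2inner_lincomb_left[OF bounded_opD(2)[OF assms(1)] bounded_opD(2)[OF assms(3)] h, of f "-1"]
      by simp
    have 2: "l2inner f (opsub b (B n) h) = l2inner f (b h) - l2inner f (B n h)"
      using l2inner_lincomb_right[OF bounded_opD(2)[OF assms(2)] bounded_opD(2)[OF assms(4)] f, of h "-1"]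
      by simp
    have "l2inner (a f) h - l2inner f (b h) = l2inner (opsub a (A n) f) h - l2inner f (opsub b (B n) h)"
      unfolding 1 2 using assms(5)[of n] f h by (simp add: adjp_def)
    then have "cmod (l2inner (a f) h - l2inner f (b h))
        \<le> cmod (l2inner (opsub a (A n) f) h) + cmod (l2inner f (opsub b (B n) h))"
      using norm_triangle_ineq4 by metis
    also have "\<dots> \<le> l2norm (opsub a (A n) f) * l2norm h + l2norm f * l2norm (opsub b (B n) h)"
      by (intro add_mono l2inner_Cauchy_Schwarz[of _ G]
          bounded_opD(2)[OF bounded_op_opsub] assms f h)
    also have "\<dots> \<le> (e n * l2norm f) * l2norm h + l2norm f * (e n * l2norm h)"
      by (intro add_mono mult_right_mono mult_left_mono bndD[OF assms(6)] bndD[OF assms(7)] f h) auto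
    finally show ?thesis by (simp add: algebra_simps)
  qed
  moreover have "(\<lambda>n. 2 * (l2norm f * l2norm h) * e n) \<longlonglongrightarrow> 2 * (l2norm f * l2norm h) * 0"
    by (intro tendsto_intros assms)
  ultimately have "cmod (l2inner (a f) h - l2inner f (b h)) \<le> 0"
    by (intro LIMSEQ_le_const) auto
  then show "l2inner (a f) h = l2inner f (b h)" by simp
qed

text \<open>Pointwise limits of a norm-Cauchy sequence; Fatou on finite sets makes the limit bounded.\<close>
lemma bounded_op_complete:
  assumes A: "\<And>n. bounded_op G (A n)" and e: "e \<longlonglongrightarrow> 0" "\<And>n. 0 \<le> e n"
    and cau: "\<And>m n. n \<le> m \<Longrightarrow> bnd G (opsub (A m) (A n)) (e n)"
  obtains T where "bounded_op G T" "\<And>n. bnd G (opsub T (A n)) (e n)"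
proof -
  define T where "T f x = lim (\<lambda>n. A n f x)" for f x
  have dist: "cmod (A m f x - A n f x) \<le> e n * l2norm f" if "n \<le> m" "f \<in> l2 G" for m n f x
  proof -
    have "cmod (opsub (A m) (A n) f x) \<le> l2norm (opsub (A m) (A n) f)"
      by (rule cmod_le_l2norm[OF bounded_opD(2)[OF bounded_op_opsub[OF A A]]])
    also have "\<dots> \<le> e n * l2norm f" by (rule bndD[OF cau]) fact+
    finally show ?thesis .
  qed
  have conv: "(\<lambda>n. A n f x) \<longlonglongrightarrow> T f x" for f x
  proof (cases "f \<in> l2 G")
    case True
    have "Cauchy (\<lambda>n. A n f x)"
    proof (rule metric_CauchyI)
      fix \<epsilon> :: real assume "\<epsilon> > 0"
      have "(\<lambda>n. e n * l2norm f) \<longlonglongrightarrow> 0 * l2norm f"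
        by (intro tendsto_intros e)
      then have "\<forall>\<^sub>F n in sequentially. e n * l2norm f < \<epsilon> / 2"
        using order_tendstoD(2)[of _ "0 * l2norm f" _ "\<epsilon> / 2"] \<open>\<epsilon> > 0\<close> by simp
      then obtain N where N: "e N * l2norm f < \<epsilon> / 2"
        by (auto simp: eventually_sequentially)
      have "dist (A m f x) (A n f x) < \<epsilon>" if "N \<le> m" "N \<le> n" for m n
      proof -
        have "dist (A m f x) (A n f x) \<le> dist (A m f x) (A N f x) + dist (A n f x) (A N f x)"
          by (rule dist_triangle2)
        also have "\<dots> < \<epsilon>"
          using dist[OF that(1) True, of x] dist[OF that(2) True, of x] N by (simp add: dist_norm)
        finally show ?thesis .
      qed
      then show "\<exists>M. \<forall>m\<ge>M. \<forall>n\<ge>M. dist (A m f x) (A n f x) < \<epsilon>" by blast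
    qed
    then show ?thesis
      unfolding T_def by (simp add: Cauchy_convergent_iff convergent_LIMSEQ_iff)
  next
    case False
    then show ?thesis by (simp add: T_def bounded_opD(1)[OF A])
  qed
  have lin: "T (\<lambda>x. f x + c * h x) = (\<lambda>x. T f x + c * T h x)" if "f \<in> l2 G" "h \<in> l2 G" for f h c
  proof
    fix x
    have "(\<lambda>n. A n (\<lambda>x. f x + c * h x) x) \<longlonglongrightarrow> T f x + c * T h x"
      unfolding bounded_opD(3)[OF A that] by (intro tendsto_intros conv)
    then show "T (\<lambda>x. f x + c * h x) x = T f x + c * T h x"
      using conv LIMSEQ_unique by blast
  qed
  have out: "T f = (\<lambda>x. 0)" if "f \<notin> l2 G" for f
    using that by (auto simp: T_def bounded_opD(1)[OF A])
  have diff: "opsub T (A n) f \<in> l2 G \<and> l2norm (opsub T (A n) f) \<le> e n * l2norm f" if f: "f \<in> l2 G" for n f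
  proof -
    have fin: "L2_set (\<lambda>x. cmod (opsub T (A n) f x)) X \<le> e n * l2norm f" for X
    proof (rule LIMSEQ_le_const2)
      show "(\<lambda>m. L2_set (\<lambda>x. cmod (A m f x - A n f x)) X) \<longlonglongrightarrow> L2_set (\<lambda>x. cmod (opsub T (A n) f x)) X"
        unfolding L2_set_def by (intro tendsto_intros conv)
      have "L2_set (\<lambda>x. cmod (A m f x - A n f x)) X \<le> e n * l2norm f" if "n \<le> m" for m
        using order_trans[OF L2_set_le_l2norm[OF bounded_opD(2)[OF bounded_op_opsub[OF A A]]]
          bndD[OF cau[OF that] f]] .
      then show "\<exists>N. \<forall>m\<ge>N. L2_set (\<lambda>x. cmod (A m f x - A n f x)) X \<le> e n * l2norm f" by blast
    qed
    have "T f x = 0" if "x \<notin> carrier G" for x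
      using l2_outside[OF bounded_opD(2)[OF A] that] by (simp add: T_def)
    then show ?thesis
      using l2_finite_boundI[OF _ _ fin, of G] l2_outside[OF bounded_opD(2)[OF A]] e(2)[of n]
      by simp
  qed
  have bd: "bnd G (opsub T (A n)) (e n)" for n
    using diff by (auto simp: bnd_def)
  have mem: "T f \<in> l2 G" if "f \<in> l2 G" for f
    using l2_add[OF conjunct1[OF diff[OF that, of 0]] bounded_opD(2)[OF A[of 0], of f]] by simp
  \<comment> \<open>Only differences are controlled directly, so \<open>T\<close> is recovered as
    \<open>(T - A 0) + A 0\<close>.\<close>
  have "bounded_op G (opsub T (A 0))"
    by (rule bounded_opI[OF _ _ _ bd])
      (auto simp: out bounded_opD(1)[OF A] diff lin bounded_opD(3)[OF A] algebra_simps)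
  from bounded_op_oplin[OF this A[of 0], of 1] have "bounded_op G T"
    by (simp add: oplin_def)
  then show thesis using bd that by blast
qed

section \<open>The reduced group C*-algebra\<close>

context group
begin

lemma bij_betw_translate: "g \<in> carrier G \<Longrightarrow> bij_betw (\<lambda>x. g \<otimes> x) (carrier G) (carrier G)"
  by (rule bij_betwI[where g = "\<lambda>x. inv g \<otimes> x"]) (auto simp: m_assoc[symmetric])

lemma lreg_apply: "f \<in> l2 G \<Longrightarrow> lreg G g f x = (if x \<in> carrier G then f (inv g \<otimes> x) else 0)"
  by (simp add: lreg_def)

lemma lreg_outside: "f \<notin> l2 G \<Longrightarrow> lreg G g f = (\<lambda>x. 0)"
  by (simp add: lreg_def)

lemma lreg_l2:
  assumes g: "g \<in> carrier G" and f: "f \<in> l2 G"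
  shows "lreg G g f \<in> l2 G" and l2norm_lreg: "l2norm (lreg G g f) = l2norm f"
proof -
  have 1: "(\<lambda>x. (cmod (lreg G g f x))\<^sup>2) summable_on UNIV \<longleftrightarrow>
      (\<lambda>x. (cmod (f (inv g \<otimes> x)))\<^sup>2) summable_on carrier G"
    by (rule summable_on_cong_neutral) (auto simp: lreg_apply[OF f])
  have 2: "(\<lambda>x. (cmod (f x))\<^sup>2) summable_on UNIV \<longleftrightarrow> (\<lambda>x. (cmod (f x))\<^sup>2) summable_on carrier G"
    by (rule summable_on_cong_neutral) (auto simp: l2_outside[OF f])
  have 3: "infsum (\<lambda>x. (cmod (lreg G g f x))\<^sup>2) UNIV =
      infsum (\<lambda>x. (cmod (f (inv g \<otimes> x)))\<^sup>2) (carrier G)"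
    by (rule infsum_cong_neutral) (auto simp: lreg_apply[OF f])
  have 4: "infsum (\<lambda>x. (cmod (f x))\<^sup>2) UNIV = infsum (\<lambda>x. (cmod (f x))\<^sup>2) (carrier G)"
    by (rule infsum_cong_neutral) (auto simp: l2_outside[OF f])
  note bij = bij_betw_translate[OF inv_closed[OF g]]
  show "lreg G g f \<in> l2 G"
    using f 1 2 summable_on_reindex_bij_betw[OF bij, of "\<lambda>x. (cmod (f x))\<^sup>2"]
    by (simp add: l2_def lreg_def)
  show "l2norm (lreg G g f) = l2norm f"
    unfolding l2norm_def 3 4 using infsum_reindex_bij_betw[OF bij, of "\<lambda>x. (cmod (f x))\<^sup>2"] by simp
qed

lemma bnd_lreg: "g \<in> carrier G \<Longrightarrow> bnd G (lreg G g) 1"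
  by (simp add: bnd_def l2norm_lreg)

lemma bounded_op_lreg: "g \<in> carrier G \<Longrightarrow> bounded_op G (lreg G g)"
  by (rule bounded_opI[of _ _ 1]) (auto simp: lreg_outside lreg_l2 lreg_apply l2_lincomb(1) bnd_lreg)

lemma lreg_one: "f \<in> l2 G \<Longrightarrow> lreg G \<one> f = f"
  by (auto simp: lreg_apply l2_outside)

lemma lreg_mult:
  assumes "g \<in> carrier G" "h \<in> carrier G"
  shows "lreg G g \<circ> lreg G h = lreg G (g \<otimes> h)"
proof
  fix f
  show "(lreg G g \<circ> lreg G h) f = lreg G (g \<otimes> h) f"
  proof (cases "f \<in> l2 G")
    case True
    then show ?thesis
      using assms by (auto simp: lreg_apply lreg_l2 inv_mult_group m_assoc)
  qed (auto simp: lreg_outside lreg_apply)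
qed

lemma lreg_delta:
  assumes "g \<in> carrier G" "x \<in> carrier G"
  shows "lreg G g (delta x) = delta (g \<otimes> x)"
proof
  fix y
  have "inv g \<otimes> y = x \<longleftrightarrow> y = g \<otimes> x" if "y \<in> carrier G"
    using assms that inv_solve_left'[of y g x] by (metis inv_closed inv_inv inv_solve_left)
  then show "lreg G g (delta x) y = delta (g \<otimes> x) y"
    using assms by (auto simp: lreg_apply[OF delta_l2[OF assms(2)]]) (auto simp: delta_def)
qed

lemma adjp_lreg:
  assumes g: "g \<in> carrier G"
  shows "adjp G (lreg G g) (lreg G (inv g))"
  unfolding adjp_def
proof (intro ballI)
  fix f h assume f: "f \<in> l2 G" and h: "h \<in> l2 G"
  have "l2inner (lreg G g f) h = infsum (\<lambda>x. f (inv g \<otimes> x) * cnj (h x)) (carrier G)"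
    unfolding l2inner_def by (rule infsum_cong_neutral) (auto simp: lreg_apply[OF f])
  also have "\<dots> = infsum (\<lambda>x. f (inv g \<otimes> (g \<otimes> x)) * cnj (h (g \<otimes> x))) (carrier G)"
    using infsum_reindex_bij_betw[OF bij_betw_translate[OF g], of "\<lambda>x. f (inv g \<otimes> x) * cnj (h x)"]
    by simp
  also have "\<dots> = infsum (\<lambda>x. f x * cnj (h (g \<otimes> x))) (carrier G)"
    using g by (intro infsum_cong) (simp add: m_assoc[symmetric])
  also have "\<dots> = l2inner f (lreg G (inv g) h)"
    unfolding l2inner_def using g
    by (intro infsum_cong_neutral) (auto simp: lreg_apply[OF h] l2_outside[OF f])
  finally show "l2inner (lreg G g f) h = l2inner f (lreg G (inv g) h)" .
qed

subsection \<open>The group algebra\<close>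

lemma group_alg_zero: "zero_op \<in> group_alg G"
  by (auto simp: group_alg_def zero_op_def intro!: exI[of _ "{}"])

lemma group_alg_oplin_lreg:
  assumes "T \<in> group_alg G" "g \<in> carrier G"
  shows "oplin T c (lreg G g) \<in> group_alg G"
proof -
  obtain S d where S: "finite S" "S \<subseteq> carrier G" "T = (\<lambda>f x. \<Sum>g\<in>S. d g * lreg G g f x)"
    using assms(1) by (auto simp: group_alg_def)
  \<comment> \<open>\<open>g\<close> may already belong to \<open>S\<close>, in which case its
    coefficients add up; off \<open>S\<close> the old coefficient function is arbitrary and has to
    be masked.\<close>
  define d' where "d' x = (if x \<in> S then d x else 0) + (if x = g then c else 0)" for x
  have "oplin T c (lreg G g) f x = (\<Sum>k\<in>insert g S. d' k * lreg G k f x)" for f x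
  proof -
    have "(\<Sum>k\<in>insert g S. (if k \<in> S then d k else 0) * lreg G k f x) = (\<Sum>k\<in>S. d k * lreg G k f x)"
      by (rule sum.mono_neutral_cong_right) (use S(1) in auto)
    moreover have "(\<Sum>k\<in>insert g S. (if k = g then c else 0) * lreg G k f x)
        = (\<Sum>k\<in>{g}. c * lreg G k f x)"
      by (rule sum.mono_neutral_cong_right) (use S(1) in auto)
    ultimately show ?thesis
      by (simp only: d'_def oplin_def S(3) distrib_right sum.distrib) simp
  qed
  then show ?thesis
    unfolding group_alg_def using S assms(2) by (intro CollectI exI[of _ "insert g S"] exI[of _ d']) auto
qed

text \<open>Facts about finite sums of translations reduce to adding one translation at a time,
  without handling the support set.\<close>

lemma group_alg_induct [consumes 1, case_names zero add]:
  assumes "T \<in> group_alg G" and z: "P zero_op"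
    and step: "\<And>T c g. T \<in> group_alg G \<Longrightarrow> P T \<Longrightarrow> g \<in> carrier G \<Longrightarrow> P (oplin T c (lreg G g))"
  shows "P T"
proof -
  obtain S d where S: "finite S" "S \<subseteq> carrier G" "T = (\<lambda>f x. \<Sum>g\<in>S. d g * lreg G g f x)"
    using assms(1) by (auto simp: group_alg_def)
  have "(\<lambda>f x. \<Sum>g\<in>S. d g * lreg G g f x) \<in> group_alg G \<and> P (\<lambda>f x. \<Sum>g\<in>S. d g * lreg G g f x)"
    using S(1,2)
  proof (induction S)
    case empty
    then show ?case using z group_alg_zero by (simp add: zero_op_def)
  next
    case (insert g S)
    then have "(\<lambda>f x. \<Sum>g\<in>insert g S. d g * lreg G g f x)
        = oplin (\<lambda>f x. \<Sum>g\<in>S. d g * lreg G g f x) (d g) (lreg G g)"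
      by (simp add: oplin_def add.commute)
    then show ?case using insert step group_alg_oplin_lreg by simp
  qed
  then show ?thesis using S by simp
qed

lemma group_alg_oplin:
  assumes "T \<in> group_alg G" "T' \<in> group_alg G"
  shows "oplin T c T' \<in> group_alg G"
  using assms(2)
proof (induction rule: group_alg_induct)
  case zero
  then show ?case using assms(1) by (simp add: oplin_def zero_op_def)
next
  case (add T' d g)
  have "oplin T c (oplin T' d (lreg G g)) = oplin (oplin T c T') (c * d) (lreg G g)"
    by (simp add: oplin_def algebra_simps)
  then show ?case using group_alg_oplin_lreg[OF add(3,2)] by simp
qed

lemma group_alg_lreg: "g \<in> carrier G \<Longrightarrow> lreg G g \<in> group_alg G"
  using group_alg_oplin_lreg[OF group_alg_zero, of g 1] by (simp add: oplin_def zero_op_def)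

lemma group_alg_bounded: "T \<in> group_alg G \<Longrightarrow> bounded_op G T"
  by (induction rule: group_alg_induct) (auto intro: bounded_op_zero_op bounded_op_oplin bounded_op_lreg)

lemma comp_oplin:
  assumes "bounded_op G a" "bounded_op G b" "bounded_op G d"
  shows "a \<circ> oplin b c d = oplin (a \<circ> b) c (a \<circ> d)"
  using bounded_opD(3)[OF assms(1) bounded_opD(2)[OF assms(2)] bounded_opD(2)[OF assms(3)]]
  by (auto simp: oplin_def)

lemma oplin_comp: "oplin b c d \<circ> a = oplin (b \<circ> a) c (d \<circ> a)"
  by (auto simp: oplin_def)

lemma group_alg_comp:
  assumes T: "T \<in> group_alg G" "T' \<in> group_alg G"
  shows "T \<circ> T' \<in> group_alg G"
proof -
  have *: "lreg G g \<circ> T' \<in> group_alg G" if g: "g \<in> carrier G" for g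
    using T(2)
  proof (induction rule: group_alg_induct)
    case zero
    have "lreg G g \<circ> zero_op = zero_op"
      using bounded_op_zero[OF bounded_op_lreg[OF g]] by (auto simp: zero_op_def)
    then show ?case by (simp add: group_alg_zero)
  next
    case (add T c h)
    then show ?case
      using g group_alg_oplin_lreg[OF add(3) m_closed[OF g add(2)]]
        comp_oplin[OF bounded_op_lreg[OF g] group_alg_bounded[OF add(1)] bounded_op_lreg[OF add(2)]]
      by (simp only: lreg_mult)
  qed
  show ?thesis using T(1)
  proof (induction rule: group_alg_induct)
    case zero
    have "zero_op \<circ> T' = zero_op" by (auto simp: zero_op_def)
    then show ?case by (simp add: group_alg_zero)
  next
    case (add T c h)
    then show ?case using * by (simp only: oplin_comp group_alg_oplin)
  qed
qed

lemma adjp_zero: "adjp G zero_op zero_op"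
  by (simp add: adjp_def zero_op_def l2inner_def)

lemma group_alg_adjoint:
  assumes "T \<in> group_alg G"
  shows "\<exists>T'\<in>group_alg G. adjp G T T'"
  using assms
proof (induction rule: group_alg_induct)
  case zero
  then show ?case using group_alg_zero adjp_zero by blast
next
  case (add T c g)
  then obtain T' where T': "T' \<in> group_alg G" "adjp G T T'" by blast
  have "adjp G (oplin T c (lreg G g)) (oplin T' (cnj c) (lreg G (inv g)))"
    by (intro adjp_oplin group_alg_bounded bounded_op_lreg adjp_lreg inv_closed add T')
  then show ?case using T' add(2) group_alg_oplin_lreg inv_closed by blast
qed

text \<open>The elements \<open>k j\<close> may coincide, as conjugates of one element can, so this
  sum is not literally of the form demanded by \<open>group_alg\<close>.\<close>

lemma group_alg_sum:
  assumes "finite J" "\<And>j. j \<in> J \<Longrightarrow> k j \<in> carrier G"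
  shows "(\<lambda>f x. \<Sum>j\<in>J. c j * lreg G (k j) f x) \<in> group_alg G"
  using assms
proof (induction J)
  case empty
  then show ?case using group_alg_zero by (simp add: zero_op_def)
next
  case (insert j J)
  then have "(\<lambda>f x. \<Sum>j\<in>insert j J. c j * lreg G (k j) f x)
      = oplin (\<lambda>f x. \<Sum>j\<in>J. c j * lreg G (k j) f x) (c j) (lreg G (k j))"
    by (simp add: oplin_def add.commute)
  then show ?case using insert group_alg_oplin_lreg by simp
qed

subsection \<open>Closure properties\<close>

text \<open>Replaces a strict inequality for \<open>opnorm\<close> by a non-strict bound; halving
  \<open>\<epsilon>\<close> restores strictness.\<close>

lemma Cstar_iff:
  "T \<in> Cstar_r G \<longleftrightarrow> bounded_op G T \<and> (\<forall>\<epsilon>>0. \<exists>S\<in>group_alg G. bnd G (opsub T S) \<epsilon>)"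
proof -
  have "(\<forall>\<epsilon>>0. \<exists>S\<in>group_alg G. opnorm G (opsub T S) < \<epsilon>) \<longleftrightarrow> (\<forall>\<epsilon>>0. \<exists>S\<in>group_alg G. bnd G (opsub T S) \<epsilon>)"
    if T: "bounded_op G T"
  proof (intro iffI allI impI)
    fix \<epsilon> :: real assume *: "\<forall>\<epsilon>>0. \<exists>S\<in>group_alg G. opnorm G (opsub T S) < \<epsilon>" and "0 < \<epsilon>"
    then obtain S where S: "S \<in> group_alg G" "opnorm G (opsub T S) < \<epsilon>" by blast
    have "bnd G (opsub T S) (opnorm G (opsub T S))"
      by (intro bnd_opnorm bounded_op_opsub T group_alg_bounded S)
    then show "\<exists>S\<in>group_alg G. bnd G (opsub T S) \<epsilon>"
      using S bnd_mono less_imp_le by blast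
  next
    fix \<epsilon> :: real assume *: "\<forall>\<epsilon>>0. \<exists>S\<in>group_alg G. bnd G (opsub T S) \<epsilon>" and "0 < \<epsilon>"
    then obtain S where S: "S \<in> group_alg G" "bnd G (opsub T S) (\<epsilon> / 2)"
      by (meson half_gt_zero)
    then have "opnorm G (opsub T S) \<le> \<epsilon> / 2" using \<open>0 < \<epsilon>\<close> by (intro opnorm_le) auto
    then have "opnorm G (opsub T S) < \<epsilon>" using \<open>0 < \<epsilon>\<close> by linarith
    then show "\<exists>S\<in>group_alg G. opnorm G (opsub T S) < \<epsilon>" using S by blast
  qed
  then show ?thesis by (auto simp: Cstar_r_def)
qed

lemma Cstar_bounded: "T \<in> Cstar_r G \<Longrightarrow> bounded_op G T"
  by (simp add: Cstar_iff)

lemma Cstar_approx: "T \<in> Cstar_r G \<Longrightarrow> 0 < \<epsilon> \<Longrightarrow> \<exists>S\<in>group_alg G. bnd G (opsub T S) \<epsilon>"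
  by (simp add: Cstar_iff)

lemma group_alg_Cstar: "T \<in> group_alg G \<Longrightarrow> T \<in> Cstar_r G"
  by (force simp: Cstar_iff group_alg_bounded bnd_def)

lemma Cstar_closed:
  assumes T: "bounded_op G T" and "\<And>\<epsilon>. 0 < \<epsilon> \<Longrightarrow> \<exists>a\<in>Cstar_r G. bnd G (opsub T a) \<epsilon>"
  shows "T \<in> Cstar_r G"
  unfolding Cstar_iff
proof (intro conjI allI impI T)
  fix \<epsilon> :: real assume "0 < \<epsilon>"
  then obtain a where a: "a \<in> Cstar_r G" "bnd G (opsub T a) (\<epsilon> / 2)"
    using assms(2) half_gt_zero by blast
  then obtain S where S: "S \<in> group_alg G" "bnd G (opsub a S) (\<epsilon> / 2)"
    using Cstar_approx \<open>0 < \<epsilon>\<close> half_gt_zero by blast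
  have "bnd G (oplin (opsub T a) 1 (opsub a S)) (\<epsilon> / 2 + cmod 1 * (\<epsilon> / 2))"
    by (intro bnd_oplin bounded_op_opsub a S T Cstar_bounded group_alg_bounded)
  then have "bnd G (opsub T S) \<epsilon>" by (simp add: oplin_def)
  then show "\<exists>S\<in>group_alg G. bnd G (opsub T S) \<epsilon>" using S by blast
qed

lemma Cstar_oplin:
  assumes a: "a \<in> Cstar_r G" and b: "b \<in> Cstar_r G"
  shows "oplin a c b \<in> Cstar_r G"
proof (rule Cstar_closed)
  show "bounded_op G (oplin a c b)" by (intro bounded_op_oplin Cstar_bounded a b)
  fix \<epsilon> :: real assume "0 < \<epsilon>"
  define \<delta> where "\<delta> = \<epsilon> / (1 + cmod c)"
  have pos: "0 < 1 + cmod c" by (rule add_pos_nonneg) auto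
  then have "0 < \<delta>" using \<open>0 < \<epsilon>\<close> by (simp add: \<delta>_def)
  then obtain S T where S: "S \<in> group_alg G" "bnd G (opsub a S) \<delta>"
    and T: "T \<in> group_alg G" "bnd G (opsub b T) \<delta>"
    using Cstar_approx a b by meson
  have "bnd G (oplin (opsub a S) c (opsub b T)) (\<delta> + cmod c * \<delta>)"
    by (intro bnd_oplin bounded_op_opsub a b S T Cstar_bounded group_alg_bounded)
  moreover have "\<delta> + cmod c * \<delta> = \<epsilon>"
    using pos unfolding \<delta>_def by (metis distrib_right mult_1 nonzero_mult_div_cancel_left
        less_irrefl times_divide_eq_right)
  moreover have "oplin (opsub a S) c (opsub b T) = opsub (oplin a c b) (oplin S c T)"
    by (simp add: oplin_def algebra_simps)
  ultimately show "\<exists>x\<in>Cstar_r G. bnd G (opsub (oplin a c b) x) \<epsilon>"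
    using group_alg_Cstar[OF group_alg_oplin[OF S(1) T(1)]] by metis
qed

lemma comp_opsub:
  assumes "bounded_op G a" "bounded_op G b" "bounded_op G d"
  shows "a \<circ> opsub b d = opsub (a \<circ> b) (a \<circ> d)"
  using comp_oplin[OF assms, of "-1"] by (simp add: oplin_def o_def)

lemma Cstar_comp:
  assumes a: "a \<in> Cstar_r G" and b: "b \<in> Cstar_r G"
  shows "a \<circ> b \<in> Cstar_r G"
proof (rule Cstar_closed)
  show "bounded_op G (a \<circ> b)" by (intro bounded_op_comp Cstar_bounded a b)
  fix \<epsilon> :: real assume "0 < \<epsilon>"
  obtain K where K: "0 \<le> K" "bnd G b K" using bounded_opD(4)[OF Cstar_bounded[OF b]] by blast
  have "0 < \<epsilon> / 2 / (K + 1)" using \<open>0 < \<epsilon>\<close> K by simp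
  then obtain S where S: "S \<in> group_alg G" "bnd G (opsub a S) (\<epsilon> / 2 / (K + 1))"
    using Cstar_approx[OF a] by blast
  \<comment> \<open>\<open>S\<close> is fixed first because the tolerance for \<open>T\<close>
    depends on the bound \<open>L\<close> of \<open>S\<close>: the error splits as
    \<open>(a - S) b + S (b - T)\<close>.\<close>
  obtain L where L: "0 \<le> L" "bnd G S L" using bounded_opD(4)[OF group_alg_bounded[OF S(1)]] by blast
  have "0 < \<epsilon> / 2 / (L + 1)" using \<open>0 < \<epsilon>\<close> L by simp
  then obtain T where T: "T \<in> group_alg G" "bnd G (opsub b T) (\<epsilon> / 2 / (L + 1))"
    using Cstar_approx[OF b] by blast
  note bo = Cstar_bounded[OF a] Cstar_bounded[OF b] group_alg_bounded[OF S(1)] group_alg_bounded[OF T(1)]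
  have 1: "bnd G (opsub a S \<circ> b) (\<epsilon> / 2 / (K + 1) * K)"
    using \<open>0 < \<epsilon>\<close> K by (intro bnd_comp bo S) auto
  have 2: "bnd G (S \<circ> opsub b T) (L * (\<epsilon> / 2 / (L + 1)))"
    by (intro bnd_comp bounded_op_opsub bo L T)
  have "bnd G (oplin (opsub a S \<circ> b) 1 (S \<circ> opsub b T)) (\<epsilon> / 2 / (K + 1) * K + cmod 1 * (L * (\<epsilon> / 2 / (L + 1))))"
    by (intro bnd_oplin bounded_op_comp bounded_op_opsub bo 1 2)
  moreover have "oplin (opsub a S \<circ> b) 1 (S \<circ> opsub b T) = opsub (a \<circ> b) (S \<circ> T)"
    by (simp add: comp_opsub bo) (simp add: oplin_def)
  moreover have "\<epsilon> / 2 / (K + 1) * K + cmod 1 * (L * (\<epsilon> / 2 / (L + 1))) \<le> \<epsilon>"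
  proof -
    have "\<epsilon> / 2 / (K + 1) * K \<le> \<epsilon> / 2" "L * (\<epsilon> / 2 / (L + 1)) \<le> \<epsilon> / 2"
      using \<open>0 < \<epsilon>\<close> K(1) L(1) by (simp_all add: field_simps)
    then show ?thesis unfolding norm_one by linarith
  qed
  ultimately have "bnd G (opsub (a \<circ> b) (S \<circ> T)) \<epsilon>"
    by (simp only: bnd_mono)
  then show "\<exists>x\<in>Cstar_r G. bnd G (opsub (a \<circ> b) x) \<epsilon>"
    using group_alg_Cstar[OF group_alg_comp[OF S(1) T(1)]] by metis
qed

lemma Cstar_complete:
  assumes A: "\<And>n. A n \<in> Cstar_r G" and e: "e \<longlonglongrightarrow> 0" "\<And>n. 0 \<le> e n"
    and cau: "\<And>m n. n \<le> m \<Longrightarrow> bnd G (opsub (A m) (A n)) (e n)"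
  obtains T where "T \<in> Cstar_r G" "\<And>n. bnd G (opsub T (A n)) (e n)"
proof -
  obtain T where T: "bounded_op G T" "\<And>n. bnd G (opsub T (A n)) (e n)"
    using bounded_op_complete[OF Cstar_bounded[OF A] e cau] by blast
  have "T \<in> Cstar_r G"
  proof (rule Cstar_closed[OF T(1)])
    fix \<epsilon> :: real assume "0 < \<epsilon>"
    then obtain n where "e n < \<epsilon>"
      using order_tendstoD(2)[OF e(1)] by (metis eventually_happens' sequentially_bot)
    then show "\<exists>a\<in>Cstar_r G. bnd G (opsub T a) \<epsilon>"
      using bnd_mono[OF T(2)[of n]] A by (meson less_imp_le)
  qed
  then show thesis using T(2) that by blast
qed

text \<open>The adjoint is obtained as a limit of explicit adjoints in the group algebra, which
  places it in the algebra itself and not merely among the bounded operators.\<close>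

lemma Cstar_adjoint:
  assumes a: "a \<in> Cstar_r G"
  obtains b where "b \<in> Cstar_r G" "adjp G a b"
proof -
  have "\<exists>S\<in>group_alg G. bnd G (opsub a S) (1 / 2 ^ n)" for n :: nat
    by (rule Cstar_approx[OF a]) simp
  then obtain A where A: "\<And>n. A n \<in> group_alg G" "\<And>n::nat. bnd G (opsub a (A n)) (1 / 2 ^ n)"
    by metis
  obtain B where B: "\<And>n. B n \<in> group_alg G" "\<And>n. adjp G (A n) (B n)"
    using group_alg_adjoint[OF A(1)] by metis
  \<comment> \<open>Two approximants of index at least \<open>n\<close> differ by at most twice the
    error \<open>1 / 2 ^ n\<close>.\<close>
  define e where "e n = 2 / (2::real) ^ n" for n :: nat
  have e: "e \<longlonglongrightarrow> 0" unfolding e_def by (rule LIMSEQ_divide_realpow_zero) simp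
  have e0: "0 \<le> e n" for n by (simp add: e_def)
  note bo = Cstar_bounded[OF a] group_alg_bounded[OF A(1)] group_alg_bounded[OF B(1)]
  have cau: "bnd G (opsub (B m) (B n)) (e n)" if "n \<le> m" for m n
  proof -
    have "bnd G (opsub (opsub a (A n)) (opsub a (A m))) (1 / 2 ^ n + 1 / 2 ^ m)"
      by (intro bnd_opsub bounded_op_opsub bo A)
    moreover have "opsub (opsub a (A n)) (opsub a (A m)) = opsub (A m) (A n)"
      by (simp add: algebra_simps)
    moreover have "1 / (2::real) ^ n + 1 / 2 ^ m \<le> e n"
      using divide_left_mono[OF power_increasing[OF that, of "2::real"], of 1] by (simp add: e_def)
    ultimately have "bnd G (opsub (A m) (A n)) (e n)" by (simp only: bnd_mono)
    moreover have "adjp G (opsub (A m) (A n)) (opsub (B m) (B n))"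
      using adjp_oplin[OF bo(2)[of m] bo(2)[of n] bo(3)[of m] bo(3)[of n] B(2) B(2), of "-1"]
      by (simp add: oplin_def)
    ultimately show ?thesis
      using bnd_adjp[OF bounded_op_opsub[OF bo(2) bo(2)] bounded_op_opsub[OF bo(3) bo(3)]] by blast
  qed
  obtain b where b: "b \<in> Cstar_r G" "\<And>n. bnd G (opsub b (B n)) (e n)"
    using Cstar_complete[OF group_alg_Cstar[OF B(1)] e e0 cau] by blast
  have "bnd G (opsub a (A n)) (e n)" for n
    by (rule bnd_mono[OF A(2)]) (simp add: e_def divide_right_mono)
  then have "adjp G a b"
    using adjp_limit[OF bo(1) Cstar_bounded[OF b(1)] bo(2,3) B(2) _ b(2) e] by blast
  then show thesis using b that by blast
qed

subsection \<open>Boundedness of tracial states\<close>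

text \<open>The square root is \<open>1 - y\<close>, where \<open>y\<close> is the fixed point of the contraction
  \<open>y \<mapsto> (a + y\<^sup>2) / 2\<close> on the ball of radius \<open>1/2\<close>.\<close>
lemma Cstar_sqrt:
  assumes a: "a \<in> Cstar_r G" "adjp G a a" "bnd G a (3/4)"
  obtains b where "b \<in> Cstar_r G" "adjp G b b" "b \<circ> b = opsub (unit_op G) a"
proof -
  define \<Phi> where "\<Phi> y = oplin zero_op (1/2) (oplin a 1 (y \<circ> y))" for y
  define y where "y n = (\<Phi> ^^ n) zero_op" for n
  have ySuc: "y (Suc n) = \<Phi> (y n)" for n by (simp add: y_def)
  note zC = group_alg_Cstar[OF group_alg_zero]
  have PC: "\<Phi> x \<in> Cstar_r G" if "x \<in> Cstar_r G" for x
    unfolding \<Phi>_def by (intro Cstar_oplin Cstar_comp zC a that)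
  have yC: "y n \<in> Cstar_r G" for n
    by (induction n) (simp_all add: ySuc PC, simp add: y_def zC)
  note yb = Cstar_bounded[OF yC] and ab = Cstar_bounded[OF a(1)]
  have yadj: "adjp G (y n) (y n)" for n
  proof (induction n)
    case (Suc n)
    have "adjp G (oplin zero_op (1/2) (oplin a 1 (y n \<circ> y n)))
        (oplin zero_op (cnj (1/2)) (oplin a (cnj 1) (y n \<circ> y n)))"
      by (intro adjp_oplin adjp_comp adjp_zero bounded_op_oplin bounded_op_comp bounded_op_zero_op
          ab yb a Suc)
    then show ?case by (simp add: ySuc \<Phi>_def)
  qed (simp add: y_def adjp_zero)
  \<comment> \<open>Origin of \<open>3/4\<close>: since \<open>(3/4 + 1/4) / 2 = 1/2\<close>, the
    map \<open>\<Phi>\<close> sends the ball of radius \<open>1/2\<close> to itself.\<close>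
  have ybnd: "bnd G (y n) (1/2)" for n
  proof (induction n)
    case (Suc n)
    have "bnd G (oplin zero_op (1/2) (oplin a 1 (y n \<circ> y n)))
        (0 + cmod (1/2) * (3/4 + cmod 1 * (1/2 * (1/2))))"
      by (intro bnd_oplin bnd_comp bounded_op_oplin bounded_op_comp bounded_op_zero_op
          ab yb a Suc bnd_zero_op) simp
    then show ?case by (simp add: ySuc \<Phi>_def norm_divide)
  qed (simp add: y_def bnd_mono[OF bnd_zero_op])
  have lip: "bnd G (opsub (\<Phi> u) (\<Phi> v)) (\<delta> / 2)"
    if u: "bounded_op G u" "bnd G u (1/2)" and v: "bounded_op G v" "bnd G v (1/2)"
      and d: "bnd G (opsub u v) \<delta>" "0 \<le> \<delta>" for u v \<delta>
  proof -
    \<comment> \<open>A noncommutative difference of squares,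
      \<open>u u - v v = u (u - v) + (u - v) v\<close>. On the ball of radius \<open>1/2\<close> it
      makes \<open>\<Phi>\<close> a contraction with factor \<open>1/2\<close>.\<close>
    have "bnd G (oplin zero_op (1/2) (oplin (u \<circ> opsub u v) 1 (opsub u v \<circ> v)))
        (0 + cmod (1/2) * (1/2 * \<delta> + cmod 1 * (\<delta> * (1/2))))"
      by (intro bnd_oplin bnd_comp bounded_op_oplin bounded_op_comp bounded_op_zero_op
          bounded_op_opsub u v d bnd_zero_op) simp
    moreover have "oplin zero_op (1/2) (oplin (u \<circ> opsub u v) 1 (opsub u v \<circ> v)) = opsub (\<Phi> u) (\<Phi> v)"
      by (simp add: comp_opsub u v) (auto simp: \<Phi>_def oplin_def zero_op_def fun_eq_iff field_simps)
    ultimately show ?thesis by (simp add: norm_divide)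
  qed
  have step: "bnd G (opsub (y (Suc n)) (y n)) (1 / 2 ^ n)" for n
  proof (induction n)
    case 0
    have "bnd G (opsub (y (Suc 0)) (y 0)) (1/2 + 1/2)"
      by (intro bnd_opsub yb ybnd)
    then show ?case by simp
  next
    case (Suc n)
    show ?case
      using lip[OF yb ybnd yb ybnd Suc] by (simp add: ySuc[symmetric] mult.commute)
  qed
  define e where "e n = 2 / (2::real) ^ n" for n :: nat
  have e: "e \<longlonglongrightarrow> 0" unfolding e_def by (rule LIMSEQ_divide_realpow_zero) simp
  have e0: "0 \<le> e n" for n by (simp add: e_def)
  \<comment> \<open>The bound is the exact value of the geometric sum of the steps from
    \<open>n\<close> to \<open>n + k\<close>; the cruder \<open>2 / 2 ^ n\<close> would not survive
    the induction on \<open>k\<close>.\<close>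
  have cau': "bnd G (opsub (y (n + k)) (y n)) (2 / 2 ^ n - 2 / 2 ^ (n + k))" for n k
  proof (induction k)
    case 0
    show ?case by (simp add: bnd_def)
  next
    case (Suc k)
    have "bnd G (oplin (opsub (y (Suc (n + k))) (y (n + k))) 1 (opsub (y (n + k)) (y n)))
       (1 / 2 ^ (n + k) + cmod 1 * (2 / 2 ^ n - 2 / 2 ^ (n + k)))"
      by (intro bnd_oplin bounded_op_opsub yb step Suc)
    then show ?case by (simp add: oplin_def field_simps)
  qed
  have cau: "bnd G (opsub (y m) (y n)) (e n)" if "n \<le> m" for m n
  proof -
    from le_Suc_ex[OF \<open>n \<le> m\<close>] obtain k where k: "m = n + k" ..
    show ?thesis unfolding k by (rule bnd_mono[OF cau']) (simp add: e_def)
  qed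
  obtain Y where Y: "Y \<in> Cstar_r G" "\<And>n. bnd G (opsub Y (y n)) (e n)"
    using Cstar_complete[OF yC e e0 cau] by blast
  note Yb = Cstar_bounded[OF Y(1)]
  have Yadj: "adjp G Y Y"
    by (rule adjp_limit[OF Yb Yb yb yb yadj Y(2) Y(2) e])
  have Ybnd: "bnd G Y (1/2)"
    unfolding bnd_def
  proof
    fix f assume f: "f \<in> l2 G"
    have "l2norm (Y f) \<le> (1/2 + e n) * l2norm f" for n
    proof -
      have "bnd G (oplin (y n) 1 (opsub Y (y n))) (1/2 + cmod 1 * e n)"
        by (intro bnd_oplin yb ybnd Y bounded_op_opsub Yb)
      then show ?thesis using bndD[OF _ f] by (simp add: oplin_def)
    qed
    moreover have "(\<lambda>n. (1/2 + e n) * l2norm f) \<longlonglongrightarrow> (1/2 + 0) * l2norm f"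
      by (intro tendsto_intros e)
    ultimately show "l2norm (Y f) \<le> 1/2 * l2norm f"
      using LIMSEQ_le_const by force
  qed
  have fix_eq: "Y = \<Phi> Y"
  proof (rule op_eqI[OF Yb Cstar_bounded[OF PC[OF Y(1)]]])
    fix \<epsilon> :: real assume "0 < \<epsilon>"
    then obtain n where n: "e n < \<epsilon>"
      using order_tendstoD(2)[OF e] by (metis eventually_happens' sequentially_bot)
    \<comment> \<open>\<open>Y - \<Phi> Y\<close> is the difference of \<open>Y - y (Suc n)\<close>
      and \<open>\<Phi> Y - \<Phi> (y n)\<close>, both small.\<close>
    have "bnd G (opsub (opsub Y (y (Suc n))) (opsub (\<Phi> Y) (\<Phi> (y n)))) (e (Suc n) + e n / 2)"
      by (intro bnd_opsub bounded_op_opsub Yb yb Y(2) Cstar_bounded PC Y(1) yC lip Ybnd ybnd e0)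
    moreover have "opsub (opsub Y (y (Suc n))) (opsub (\<Phi> Y) (\<Phi> (y n))) = opsub Y (\<Phi> Y)"
      by (simp add: ySuc)
    moreover have "e (Suc n) + e n / 2 \<le> \<epsilon>" using n by (simp add: e_def field_simps)
    ultimately show "bnd G (opsub Y (\<Phi> Y)) \<epsilon>" by (simp only: bnd_mono)
  qed
  note uC = group_alg_Cstar[OF group_alg_lreg[OF one_closed], folded unit_op_def]
  define b where "b = oplin (unit_op G) (-1) Y"
  have "b \<in> Cstar_r G" unfolding b_def by (intro Cstar_oplin uC Y)
  moreover have "adjp G b b"
  proof -
    have "adjp G (unit_op G) (unit_op G)"
      using adjp_lreg[OF one_closed] by (simp add: unit_op_def)
    then show ?thesis
      unfolding b_def
      using adjp_oplin[OF Cstar_bounded[OF uC] Yb Cstar_bounded[OF uC] Yb _ Yadj, of "-1"] by simp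
  qed
  moreover have "b \<circ> b = opsub (unit_op G) a"
  proof -
    have u: "unit_op G \<circ> T = T" "T \<circ> unit_op G = T" if "bounded_op G T" for T
    proof -
      show "unit_op G \<circ> T = T"
        using lreg_one bounded_opD(2)[OF that] by (auto simp: unit_op_def)
      have "T (lreg G \<one> f) = T f" for f
        using lreg_one lreg_outside bounded_opD(1)[OF that] bounded_op_zero[OF that]
        by (cases "f \<in> l2 G") auto
      then show "T \<circ> unit_op G = T"
        by (auto simp: unit_op_def)
    qed
    have "b \<circ> b = oplin (oplin (unit_op G) (-1) Y) (-1) (oplin Y (-1) (Y \<circ> Y))"
      unfolding b_def oplin_comp
      by (simp add: comp_oplin Yb Cstar_bounded[OF uC] u bounded_op_oplin)
    \<comment> \<open>The product is \<open>1 - 2 Y + Y Y\<close>, and the fixed point equation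
      reads \<open>2 Y = a + Y Y\<close>.\<close>
    also have "\<dots> = opsub (unit_op G) a"
    proof (intro ext)
      fix f x
      have "Y f x = (a f x + (Y \<circ> Y) f x) / 2"
        using fun_cong[OF fun_cong[OF fix_eq], of f x] by (simp add: \<Phi>_def oplin_def zero_op_def)
      then show "oplin (oplin (unit_op G) (-1) Y) (-1) (oplin Y (-1) (Y \<circ> Y)) f x
          = opsub (unit_op G) a f x"
        by (simp add: oplin_def field_simps)
    qed
    finally show ?thesis .
  qed
  ultimately show thesis using that by blast
qed

lemma unit_op_Cstar: "unit_op G \<in> Cstar_r G"
  unfolding unit_op_def by (intro group_alg_Cstar group_alg_lreg one_closed)

lemma tracial_state_oplin:
  assumes "tracial_state G \<tau>" "a \<in> Cstar_r G" "b \<in> Cstar_r G"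
  shows "\<tau> (oplin a c b) = \<tau> a + c * \<tau> b"
  using assms by (simp add: tracial_state_def oplin_def)

lemma tracial_state_zero:
  assumes "tracial_state G \<tau>"
  shows "\<tau> zero_op = 0"
proof -
  note z = group_alg_Cstar[OF group_alg_zero]
  have "oplin zero_op 1 zero_op = (zero_op :: 'a op)" by (simp add: oplin_def zero_op_def)
  then show ?thesis using tracial_state_oplin[OF assms z z, of 1] by simp
qed

text \<open>\<open>1 - a\<close> is \<open>b \<circ> b\<close> with \<open>b\<close> self-adjoint,
  so positivity applies to it and makes \<open>1 - \<tau> a\<close> real and nonnegative.\<close>

lemma tracial_state_le_1:
  assumes \<tau>: "tracial_state G \<tau>" and a: "a \<in> Cstar_r G" "adjp G a a" "bnd G a (3/4)"
  shows "Im (\<tau> a) = 0" "Re (\<tau> a) \<le> 1"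
proof -
  obtain b where b: "b \<in> Cstar_r G" "adjp G b b" "b \<circ> b = opsub (unit_op G) a"
    using Cstar_sqrt[OF a] by blast
  have "adj G b = b" by (intro adj_eqI Cstar_bounded b)
  then have *: "Im (\<tau> (b \<circ> b)) = 0" "Re (\<tau> (b \<circ> b)) \<ge> 0"
    using \<tau> b(1) by (auto simp: tracial_state_def dest!: bspec)
  have "\<tau> (b \<circ> b) = 1 - \<tau> a"
    unfolding b(3) opsub_oplin using \<tau> tracial_state_oplin[OF \<tau> unit_op_Cstar a(1), of "-1"]
    by (simp add: tracial_state_def)
  then show "Im (\<tau> a) = 0" "Re (\<tau> a) \<le> 1" using * by simp_all
qed

lemma tracial_state_selfadjoint_bound:
  assumes \<tau>: "tracial_state G \<tau>" and a: "a \<in> Cstar_r G" "adjp G a a" "bnd G a (3/4)"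
  shows "cmod (\<tau> a) \<le> 1"
proof -
  note z = group_alg_Cstar[OF group_alg_zero]
  define n where "n = oplin zero_op (-1) a"
  have "adjp G n n"
    unfolding n_def
    using adjp_oplin[OF bounded_op_zero_op Cstar_bounded[OF a(1)] bounded_op_zero_op
        Cstar_bounded[OF a(1)] adjp_zero a(2), of "-1"] by simp
  moreover have "bnd G n (3/4)"
    unfolding n_def
    using bnd_oplin[OF bounded_op_zero_op Cstar_bounded[OF a(1)] bnd_zero_op a(3), of "-1"] by simp
  moreover have "n \<in> Cstar_r G" unfolding n_def by (intro Cstar_oplin z a)
  ultimately have "Re (\<tau> n) \<le> 1" using tracial_state_le_1(2)[OF \<tau>] by blast
  moreover have "\<tau> n = - \<tau> a"
    unfolding n_def using tracial_state_oplin[OF \<tau> z a(1), of "-1"] tracial_state_zero[OF \<tau>] by simp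
  ultimately show ?thesis
    using tracial_state_le_1[OF \<tau> a] by (simp add: cmod_eq_Re)
qed

text \<open>Automatic continuity of tracial states, by splitting \<open>a\<close> into self-adjoint
  and skew-adjoint parts and bounding the trace on each.\<close>

lemma tracial_state_bound:
  assumes \<tau>: "tracial_state G \<tau>" and a: "a \<in> Cstar_r G" and K: "bnd G a K" "0 < K"
  shows "cmod (\<tau> a) \<le> 3 * K"
proof -
  obtain b where b: "b \<in> Cstar_r G" "adjp G a b" using Cstar_adjoint[OF a] by blast
  note z = group_alg_Cstar[OF group_alg_zero]
  note bo = Cstar_bounded[OF a] Cstar_bounded[OF b(1)] bounded_op_zero_op
  have bK: "bnd G b K" using bnd_adjp[OF bo(1,2) b(2) K(1)] .
  \<comment> \<open>Scaled so that \<open>t (a + b)\<close> and \<open>t (a - b)\<close> have bound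
    \<open>3/4\<close>. From \<open>2 t a = p + \<i> q\<close> one gets
    \<open>cmod (\<tau> a) \<le> 1 / t\<close>, which is \<open>8 K / 3\<close>.\<close>
  define t where "t = 3 / (8 * K)"
  have t: "0 < t" "t * (K + K) = 3/4" using K by (auto simp: t_def)
  define p where "p = oplin zero_op (of_real t) (oplin a 1 b)"
  define q where "q = oplin zero_op (- \<i> * of_real t) (oplin a (-1) b)"
  have pC: "p \<in> Cstar_r G" "q \<in> Cstar_r G"
    unfolding p_def q_def by (intro Cstar_oplin z a b)+
  have "oplin b 1 a = oplin a 1 b" by (simp add: oplin_def add.commute)
  then have padj: "adjp G p p"
    using adjp_oplin[OF bo(3) _ bo(3) _ adjp_zero adjp_oplin[OF bo(1,2,2,1) b(2) adjp_sym[OF b(2)], of 1],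
        of "of_real t"] bo by (simp add: p_def bounded_op_oplin)
  have "oplin zero_op (\<i> * of_real t) (oplin b (-1) a) = q" by (simp add: q_def oplin_def zero_op_def algebra_simps)
  then have qadj: "adjp G q q"
    using adjp_oplin[OF bo(3) _ bo(3) _ adjp_zero adjp_oplin[OF bo(1,2,2,1) b(2) adjp_sym[OF b(2)], of "-1"],
        of "- \<i> * of_real t"] bo
    unfolding q_def by (simp add: bounded_op_oplin)
  have t': "0 + cmod (of_real t) * (K + cmod 1 * K) = 3/4"
    "0 + cmod (- \<i> * of_real t) * (K + cmod (-1) * K) = 3/4"
    using t by (simp_all add: norm_mult)
  have "bnd G p (3/4)"
    using bnd_oplin[OF bo(3) bounded_op_oplin[OF bo(1,2)] bnd_zero_op bnd_oplin[OF bo(1,2) K(1) bK],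
        of "of_real t" 1] unfolding t' p_def .
  moreover have "bnd G q (3/4)"
    using bnd_oplin[OF bo(3) bounded_op_oplin[OF bo(1,2)] bnd_zero_op bnd_oplin[OF bo(1,2) K(1) bK],
        of "- \<i> * of_real t" "-1"] unfolding t' q_def .
  ultimately have le: "cmod (\<tau> p) \<le> 1" "cmod (\<tau> q) \<le> 1"
    using tracial_state_selfadjoint_bound[OF \<tau>] pC padj qadj by blast+
  have \<tau>p: "\<tau> p = of_real t * (\<tau> a + \<tau> b)"
    unfolding p_def using tracial_state_oplin[OF \<tau> z Cstar_oplin[OF a b(1)]]
      tracial_state_oplin[OF \<tau> a b(1)] tracial_state_zero[OF \<tau>] by simp
  have \<tau>q: "\<tau> q = - \<i> * of_real t * (\<tau> a - \<tau> b)"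
    unfolding q_def using tracial_state_oplin[OF \<tau> z Cstar_oplin[OF a b(1)]]
      tracial_state_oplin[OF \<tau> a b(1)] tracial_state_zero[OF \<tau>] by simp
  have "of_real (2 * t) * \<tau> a = \<tau> p + \<i> * \<tau> q" by (simp add: \<tau>p \<tau>q algebra_simps)
  then have "cmod (of_real (2 * t) * \<tau> a) \<le> cmod (\<tau> p) + cmod (\<tau> q)"
    using norm_triangle_ineq[of "\<tau> p" "\<i> * \<tau> q"] by (simp add: norm_mult)
  then have "2 * t * cmod (\<tau> a) \<le> 2"
    using le t by (simp add: norm_mult)
  then have "cmod (\<tau> a) * 3 \<le> 8 * K"
    using K by (simp add: t_def field_simps)
  then show ?thesis using K norm_ge_zero[of "\<tau> a"] by linarith
qed

subsection \<open>The canonical trace\<close>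

lemma can_trace_apply: "can_trace G a = a (delta \<one>) \<one>"
  by (simp add: can_trace_def l2inner_delta)

lemma cmod_apply_delta_le:
  assumes "bounded_op G a" "bnd G a K" "x \<in> carrier G"
  shows "cmod (a (delta x) y) \<le> K"
  using cmod_le_l2norm[OF bounded_opD(2)[OF assms(1)], of "delta x" y]
    bndD[OF assms(2) delta_l2[OF assms(3)]] by simp

text \<open>Left translations commute with right translations, so the matrix entry at
  \<open>(\<one>, h)\<close> equals the one at \<open>(inv h, \<one>)\<close>. The trace identity
  for a single translation is exactly this invariance.\<close>

lemma group_alg_delta:
  assumes "T \<in> group_alg G" "h \<in> carrier G"
  shows "T (delta h) \<one> = T (delta \<one>) (inv h)"
  using assms(1)
proof (induction rule: group_alg_induct)
  case (add T c g)
  then have "lreg G g (delta h) \<one> = lreg G g (delta \<one>) (inv h)"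
    using assms(2) inv_equality[of g h] by (auto simp: lreg_delta) (auto simp: delta_def)
  then show ?case using add by (simp add: oplin_def)
qed (simp add: zero_op_def)

lemma Cstar_delta:
  assumes a: "a \<in> Cstar_r G" and h: "h \<in> carrier G"
  shows "a (delta h) \<one> = a (delta \<one>) (inv h)"
proof -
  have "cmod (a (delta h) \<one> - a (delta \<one>) (inv h)) \<le> 0 + \<epsilon>" if "0 < \<epsilon>" for \<epsilon>
  proof -
    obtain S where S: "S \<in> group_alg G" "bnd G (opsub a S) (\<epsilon> / 2)"
      using Cstar_approx[OF a] \<open>0 < \<epsilon>\<close> half_gt_zero by blast
    note bo = bounded_op_opsub[OF Cstar_bounded[OF a] group_alg_bounded[OF S(1)]]
    have "a (delta h) \<one> - a (delta \<one>) (inv h) = opsub a S (delta h) \<one> - opsub a S (delta \<one>) (inv h)"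
      using group_alg_delta[OF S(1) h] by simp
    then show ?thesis
      using cmod_apply_delta_le[OF bo S(2) h, of \<one>] cmod_apply_delta_le[OF bo S(2) one_closed, of "inv h"]
        norm_triangle_ineq4[of "opsub a S (delta h) \<one>" "opsub a S (delta \<one>) (inv h)"] by simp
  qed
  then have "cmod (a (delta h) \<one> - a (delta \<one>) (inv h)) \<le> 0" by (rule field_le_epsilon)
  then show ?thesis by simp
qed

text \<open>For a translation by \<open>g\<close> the two sides are
  \<open>a (delta g) \<one>\<close> and \<open>a (delta \<one>) (inv g)\<close>, which agree by
  \<open>Cstar_delta\<close>.\<close>

lemma can_trace_commute_group_alg:
  assumes a: "a \<in> Cstar_r G" and "T \<in> group_alg G"
  shows "can_trace G (a \<circ> T) = can_trace G (T \<circ> a)"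
  using assms(2)
proof (induction rule: group_alg_induct)
  case zero
  then show ?case using bounded_op_zero[OF Cstar_bounded[OF a]] by (simp add: can_trace_apply zero_op_def)
next
  case (add T c g)
  have "(a \<circ> lreg G g) (delta \<one>) \<one> = (lreg G g \<circ> a) (delta \<one>) \<one>"
    using add(2) Cstar_delta[OF a add(2)] bounded_opD(2)[OF Cstar_bounded[OF a]]
    by (simp add: lreg_delta lreg_apply)
  then show ?case
    using add(3)
    by (simp add: can_trace_apply comp_oplin[OF Cstar_bounded[OF a] group_alg_bounded[OF add(1)] bounded_op_lreg[OF add(2)]]
        oplin_comp) (simp add: oplin_def)
qed

lemma can_trace_commute:
  assumes a: "a \<in> Cstar_r G" and b: "b \<in> Cstar_r G"
  shows "can_trace G (a \<circ> b) = can_trace G (b \<circ> a)"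
proof -
  obtain K where K: "0 \<le> K" "bnd G a K" using bounded_opD(4)[OF Cstar_bounded[OF a]] by blast
  have "cmod (can_trace G (a \<circ> b) - can_trace G (b \<circ> a)) \<le> 0 + \<epsilon>" if "0 < \<epsilon>" for \<epsilon>
  proof -
    have "0 < \<epsilon> / 2 / (K + 1)" using \<open>0 < \<epsilon>\<close> K by simp
    then obtain S where S: "S \<in> group_alg G" "bnd G (opsub b S) (\<epsilon> / 2 / (K + 1))"
      using Cstar_approx[OF b] by blast
    note bo = Cstar_bounded[OF a] Cstar_bounded[OF b] group_alg_bounded[OF S(1)]
    have small: "K * (\<epsilon> / 2 / (K + 1)) \<le> \<epsilon> / 2" using \<open>0 < \<epsilon>\<close> K(1) by (simp add: field_simps)
    have 1: "bnd G (a \<circ> opsub b S) (K * (\<epsilon> / 2 / (K + 1)))"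
      by (intro bnd_comp bounded_op_opsub bo K S)
    have 2: "bnd G (opsub b S \<circ> a) (\<epsilon> / 2 / (K + 1) * K)"
      using \<open>0 < \<epsilon>\<close> K(1) by (intro bnd_comp bounded_op_opsub bo K S) simp
    have eq: "can_trace G (a \<circ> b) - can_trace G (b \<circ> a)
        = (a \<circ> opsub b S) (delta \<one>) \<one> - (opsub b S \<circ> a) (delta \<one>) \<one>"
      unfolding comp_opsub[OF bo] using can_trace_commute_group_alg[OF a S(1)]
      by (simp add: can_trace_apply)
    have "cmod ((a \<circ> opsub b S) (delta \<one>) \<one>) \<le> K * (\<epsilon> / 2 / (K + 1))"
      by (intro cmod_apply_delta_le 1 bounded_op_comp bounded_op_opsub bo one_closed)
    moreover have "cmod ((opsub b S \<circ> a) (delta \<one>) \<one>) \<le> K * (\<epsilon> / 2 / (K + 1))"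
      unfolding mult.commute[of K]
      by (intro cmod_apply_delta_le 2 bounded_op_comp bounded_op_opsub bo one_closed)
    ultimately show ?thesis
      unfolding eq
      using small norm_triangle_ineq4[of "(a \<circ> opsub b S) (delta \<one>) \<one>" "(opsub b S \<circ> a) (delta \<one>) \<one>"]
      by linarith
  qed
  then have "cmod (can_trace G (a \<circ> b) - can_trace G (b \<circ> a)) \<le> 0" by (rule field_le_epsilon)
  then show ?thesis by simp
qed

lemma tracial_state_can_trace: "tracial_state G (can_trace G)"
  unfolding tracial_state_def
proof (intro conjI ballI allI)
  fix a b c
  show "can_trace G (\<lambda>f x. a f x + c * b f x) = can_trace G a + c * can_trace G b"
    by (simp add: can_trace_apply)
next
  fix a assume a: "a \<in> Cstar_r G"
  obtain b where b: "b \<in> Cstar_r G" "adjp G a b" using Cstar_adjoint[OF a] by blast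
  note d = delta_l2[OF one_closed]
  have al: "a (delta \<one>) \<in> l2 G" by (rule bounded_opD(2)[OF Cstar_bounded[OF a]])
  have "adj G a = b" by (intro adj_eqI Cstar_bounded b)
  then have "can_trace G (adj G a \<circ> a) = l2inner (b (a (delta \<one>))) (delta \<one>)"
    by (simp add: can_trace_def)
  also have "\<dots> = l2inner (a (delta \<one>)) (a (delta \<one>))"
    using adjp_sym[OF b(2)] al d by (simp add: adjp_def)
  also have "\<dots> = complex_of_real ((l2norm (a (delta \<one>)))\<^sup>2)"
    by (rule l2inner_self[OF al])
  finally show "Im (can_trace G (adj G a \<circ> a)) = 0" "0 \<le> Re (can_trace G (adj G a \<circ> a))"
    by simp_all
next
  show "can_trace G (unit_op G) = 1"
    by (simp add: can_trace_apply unit_op_def lreg_delta) (simp add: delta_def)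
next
  fix a b assume "a \<in> Cstar_r G" "b \<in> Cstar_r G"
  then show "can_trace G (a \<circ> b) = can_trace G (b \<circ> a)" by (rule can_trace_commute)
qed

end

section \<open>A criterion for the unique trace property\<close>

lemma has_sum_sum:
  fixes g :: "'i \<Rightarrow> 'x \<Rightarrow> 'b :: topological_comm_monoid_add"
  assumes "finite J" "\<And>j. j \<in> J \<Longrightarrow> (g j has_sum s j) A"
  shows "((\<lambda>x. \<Sum>j\<in>J. g j x) has_sum (\<Sum>j\<in>J. s j)) A"
  using assms by (induction J) (auto intro!: has_sum_add)

lemma l2norm_sum_disjoint:
  assumes "finite J" and l2: "\<And>j. j \<in> J \<Longrightarrow> u j \<in> l2 G"
    and disj: "\<And>i j x. i \<in> J \<Longrightarrow> j \<in> J \<Longrightarrow> i \<noteq> j \<Longrightarrow> u i x = 0 \<or> u j x = 0"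
  shows "(l2norm (\<lambda>x. \<Sum>j\<in>J. u j x))\<^sup>2 = (\<Sum>j\<in>J. (l2norm (u j))\<^sup>2)"
proof -
  have pt: "(cmod (\<Sum>j\<in>J. u j x))\<^sup>2 = (\<Sum>j\<in>J. (cmod (u j x))\<^sup>2)" for x
  proof (cases "\<exists>i\<in>J. u i x \<noteq> 0")
    case True
    then obtain i where i: "i \<in> J" "u i x \<noteq> 0" by blast
    then have z: "u j x = 0" if "j \<in> J - {i}" for j using disj that by blast
    have "(\<Sum>j\<in>J. u j x) = u i x" "(\<Sum>j\<in>J. (cmod (u j x))\<^sup>2) = (cmod (u i x))\<^sup>2"
      using sum.remove[OF \<open>finite J\<close> i(1), of "\<lambda>j. u j x"] z
        sum.remove[OF \<open>finite J\<close> i(1), of "\<lambda>j. (cmod (u j x))\<^sup>2"] by simp_all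
    then show ?thesis by simp
  qed simp
  have "infsum (\<lambda>x. (cmod (\<Sum>j\<in>J. u j x))\<^sup>2) UNIV = (\<Sum>j\<in>J. infsum (\<lambda>x. (cmod (u j x))\<^sup>2) UNIV)"
    unfolding pt using l2 \<open>finite J\<close> by (intro infsumI has_sum_sum has_sum_infsum) (auto simp: l2_def)
  then show ?thesis
    by (simp add: l2norm_def infsum_nonneg sum_nonneg)
qed

lemma l2_restrict:
  assumes "f \<in> l2 G"
  shows "(\<lambda>x. if x \<in> E then f x else 0) \<in> l2 G"
    and l2norm_restrict: "l2norm (\<lambda>x. if x \<in> E then f x else 0) \<le> l2norm f"
proof -
  have *: "L2_set (\<lambda>x. cmod (if x \<in> E then f x else 0)) X \<le> l2norm f" for X
    by (rule order_trans[OF L2_set_mono L2_set_le_l2norm[OF assms]]) auto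
  show "(\<lambda>x. if x \<in> E then f x else 0) \<in> l2 G" "l2norm (\<lambda>x. if x \<in> E then f x else 0) \<le> l2norm f"
    using l2_finite_boundI[OF _ _ *, of G] l2_outside[OF assms] by simp_all
qed

context group
begin

text \<open>Powers' averaging estimate: split \<open>f\<close> along \<open>E j\<close> and its complement; the pieces on \<open>E j\<close> are
  orthogonal before translating, the pieces off \<open>E j\<close> become orthogonal after translating.\<close>
lemma bnd_average_lreg:
  fixes k :: "nat \<Rightarrow> 'a"
  assumes k: "\<And>j. k j \<in> carrier G" and n: "0 < n"
    and disj: "\<And>i j. i < n \<Longrightarrow> j < n \<Longrightarrow> i \<noteq> j \<Longrightarrow> E i \<inter> E j = {}"
    and move: "\<And>j x. j < n \<Longrightarrow> x \<in> carrier G \<Longrightarrow> x \<notin> E j \<Longrightarrow> k j \<otimes> x \<in> E j"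
  shows "bnd G (\<lambda>f x. \<Sum>j<n. (1 / of_nat n) * lreg G (k j) f x) (2 / sqrt (real n))"
  unfolding bnd_def
proof
  fix f assume f: "f \<in> l2 G"
  define p where "p j = (\<lambda>x. if x \<in> E j then f x else 0)" for j
  define q where "q j = (\<lambda>x. if x \<in> - E j then f x else 0)" for j
  have p: "p j \<in> l2 G" for j unfolding p_def by (rule l2_restrict[OF f])
  have q: "q j \<in> l2 G" "l2norm (q j) \<le> l2norm f" for j
    unfolding q_def by (rule l2_restrict[OF f] l2norm_restrict[OF f])+
  define F1 where "F1 = (\<lambda>x. \<Sum>j<n. lreg G (k j) (p j) x)"
  define F2 where "F2 = (\<lambda>x. \<Sum>j<n. lreg G (k j) (q j) x)"
  have F: "F1 \<in> l2 G" "F2 \<in> l2 G"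
    unfolding F1_def F2_def by (intro l2_sum lreg_l2 k p q; simp)+
  have split: "lreg G (k j) f x = lreg G (k j) (p j) x + lreg G (k j) (q j) x" for j x
    by (simp add: lreg_apply[OF f] lreg_apply[OF p] lreg_apply[OF q(1)]) (simp add: p_def q_def)
  have eq: "(\<lambda>x. \<Sum>j<n. (1 / of_nat n) * lreg G (k j) f x) = (\<lambda>x. (1 / of_nat n) * (F1 x + F2 x))"
    by (simp add: split F1_def F2_def sum_distrib_left[symmetric] sum_divide_distrib[symmetric] sum.distrib)
  \<comment> \<open>Translation may make the supports of the pieces overlap, so Cauchy-Schwarz over
    \<open>j\<close> comes first and the disjointness of the sets \<open>E j\<close> is used on the
    untranslated pieces.\<close>
  have "l2norm F1 \<le> (\<Sum>j<n. l2norm (lreg G (k j) (p j)))"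
    unfolding F1_def by (intro l2norm_sum[where G = G] lreg_l2 k p) simp
  also have "\<dots> = (\<Sum>j<n. \<bar>1\<bar> * \<bar>l2norm (p j)\<bar>)"
    by (simp add: l2norm_lreg k p)
  also have "\<dots> \<le> L2_set (\<lambda>j. 1) {..<n} * L2_set (\<lambda>j. l2norm (p j)) {..<n}"
    by (rule L2_set_mult_ineq)
  also have "L2_set (\<lambda>j. 1) {..<n} = sqrt (real n)"
    by (simp add: L2_set_constant)
  also have "L2_set (\<lambda>j. l2norm (p j)) {..<n} \<le> l2norm f"
  proof -
    have "(\<Sum>j<n. (l2norm (p j))\<^sup>2) = (l2norm (\<lambda>x. \<Sum>j<n. p j x))\<^sup>2"
      by (rule l2norm_sum_disjoint[symmetric, of _ _ G]) (use p disj in \<open>auto simp: p_def\<close>)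
    moreover have "(\<lambda>x. \<Sum>j<n. p j x) = (\<lambda>x. if x \<in> (\<Union>j<n. E j) then f x else 0)"
    proof
      fix x
      show "(\<Sum>j<n. p j x) = (if x \<in> (\<Union>j<n. E j) then f x else 0)"
      proof (cases "x \<in> (\<Union>j<n. E j)")
        case True
        then obtain i where i: "i < n" "x \<in> E i" by blast
        then have "p j x = 0" if "j \<in> {..<n} - {i}" for j
          using disj that by (auto simp: p_def)
        then show ?thesis
          using True i sum.remove[of "{..<n}" i "\<lambda>j. p j x"] by (simp add: p_def)
      next
        case False
        then have "p j x = 0" if "j < n" for j using that by (auto simp: p_def)
        then show ?thesis using False by simp
      qed
    qed
    ultimately have "L2_set (\<lambda>j. l2norm (p j)) {..<n} = l2norm (\<lambda>x. if x \<in> (\<Union>j<n. E j) then f x else 0)"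
      by (simp add: L2_set_def)
    then show ?thesis by (simp only: l2norm_restrict[OF f])
  qed
  finally have 1: "l2norm F1 \<le> sqrt (real n) * l2norm f"
    by (simp add: mult_left_mono)
  \<comment> \<open>Translating by \<open>k j\<close> carries the complement of \<open>E j\<close>
    into \<open>E j\<close>, so these pieces have disjoint supports afterwards.\<close>
  have supp: "x \<in> E j" if "lreg G (k j) (q j) x \<noteq> 0" "j < n" for x j
  proof -
    have x: "x \<in> carrier G" "inv (k j) \<otimes> x \<notin> E j"
      using that(1) unfolding lreg_apply[OF q(1)] by (auto simp: q_def split: if_splits)
    then have "k j \<otimes> (inv (k j) \<otimes> x) \<in> E j" using move[OF that(2)] k by simp
    then show ?thesis using x k by (simp add: m_assoc[symmetric])
  qed
  have "(l2norm F2)\<^sup>2 = (\<Sum>j<n. (l2norm (lreg G (k j) (q j)))\<^sup>2)"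
    unfolding F2_def
  proof (rule l2norm_sum_disjoint)
    fix i j x assume "i \<in> {..<n}" "j \<in> {..<n}" "i \<noteq> j"
    then show "lreg G (k i) (q i) x = 0 \<or> lreg G (k j) (q j) x = 0"
      using supp[of i x] supp[of j x] disj[of i j] by auto
  qed (auto intro: lreg_l2 k q)
  also have "\<dots> \<le> (\<Sum>j<n. (l2norm f)\<^sup>2)"
    by (intro sum_mono power_mono) (simp_all add: l2norm_lreg k q)
  also have "\<dots> = (sqrt (real n) * l2norm f)\<^sup>2"
    by (simp add: power_mult_distrib)
  finally have 2: "l2norm F2 \<le> sqrt (real n) * l2norm f"
    by (rule power2_le_imp_le) simp
  have "l2norm (\<lambda>x. (1 / of_nat n) * (F1 x + F2 x)) = 1 / real n * l2norm (\<lambda>x. F1 x + F2 x)"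
    by (simp only: l2norm_scale norm_divide norm_one norm_of_nat)
  also have "\<dots> \<le> 1 / real n * (sqrt (real n) * l2norm f + sqrt (real n) * l2norm f)"
    using order_trans[OF l2norm_add[OF F] add_mono[OF 1 2]] by (intro mult_left_mono) auto
  also have "\<dots> = 2 * (sqrt (real n) / real n) * l2norm f"
    by (simp add: field_simps)
  also have "\<dots> = 2 / sqrt (real n) * l2norm f"
    using n by (simp add: sqrt_divide_self_eq inverse_eq_divide)
  finally show "l2norm (\<lambda>x. \<Sum>j<n. (1 / of_nat n) * lreg G (k j) f x) \<le> 2 / sqrt (real n) * l2norm f"
    unfolding eq .
qed

section \<open>Traces on nontrivial group elements\<close>

lemma tracial_state_conj:
  assumes \<tau>: "tracial_state G \<tau>" and "g \<in> carrier G" "s \<in> carrier G"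
  shows "\<tau> (lreg G (s \<otimes> g \<otimes> inv s)) = \<tau> (lreg G g)"
proof -
  have "\<tau> (lreg G s \<circ> lreg G (g \<otimes> inv s)) = \<tau> (lreg G (g \<otimes> inv s) \<circ> lreg G s)"
    using \<tau> assms group_alg_Cstar[OF group_alg_lreg] by (simp add: tracial_state_def)
  then show ?thesis
    using assms by (simp add: lreg_mult m_assoc)
qed

lemma tracial_state_sum:
  assumes \<tau>: "tracial_state G \<tau>" and "finite J" "\<And>j. j \<in> J \<Longrightarrow> k j \<in> carrier G"
  shows "\<tau> (\<lambda>f x. \<Sum>j\<in>J. c j * lreg G (k j) f x) = (\<Sum>j\<in>J. c j * \<tau> (lreg G (k j)))"
  using assms(2,3)
proof (induction J)
  case empty
  then show ?case using tracial_state_zero[OF \<tau>] by (simp add: zero_op_def)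
next
  case (insert j J)
  then have "(\<lambda>f x. \<Sum>j\<in>insert j J. c j * lreg G (k j) f x)
      = oplin (\<lambda>f x. \<Sum>j\<in>J. c j * lreg G (k j) f x) (c j) (lreg G (k j))"
    by (simp add: oplin_def add.commute)
  moreover have "\<tau> (oplin (\<lambda>f x. \<Sum>j\<in>J. c j * lreg G (k j) f x) (c j) (lreg G (k j)))
      = \<tau> (\<lambda>f x. \<Sum>j\<in>J. c j * lreg G (k j) f x) + c j * \<tau> (lreg G (k j))"
    using insert by (intro tracial_state_oplin[OF \<tau>] group_alg_Cstar group_alg_sum group_alg_lreg) auto
  ultimately show ?case using insert by (simp add: add.commute)
qed

text \<open>The set \<open>E j\<close> below is the complement of the translate of \<open>C\<close>
  by \<open>s j\<close>; the last hypothesis says that these complements are pairwise disjoint.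
  Conjugating \<open>g\<close> by \<open>s j\<close> sends everything outside \<open>E j\<close>
  into \<open>E j\<close>. All conjugates have the same trace, so the trace of \<open>g\<close> is
  that of an average of norm at most \<open>2 / sqrt n\<close>.\<close>

lemma tracial_state_lreg_zero:
  assumes \<tau>: "tracial_state G \<tau>" and g: "g \<in> carrier G"
    and C: "\<And>x. x \<in> C \<Longrightarrow> g \<otimes> x \<notin> C"
    and s: "\<And>j :: nat. s j \<in> carrier G"
    and disj: "\<And>i j x. i \<noteq> j \<Longrightarrow> x \<in> carrier G \<Longrightarrow> inv (s i) \<otimes> x \<in> C \<or> inv (s j) \<otimes> x \<in> C"
  shows "\<tau> (lreg G g) = 0"
proof -
  define k where "k j = s j \<otimes> g \<otimes> inv (s j)" for j
  define E where "E j = {x \<in> carrier G. inv (s j) \<otimes> x \<notin> C}" for j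
  have k: "k j \<in> carrier G" for j using s g by (simp add: k_def)
  have "cmod (\<tau> (lreg G g)) \<le> 3 * (2 / sqrt (real (Suc m)))" for m
  proof -
    let ?n = "Suc m"
    let ?A = "\<lambda>f x. \<Sum>j<?n. (1 / of_nat ?n) * lreg G (k j) f x"
    have "bnd G ?A (2 / sqrt (real ?n))"
    proof (rule bnd_average_lreg[where E = E, OF k])
      fix i j :: nat assume "i \<noteq> j"
      then show "E i \<inter> E j = {}" using disj[of i j] by (auto simp: E_def)
    next
      fix j :: nat and x assume x: "x \<in> carrier G" "x \<notin> E j"
      then have "g \<otimes> (inv (s j) \<otimes> x) \<notin> C" using C by (simp add: E_def)
      moreover have "inv (s j) \<otimes> (k j \<otimes> x) = g \<otimes> (inv (s j) \<otimes> x)"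
        using x g s[of j] by (simp add: k_def m_assoc[symmetric])
      ultimately show "k j \<otimes> x \<in> E j" using x k by (simp add: E_def)
    qed simp
    moreover have "?A \<in> Cstar_r G" by (intro group_alg_Cstar group_alg_sum k) simp
    ultimately have "cmod (\<tau> ?A) \<le> 3 * (2 / sqrt (real ?n))"
      by (intro tracial_state_bound[OF \<tau>]) simp_all
    moreover have "\<tau> ?A = (\<Sum>j<?n. (1 / of_nat ?n) * \<tau> (lreg G (k j)))"
      by (intro tracial_state_sum[OF \<tau>] k) simp
    moreover have "\<dots> = (\<Sum>j<?n. (1 / of_nat ?n) * \<tau> (lreg G g))"
      unfolding k_def using tracial_state_conj[OF \<tau> g s] by simp
    moreover have "\<dots> = \<tau> (lreg G g)"
      by (simp only: sum_constant card_lessThan) (simp del: of_nat_Suc)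
    ultimately show ?thesis by simp
  qed
  moreover have "(\<lambda>m. 3 * (2 / sqrt (real (Suc m)))) \<longlonglongrightarrow> 3 * 0"
    by (intro tendsto_intros filterlim_compose[OF sqrt_at_top]
        tendsto_divide_0[OF tendsto_const] filterlim_at_top_imp_at_infinity
        filterlim_compose[OF filterlim_real_sequentially filterlim_Suc])
  ultimately have "cmod (\<tau> (lreg G g)) \<le> 0"
    by (intro LIMSEQ_le_const[where a = "cmod (\<tau> (lreg G g))"]) auto
  then show ?thesis by simp
qed

lemma unique_traceI:
  assumes "\<And>g. g \<in> carrier G \<Longrightarrow> g \<noteq> \<one> \<Longrightarrow> \<exists>C (s :: nat \<Rightarrow> 'a).
      (\<forall>x\<in>C. g \<otimes> x \<notin> C) \<and> (\<forall>j. s j \<in> carrier G) \<and>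
      (\<forall>i j x. i \<noteq> j \<longrightarrow> x \<in> carrier G \<longrightarrow> inv (s i) \<otimes> x \<in> C \<or> inv (s j) \<otimes> x \<in> C)"
  shows "unique_trace G"
  unfolding unique_trace_def
proof (intro conjI tracial_state_can_trace allI impI ballI)
  fix \<tau> a assume \<tau>: "tracial_state G \<tau>" and a: "a \<in> Cstar_r G"
  have lreg: "\<tau> (lreg G g) = can_trace G (lreg G g)" if g: "g \<in> carrier G" for g
  proof (cases "g = \<one>")
    case True
    then show ?thesis
      using \<tau> tracial_state_can_trace by (simp add: tracial_state_def unit_op_def)
  next
    case False
    obtain C s where "\<And>x. x \<in> C \<Longrightarrow> g \<otimes> x \<notin> C" "\<And>j::nat. s j \<in> carrier G"
      "\<And>i j x. i \<noteq> j \<Longrightarrow> x \<in> carrier G \<Longrightarrow> inv (s i) \<otimes> x \<in> C \<or> inv (s j) \<otimes> x \<in> C"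
      using assms[OF g False] by metis
    then have "\<tau> (lreg G g) = 0" by (rule tracial_state_lreg_zero[OF \<tau> g])
    moreover have "can_trace G (lreg G g) = 0"
      using g False by (simp add: can_trace_apply lreg_delta) (simp add: delta_def)
    ultimately show ?thesis by simp
  qed
  have alg: "\<tau> S = can_trace G S" if "S \<in> group_alg G" for S
    using that
  proof (induction rule: group_alg_induct)
    case zero
    then show ?case using tracial_state_zero \<tau> tracial_state_can_trace by metis
  next
    case (add T c g)
    then show ?case
      using tracial_state_oplin[OF \<tau>] tracial_state_oplin[OF tracial_state_can_trace]
        group_alg_Cstar group_alg_lreg lreg by simp
  qed
  have "cmod (\<tau> a - can_trace G a) \<le> 0 + \<epsilon>" if "0 < \<epsilon>" for \<epsilon>
  proof -
    \<comment> \<open>Each of the two traces enlarges a bound at most threefold, contributing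
      \<open>\<epsilon> / 2\<close>.\<close>
    have pos: "0 < \<epsilon> / 6" using that by simp
    then obtain S where S: "S \<in> group_alg G" "bnd G (opsub a S) (\<epsilon> / 6)"
      using Cstar_approx[OF a] by blast
    note SC = group_alg_Cstar[OF S(1)]
    have d: "opsub a S \<in> Cstar_r G" unfolding opsub_oplin by (intro Cstar_oplin a SC)
    have eq: "\<tau> a - can_trace G a = \<tau> (opsub a S) - can_trace G (opsub a S)"
      unfolding opsub_oplin tracial_state_oplin[OF \<tau> a SC] tracial_state_oplin[OF tracial_state_can_trace a SC]
      using alg[OF S(1)] by simp
    show ?thesis
      unfolding eq
      using tracial_state_bound[OF \<tau> d S(2) pos] tracial_state_bound[OF tracial_state_can_trace d S(2) pos]
        norm_triangle_ineq4[of "\<tau> (opsub a S)" "can_trace G (opsub a S)"] by linarith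
  qed
  then have "cmod (\<tau> a - can_trace G a) \<le> 0" by (rule field_le_epsilon)
  then show "\<tau> a = can_trace G a" by simp
qed

section \<open>A criterion for failure of C*-simplicity\<close>

definition coset_vec :: "'a set \<Rightarrow> 'a \<Rightarrow> 'a \<Rightarrow> complex" where
  "coset_vec F z = (\<lambda>x. if x \<in> carrier G \<and> inv z \<otimes> x \<in> F then of_real (1 / sqrt (real (card F))) else 0)"

lemma coset_vec_l2:
  assumes F: "subgroup F G" "finite F" and z: "z \<in> carrier G"
  shows "coset_vec F z \<in> l2 G" and l2norm_coset_vec: "l2norm (coset_vec F z) = 1"
proof -
  have sub: "F \<subseteq> carrier G" by (rule subgroup.subset[OF F(1)])
  have supp: "coset_vec F z x = 0" if "x \<notin> (\<lambda>y. z \<otimes> y) ` F" for x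
  proof -
    have False if "x \<in> carrier G" "inv z \<otimes> x \<in> F"
    proof -
      have "x = z \<otimes> (inv z \<otimes> x)" using that z by (simp add: m_assoc[symmetric])
      then show False using that \<open>x \<notin> _\<close> by blast
    qed
    then show ?thesis by (auto simp: coset_vec_def)
  qed
  have fin: "finite ((\<lambda>y. z \<otimes> y) ` F)" "(\<lambda>y. z \<otimes> y) ` F \<subseteq> carrier G"
    using F sub z by auto
  show "coset_vec F z \<in> l2 G" by (rule l2_finite_support[OF fin supp])
  have card: "card ((\<lambda>y. z \<otimes> y) ` F) = card F" "0 < card F"
    using z sub F subgroup.one_closed[OF F(1)]
    by (auto intro!: card_image inj_onI simp: card_gt_0_iff subset_iff)
  have "coset_vec F z x = of_real (1 / sqrt (real (card F)))" if "x \<in> (\<lambda>y. z \<otimes> y) ` F" for x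
    using that z sub by (auto simp: coset_vec_def m_assoc[symmetric] subset_iff)
  then have "L2_set (\<lambda>x. cmod (coset_vec F z x)) ((\<lambda>y. z \<otimes> y) ` F)
      = L2_set (\<lambda>x. 1 / sqrt (real (card F))) ((\<lambda>y. z \<otimes> y) ` F)"
    by (intro L2_set_cong) (simp_all add: norm_divide)
  also have "\<dots> = 1" using card by (simp add: L2_set_constant)
  finally show "l2norm (coset_vec F z) = 1"
    using l2norm_finite_support[OF fin(1) supp] by simp
qed

lemma lreg_coset_vec:
  assumes F: "subgroup F G" "finite F" and "g \<in> carrier G" "z \<in> carrier G"
  shows "lreg G g (coset_vec F z) = coset_vec F (g \<otimes> z)"
proof
  fix x
  show "lreg G g (coset_vec F z) x = coset_vec F (g \<otimes> z) x"
    using assms(3,4) unfolding lreg_apply[OF coset_vec_l2(1)[OF F assms(4)]]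
    by (simp add: coset_vec_def inv_mult_group m_assoc)
qed

text \<open>Under the hypothesis \<open>g\<close> maps the coset of \<open>z\<close> to itself,
  because \<open>inv (g \<otimes> z) \<otimes> x\<close> and \<open>inv z \<otimes> x\<close> differ
  by a left factor from \<open>F\<close>.\<close>

lemma coset_vec_eq:
  assumes F: "subgroup F G" and z: "z \<in> carrier G" and g: "g \<in> carrier G" "inv z \<otimes> g \<otimes> z \<in> F"
  shows "coset_vec F (g \<otimes> z) = coset_vec F z"
proof
  fix x
  have "inv (g \<otimes> z) \<otimes> x \<in> F \<longleftrightarrow> inv z \<otimes> x \<in> F" if x: "x \<in> carrier G"
  proof -
    have eq: "inv z \<otimes> x = (inv z \<otimes> g \<otimes> z) \<otimes> (inv (g \<otimes> z) \<otimes> x)"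
      using x z g(1) by (simp add: inv_mult_group m_assoc) (simp add: m_assoc[symmetric])
    show ?thesis
    proof
      assume "inv (g \<otimes> z) \<otimes> x \<in> F"
      then show "inv z \<otimes> x \<in> F"
        unfolding eq by (rule subgroup.m_closed[OF F g(2)])
    next
      assume *: "inv z \<otimes> x \<in> F"
      have "inv (g \<otimes> z) \<otimes> x = inv (inv z \<otimes> g \<otimes> z) \<otimes> (inv z \<otimes> x)"
        unfolding eq using x z g(1)
        by (metis inv_closed l_inv l_one m_assoc m_closed)
      then show "inv (g \<otimes> z) \<otimes> x \<in> F"
        using subgroup.m_closed[OF F subgroup.m_inv_closed[OF F g(2)] *] by simp
    qed
  qed
  then show "coset_vec F (g \<otimes> z) x = coset_vec F z x" by (auto simp: coset_vec_def)
qed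

text \<open>The ideal is the kernel of the representation on \<open>\<ell>\<^sup>2(G / \<Union>F)\<close>: unit vectors supported on
  the cosets of \<open>F n\<close> play the role of the basis vectors of that space.\<close>
lemma not_Cstar_simpleI:
  fixes F :: "nat \<Rightarrow> 'a set"
  assumes F: "\<And>n. subgroup (F n) G" "\<And>n. finite (F n)" "\<And>m n. m \<le> n \<Longrightarrow> F m \<subseteq> F n"
    and a: "a \<in> carrier G" "a \<noteq> \<one>" and b: "b \<in> carrier G" "b \<noteq> \<one>" and ab: "a \<otimes> b = b \<otimes> a"
    and fixes_coset: "\<And>z. z \<in> carrier G \<Longrightarrow>
      (\<exists>n. inv z \<otimes> a \<otimes> z \<in> F n) \<or> (\<exists>n. inv z \<otimes> b \<otimes> z \<in> F n)"
  shows "\<not> Cstar_simple G"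
proof
  assume simple: "Cstar_simple G"
  define u where "u z n = coset_vec (F n) z" for z n
  have u: "u z n \<in> l2 G" "l2norm (u z n) = 1" if "z \<in> carrier G" for z n
    unfolding u_def using coset_vec_l2 l2norm_coset_vec F that by auto
  have lreg_u: "lreg G g (u z n) = u (g \<otimes> z) n" if "g \<in> carrier G" "z \<in> carrier G" for g z n
    unfolding u_def using lreg_coset_vec F that by auto
  \<comment> \<open>Right multiplication by \<open>lreg G g\<close> turns the test vectors at
    \<open>z\<close> into those at \<open>g \<otimes> z\<close>; quantifying over all
    \<open>z\<close> is what makes this left ideal two-sided.\<close>
  define I where "I = {T \<in> Cstar_r G. \<forall>z\<in>carrier G. (\<lambda>n. l2norm (T (u z n))) \<longlonglongrightarrow> 0}"
  have zeroI: "zero_op \<in> I"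
    using group_alg_Cstar[OF group_alg_zero] by (simp add: I_def) (simp add: zero_op_def)
  have linI: "oplin x c y \<in> I" if x: "x \<in> I" and y: "y \<in> I" for x y c
  proof -
    have C: "x \<in> Cstar_r G" "y \<in> Cstar_r G" using x y by (auto simp: I_def)
    have "(\<lambda>n. l2norm (oplin x c y (u z n))) \<longlonglongrightarrow> 0" if z: "z \<in> carrier G" for z
    proof (rule tendsto_sandwich[OF _ _ tendsto_const])
      have "l2norm (oplin x c y (u z n)) \<le> l2norm (x (u z n)) + cmod c * l2norm (y (u z n))" for n
        unfolding oplin_def by (intro l2norm_lincomb[of _ G] bounded_opD(2)[OF Cstar_bounded] C)
      then show "\<forall>\<^sub>F n in sequentially. l2norm (oplin x c y (u z n))
          \<le> l2norm (x (u z n)) + cmod c * l2norm (y (u z n))" by simp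
      have "(\<lambda>n. l2norm (x (u z n)) + cmod c * l2norm (y (u z n))) \<longlonglongrightarrow> 0 + cmod c * 0"
        using x y z by (intro tendsto_intros) (auto simp: I_def)
      then show "(\<lambda>n. l2norm (x (u z n)) + cmod c * l2norm (y (u z n))) \<longlonglongrightarrow> 0" by simp
    qed simp
    then show ?thesis using Cstar_oplin C by (simp add: I_def)
  qed
  have closI: "T \<in> I" if T: "T \<in> Cstar_r G"
    and ap: "\<And>\<epsilon>. 0 < \<epsilon> \<Longrightarrow> \<exists>x\<in>I. bnd G (opsub T x) \<epsilon>" for T
  proof -
    have "(\<lambda>n. l2norm (T (u z n))) \<longlonglongrightarrow> 0" if z: "z \<in> carrier G" for z
    proof (rule LIMSEQ_I)
      fix r :: real assume "0 < r"
      then obtain x where x: "x \<in> I" "bnd G (opsub T x) (r / 2)"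
        using ap half_gt_zero by blast
      then have xC: "x \<in> Cstar_r G" by (simp add: I_def)
      obtain N where N: "\<And>n. N \<le> n \<Longrightarrow> l2norm (x (u z n)) < r / 2"
        using LIMSEQ_D[of "\<lambda>n. l2norm (x (u z n))" 0 "r / 2"] x(1) z \<open>0 < r\<close>
        by (auto simp: I_def)
      have "l2norm (T (u z n)) < r" if "N \<le> n" for n
      proof -
        have "l2norm (T (u z n)) \<le> l2norm (opsub T x (u z n)) + l2norm (x (u z n))"
          using l2norm_add[OF bounded_opD(2)[OF bounded_op_opsub[OF Cstar_bounded[OF T] Cstar_bounded[OF xC]]]
              bounded_opD(2)[OF Cstar_bounded[OF xC]], of "u z n" "u z n"] by simp
        moreover have "l2norm (opsub T x (u z n)) \<le> r / 2"
          using bndD[OF x(2) u(1)[OF z], of n] u(2)[OF z, of n] by simp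
        ultimately show ?thesis using N[OF that] by linarith
      qed
      then show "\<exists>no. \<forall>n\<ge>no. norm (l2norm (T (u z n)) - 0) < r" by auto
    qed
    then show ?thesis using T by (simp add: I_def)
  qed
  have leftI: "s \<circ> x \<in> I" if s: "s \<in> Cstar_r G" and x: "x \<in> I" for s x
  proof -
    have xC: "x \<in> Cstar_r G" using x by (simp add: I_def)
    obtain K where K: "0 \<le> K" "bnd G s K" using bounded_opD(4)[OF Cstar_bounded[OF s]] by blast
    have "(\<lambda>n. l2norm (s (x (u z n)))) \<longlonglongrightarrow> 0" if z: "z \<in> carrier G" for z
    proof (rule tendsto_sandwich[OF _ _ tendsto_const])
      show "\<forall>\<^sub>F n in sequentially. l2norm (s (x (u z n))) \<le> K * l2norm (x (u z n))"
        using bndD[OF K(2) bounded_opD(2)[OF Cstar_bounded[OF xC]]] by simp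
      have "(\<lambda>n. K * l2norm (x (u z n))) \<longlonglongrightarrow> K * 0"
        using x z by (intro tendsto_intros) (auto simp: I_def)
      then show "(\<lambda>n. K * l2norm (x (u z n))) \<longlonglongrightarrow> 0" by simp
    qed simp
    then show ?thesis using Cstar_comp[OF s xC] by (simp add: I_def)
  qed
  have right_algI: "x \<circ> S \<in> I" if x: "x \<in> I" and S: "S \<in> group_alg G" for x S
    using S
  proof (induction rule: group_alg_induct)
    case zero
    have "x \<circ> zero_op = zero_op"
      using x bounded_op_zero[OF Cstar_bounded] by (auto simp: I_def zero_op_def)
    then show ?case using zeroI by simp
  next
    case (add T c g)
    have xC: "x \<in> Cstar_r G" using x by (simp add: I_def)
    have "x \<circ> lreg G g \<in> I"
      using x add(2) lreg_u Cstar_comp[OF xC group_alg_Cstar[OF group_alg_lreg[OF add(2)]]]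
      by (auto simp: I_def)
    then show ?case
      using linI[OF add(3)]
        comp_oplin[OF Cstar_bounded[OF xC] group_alg_bounded[OF add(1)] bounded_op_lreg[OF add(2)]]
      by metis
  qed
  \<comment> \<open>A general \<open>s\<close> does not map test vectors to test vectors, so it is
    approximated by the group algebra and closedness of \<open>I\<close> finishes the
    argument.\<close>
  have rightI: "x \<circ> s \<in> I" if s: "s \<in> Cstar_r G" and x: "x \<in> I" for s x
  proof (rule closI)
    have xC: "x \<in> Cstar_r G" using x by (simp add: I_def)
    show "x \<circ> s \<in> Cstar_r G" by (rule Cstar_comp[OF xC s])
    fix \<epsilon> :: real assume "0 < \<epsilon>"
    obtain K where K: "0 \<le> K" "bnd G x K" using bounded_opD(4)[OF Cstar_bounded[OF xC]] by blast
    have "0 < \<epsilon> / (K + 1)" using \<open>0 < \<epsilon>\<close> K by simp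
    then obtain S where S: "S \<in> group_alg G" "bnd G (opsub s S) (\<epsilon> / (K + 1))"
      using Cstar_approx[OF s] by blast
    note bo = Cstar_bounded[OF xC] Cstar_bounded[OF s] group_alg_bounded[OF S(1)]
    have "bnd G (x \<circ> opsub s S) (K * (\<epsilon> / (K + 1)))"
      by (intro bnd_comp bounded_op_opsub bo K S)
    moreover have "K * (\<epsilon> / (K + 1)) \<le> \<epsilon>" using \<open>0 < \<epsilon>\<close> K(1) by (simp add: field_simps)
    ultimately have "bnd G (opsub (x \<circ> s) (x \<circ> S)) \<epsilon>"
      unfolding comp_opsub[OF bo] by (rule bnd_mono)
    then show "\<exists>y\<in>I. bnd G (opsub (x \<circ> s) y) \<epsilon>"
      using right_algI[OF x S(1)] by (rule bexI)
  qed
  have "closed_ideal G I"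
    unfolding closed_ideal_def
  proof (intro conjI ballI allI impI)
    show "I \<subseteq> Cstar_r G" by (auto simp: I_def)
    show "zero_op \<in> I" by (rule zeroI)
  next
    fix x y assume "x \<in> I" "y \<in> I"
    then show "(\<lambda>f z. x f z + y f z) \<in> I" using linI[of x y 1] by (simp add: oplin_def)
  next
    fix x c assume "x \<in> I"
    then show "(\<lambda>f z. c * x f z) \<in> I" using linI[OF zeroI, of x c] by (simp add: oplin_def zero_op_def)
  next
    fix s x assume "s \<in> Cstar_r G" "x \<in> I"
    then show "s \<circ> x \<in> I" "x \<circ> s \<in> I" by (rule leftI rightI)+
  next
    fix T assume T: "T \<in> Cstar_r G" and ap: "\<forall>\<epsilon>>0. \<exists>x\<in>I. opnorm G (opsub T x) < \<epsilon>"
    show "T \<in> I"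
    proof (rule closI[OF T])
      fix \<epsilon> :: real assume "0 < \<epsilon>"
      then obtain x where x: "x \<in> I" "opnorm G (opsub T x) < \<epsilon>" using ap by blast
      then have "x \<in> Cstar_r G" by (simp add: I_def)
      then have "bnd G (opsub T x) (opnorm G (opsub T x))"
        by (intro bnd_opnorm bounded_op_opsub Cstar_bounded T)
      then have "bnd G (opsub T x) \<epsilon>" by (rule bnd_mono) (use x in simp)
      then show "\<exists>x\<in>I. bnd G (opsub T x) \<epsilon>" using x(1) by (rule bexI)
    qed
  qed
  then consider "I = {zero_op}" | "I = Cstar_r G"
    using simple by (auto simp: Cstar_simple_def)
  then show False
  proof cases
    case 1
    \<comment> \<open>The expansion of \<open>(1 - a)(1 - b)\<close>. Since \<open>a\<close> and
      \<open>b\<close> commute, either factor may act first, and on each coset one of them kills the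
      test vector for all large \<open>n\<close>.\<close>
    define W where "W = oplin (oplin (oplin (lreg G \<one>) (-1) (lreg G a)) (-1) (lreg G b)) 1 (lreg G (a \<otimes> b))"
    have WC: "W \<in> Cstar_r G"
      unfolding W_def using a b by (intro group_alg_Cstar group_alg_oplin group_alg_lreg) auto
    have "\<forall>\<^sub>F n in sequentially. W (u z n) = (\<lambda>x. 0)" if z: "z \<in> carrier G" for z
    proof -
      have W: "W (u z n) = (\<lambda>x. u z n x - u (a \<otimes> z) n x - u (b \<otimes> z) n x + u (a \<otimes> b \<otimes> z) n x)" for n
        using a b z by (simp add: W_def oplin_def lreg_u)
      consider N where "inv z \<otimes> a \<otimes> z \<in> F N" | N where "inv z \<otimes> b \<otimes> z \<in> F N"
        using fixes_coset[OF z] by blast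
      then show ?thesis
      proof cases
        case 1
        have "W (u z n) = (\<lambda>x. 0)" if "N \<le> n" for n
        proof -
          have "u (a \<otimes> z) n = u z n"
            unfolding u_def using 1 F(3)[OF that] by (intro coset_vec_eq F z a) blast
          moreover have "u (a \<otimes> b \<otimes> z) n = u (b \<otimes> z) n"
            using calculation a b z by (simp add: ab m_assoc lreg_u[symmetric])
          ultimately show ?thesis by (simp add: W)
        qed
        then show ?thesis by (auto simp: eventually_sequentially)
      next
        case 2
        have "W (u z n) = (\<lambda>x. 0)" if "N \<le> n" for n
        proof -
          have "u (b \<otimes> z) n = u z n"
            unfolding u_def using 2 F(3)[OF that] by (intro coset_vec_eq F z b) blast
          moreover have "u (a \<otimes> b \<otimes> z) n = u (a \<otimes> z) n"
            using calculation a b z by (simp add: m_assoc lreg_u[symmetric])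
          ultimately show ?thesis by (simp add: W)
        qed
        then show ?thesis by (auto simp: eventually_sequentially)
      qed
    qed
    then have "(\<lambda>n. l2norm (W (u z n))) \<longlonglongrightarrow> 0" if "z \<in> carrier G" for z
      using that by (intro tendsto_eventually) (fastforce elim: eventually_mono)
    then have "W \<in> I" using WC by (simp add: I_def)
    then have "W (delta \<one>) \<one> = 0" using 1 by (simp add: zero_op_def)
    \<comment> \<open>The unit contributes 1, the terms for \<open>a\<close> and \<open>b\<close>
      contribute 0, and the product contributes 1 exactly if it is trivial; nothing can
      cancel.\<close>
    moreover have "W (delta \<one>) \<one> = (if a \<otimes> b = \<one> then 2 else 1)"
      using a b by (auto simp: W_def oplin_def lreg_delta) (auto simp: delta_def)
    ultimately show False by (simp split: if_splits)
  next
    case 2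
    then have "unit_op G \<in> I" using unit_op_Cstar by simp
    then have "(\<lambda>n. l2norm (unit_op G (u \<one> n))) \<longlonglongrightarrow> 0" by (simp add: I_def)
    then have "(\<lambda>n. 1::real) \<longlonglongrightarrow> 0"
      using u[OF one_closed] by (simp add: unit_op_def lreg_one)
    then show False by (simp add: LIMSEQ_const_iff)
  qed
qed

end

section \<open>The group \<open>\<Gamma>\<close>\<close>

lemma weq_context: "weq u v \<Longrightarrow> weq (p @ u @ q) (p @ v @ q)"
proof (induction rule: weq.induct)
  case (cancel u x b v)
  show ?case using weq.cancel[of "p @ u" x b "v @ q"] by simp
next
  case (rel r u v)
  then show ?case using weq.rel[of r "p @ u" "v @ q"] by simp
qed (blast intro: weq.intros)+

lemma weq_append: "weq a a' \<Longrightarrow> weq b b' \<Longrightarrow> weq (a @ b) (a' @ b')"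
  using weq_context[of a a' "[]" b] weq_context[of b b' a' "[]"] weq.trans by auto

lemma wclass_eq_iff: "wclass u = wclass v \<longleftrightarrow> weq u v"
  unfolding wclass_def by (auto intro: weq.intros)

lemma wclass_mult: "wclass a \<otimes>\<^bsub>Gamma\<^esub> wclass b = wclass (a @ b)"
  unfolding Gamma_def wclass_def
  by (auto intro: weq.refl weq.trans[OF weq_append])

lemma Gamma_one: "\<one>\<^bsub>Gamma\<^esub> = wclass []"
  by (simp add: Gamma_def)

lemma wclass_in_Gamma: "valid_word w \<Longrightarrow> wclass w \<in> carrier Gamma"
  by (auto simp: Gamma_def)

lemma Gamma_cases:
  assumes "A \<in> carrier Gamma"
  obtains w where "valid_word w" "A = wclass w"
  using assms by (auto simp: Gamma_def)

definition winv :: "letter list \<Rightarrow> letter list" where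
  "winv w = rev (map (\<lambda>(x, b). (x, \<not> b)) w)"

lemma winv_cancel: "weq (winv w @ w) []"
proof (induction w)
  case (Cons l w)
  obtain x b where l: "l = (x, b)" by fastforce
  have "weq (winv w @ [(x, \<not> b), (x, \<not> \<not> b)] @ w) (winv w @ w)" by (rule weq.cancel)
  then show ?case using Cons l by (auto simp: winv_def intro: weq.trans)
qed (simp add: winv_def weq.refl)

lemma group_Gamma: "group Gamma"
proof (rule groupI)
  fix A B assume "A \<in> carrier Gamma" "B \<in> carrier Gamma"
  then show "A \<otimes>\<^bsub>Gamma\<^esub> B \<in> carrier Gamma"
    by (elim Gamma_cases) (auto simp: wclass_mult valid_word_def intro!: wclass_in_Gamma)
next
  show "\<one>\<^bsub>Gamma\<^esub> \<in> carrier Gamma"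
    by (auto simp: Gamma_one valid_word_def intro!: wclass_in_Gamma)
next
  fix A B C assume "A \<in> carrier Gamma" "B \<in> carrier Gamma" "C \<in> carrier Gamma"
  then show "A \<otimes>\<^bsub>Gamma\<^esub> B \<otimes>\<^bsub>Gamma\<^esub> C = A \<otimes>\<^bsub>Gamma\<^esub> (B \<otimes>\<^bsub>Gamma\<^esub> C)"
    by (elim Gamma_cases) (simp add: wclass_mult)
next
  fix A assume "A \<in> carrier Gamma"
  then show "\<one>\<^bsub>Gamma\<^esub> \<otimes>\<^bsub>Gamma\<^esub> A = A"
    by (elim Gamma_cases) (simp add: wclass_mult Gamma_one)
next
  fix A assume "A \<in> carrier Gamma"
  then obtain w where w: "valid_word w" "A = wclass w" by (rule Gamma_cases)
  have "wclass (winv w) \<otimes>\<^bsub>Gamma\<^esub> A = \<one>\<^bsub>Gamma\<^esub>"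
    by (simp add: w(2) wclass_mult Gamma_one wclass_eq_iff winv_cancel)
  moreover have "valid_word (winv w)" using w(1) by (auto simp: valid_word_def winv_def)
  ultimately show "\<exists>B\<in>carrier Gamma. B \<otimes>\<^bsub>Gamma\<^esub> A = \<one>\<^bsub>Gamma\<^esub>"
    using wclass_in_Gamma by blast
qed

interpretation Gamma: group Gamma
  by (rule group_Gamma)

abbreviation gmult (infixl \<open>\<cdot>\<close> 70) where "x \<cdot> y \<equiv> x \<otimes>\<^bsub>Gamma\<^esub> y"
abbreviation gone (\<open>\<e>\<close>) where "\<e> \<equiv> \<one>\<^bsub>Gamma\<^esub>"

definition gen_el :: "gen \<Rightarrow> letter list set" where
  "gen_el x = wclass [gl x]"

lemma gen_el_closed [simp]: "valid_gen x \<Longrightarrow> gen_el x \<in> carrier Gamma"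
  by (auto simp: gen_el_def valid_word_def intro!: wclass_in_Gamma)

lemma gen_el_sq:
  assumes "valid_gen x"
  shows "gen_el x \<cdot> gen_el x = \<e>"
proof -
  have "[gl x, gl x] \<in> relators"
    using assms by (cases x) (auto intro: relators.intros)
  from weq.rel[OF this, of "[]" "[]"] show ?thesis
    by (simp add: gen_el_def wclass_mult Gamma_one wclass_eq_iff)
qed

text \<open>Every generator is an involution, so the inverse flag is invisible in the group and
  induction over elements may use positive letters alone.\<close>

lemma wclass_letter:
  assumes "valid_gen x"
  shows "wclass [(x, b)] = gen_el x"
proof (cases b)
  case True
  have "wclass [(x, True)] \<cdot> gen_el x = \<e>"
    using weq.cancel[of "[]" x True "[]"]
    by (simp add: gen_el_def wclass_mult Gamma_one wclass_eq_iff)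
  moreover have "wclass [(x, True)] \<in> carrier Gamma"
    using assms by (auto simp: valid_word_def intro!: wclass_in_Gamma)
  ultimately have "wclass [(x, True)] = inv\<^bsub>Gamma\<^esub> gen_el x"
    using Gamma.inv_equality assms by simp
  moreover have "gen_el x = inv\<^bsub>Gamma\<^esub> gen_el x"
    using Gamma.inv_equality[OF gen_el_sq[OF assms]] assms by simp
  ultimately show ?thesis using True by simp
qed (simp add: gen_el_def)

lemma Gamma_induct [consumes 1, case_names one gen]:
  assumes "z \<in> carrier Gamma" and "P \<e>"
    and step: "\<And>x z. valid_gen x \<Longrightarrow> z \<in> carrier Gamma \<Longrightarrow> P z \<Longrightarrow> P (gen_el x \<cdot> z)"
  shows "P z"
proof -
  obtain w where w: "valid_word w" "z = wclass w" using assms(1) by (rule Gamma_cases)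
  have "P (wclass w)" using w(1)
  proof (induction w)
    case Nil
    then show ?case using assms(2) by (simp add: Gamma_one)
  next
    case (Cons l w)
    obtain x b where l: "l = (x, b)" by fastforce
    have v: "valid_gen x" "valid_word w" using Cons.prems l by (auto simp: valid_word_def)
    have "wclass (l # w) = gen_el x \<cdot> wclass w"
      using wclass_mult[of "[l]" w] wclass_letter[OF v(1), of b] l by simp
    then show ?case using step[OF v(1) wclass_in_Gamma[OF v(2)] Cons.IH[OF v(2)]] by simp
  qed
  then show ?thesis using w by simp
qed

text \<open>All relators have even length.\<close>
lemma weq_parity: "weq u v \<Longrightarrow> even (length u) \<longleftrightarrow> even (length v)"
proof (induction rule: weq.induct)
  case (rel r u v)
  then have "even (length r)" by cases auto
  then show ?case by simp
qed auto

lemma gen_el_neq_one: "gen_el x \<noteq> \<e>"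
  using weq_parity[of "[gl x]" "[]"] by (auto simp: gen_el_def Gamma_one wclass_eq_iff)

subsection \<open>Relations\<close>

lemma relator_conj:
  assumes "[gl x, gl y, gl z, gi w] \<in> relators"
  shows "gen_el x \<cdot> gen_el y \<cdot> gen_el z = gen_el w"
proof -
  have 1: "weq [gl x, gl y, gl z, gi w, gl w] [gl w]"
    using weq.rel[OF assms, of "[]" "[gl w]"] by simp
  have 2: "weq [gl x, gl y, gl z, gi w, gl w] [gl x, gl y, gl z]"
    using weq.cancel[of "[gl x, gl y, gl z]" w True "[]"] by simp
  have "weq [gl x, gl y, gl z] [gl w]"
    by (rule weq.trans[OF weq.sym[OF 2] 1])
  then show ?thesis by (simp add: gen_el_def wclass_mult wclass_eq_iff)
qed

definition h :: "bool list \<Rightarrow> letter list set" where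
  "h s = gen_el (Hg s)"

text \<open>Indexing by a digit exposes the symmetry between \<open>G0\<close> and \<open>G1\<close>
  under exchanging 0 and 1, so each relation is stated once.\<close>

definition g :: "bool \<Rightarrow> letter list set" where
  "g i = gen_el (if i then G1 else G0)"

lemma h_closed [simp]: "s \<noteq> [] \<Longrightarrow> h s \<in> carrier Gamma"
  and h_sq: "s \<noteq> [] \<Longrightarrow> h s \<cdot> h s = \<e>"
  by (auto simp: h_def gen_el_sq)

lemma g_closed [simp]: "g i \<in> carrier Gamma"
  and g_sq: "g i \<cdot> g i = \<e>"
  by (auto simp: g_def gen_el_sq)

lemma h_inv: "s \<noteq> [] \<Longrightarrow> inv\<^bsub>Gamma\<^esub> h s = h s"
  using Gamma.inv_equality[OF h_sq] by simp

lemma g_inv: "inv\<^bsub>Gamma\<^esub> g i = g i"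
  using Gamma.inv_equality[OF g_sq] by simp

lemma h_conj: "i \<noteq> [] \<Longrightarrow> length i \<le> length j \<Longrightarrow> h i \<cdot> h j \<cdot> h i = h (hconj i j)"
  unfolding h_def by (intro relator_conj relators.intros)

lemma g_conj_h: "g i \<cdot> h (i # r) \<cdot> g i = h ((\<not> i) # i # r)"
  and g_conj_h': "g i \<cdot> h ((\<not> i) # i # r) \<cdot> g i = h (i # r)"
proof -
  show *: "g i \<cdot> h ((\<not> i) # i # r) \<cdot> g i = h (i # r)"
    unfolding h_def g_def by (cases i) (auto intro!: relator_conj intro: relators.intros)
  show "g i \<cdot> h (i # r) \<cdot> g i = h ((\<not> i) # i # r)"
    unfolding *[symmetric] by (simp add: Gamma.m_assoc g_sq) (simp add: Gamma.m_assoc[symmetric] g_sq)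
qed

lemma g_conj_h_fixed: "g i \<cdot> h ((\<not> i) # (\<not> i) # r) \<cdot> g i = h ((\<not> i) # (\<not> i) # r)"
  unfolding h_def g_def by (cases i) (auto intro!: relator_conj intro: relators.intros)

text \<open>The cube relator says that the two sides are mutually inverse, and the right side is its
  own inverse. Read from left to right, it trades two occurrences of \<open>g i\<close> for
  one.\<close>

lemma g_braid: "g i \<cdot> h [\<not> i] \<cdot> g i = h [\<not> i] \<cdot> g i \<cdot> h [\<not> i]"
proof -
  let ?x = "if i then G1 else G0" and ?y = "Hg [\<not> i]"
  have "[gl ?x, gl ?y, gl ?x, gl ?y, gl ?x, gl ?y] \<in> relators"
    by (cases i) (auto intro: relators.intros)
  from weq.rel[OF this, of "[]" "[]"]
  have 1: "(g i \<cdot> h [\<not> i] \<cdot> g i) \<cdot> (h [\<not> i] \<cdot> g i \<cdot> h [\<not> i]) = \<e>"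
    by (simp add: g_def h_def gen_el_def wclass_mult Gamma_one wclass_eq_iff)
  have c: "h [\<not> i] \<in> carrier Gamma" "g i \<in> carrier Gamma" by auto
  have "(h [\<not> i] \<cdot> g i \<cdot> h [\<not> i]) \<cdot> (h [\<not> i] \<cdot> g i \<cdot> h [\<not> i])
      = h [\<not> i] \<cdot> (g i \<cdot> (h [\<not> i] \<cdot> h [\<not> i]) \<cdot> g i) \<cdot> h [\<not> i]"
    using c by (simp only: Gamma.m_assoc Gamma.m_closed)
  also have "\<dots> = \<e>" using c by (simp add: g_sq h_sq)
  finally have 2: "(h [\<not> i] \<cdot> g i \<cdot> h [\<not> i]) \<cdot> (h [\<not> i] \<cdot> g i \<cdot> h [\<not> i]) = \<e>" .
  show ?thesis
    using Gamma.inv_equality[OF 1] Gamma.inv_equality[OF 2] c by simp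
qed

subsection \<open>The action on the Cantor space\<close>

fun hact :: "bool list \<Rightarrow> bool stream \<Rightarrow> bool stream" where
  "hact [] x = (\<not> shd x) ## stl x"
| "hact (b # s) x = (if shd x = b then b ## hact s (stl x) else x)"

definition g_act :: "bool \<Rightarrow> bool stream \<Rightarrow> bool stream" where
  "g_act i x = (if shd x = i then (\<not> i) ## x else if shd (stl x) = i then stl x else x)"

fun act_gen :: "gen \<Rightarrow> bool stream \<Rightarrow> bool stream" where
  "act_gen (Hg s) = hact s"
| "act_gen G0 = g_act False"
| "act_gen G1 = g_act True"

text \<open>The flags are dropped because every generator acts as an involution.\<close>

definition act :: "letter list \<Rightarrow> bool stream \<Rightarrow> bool stream" where
  "act w = foldr (\<lambda>l f. act_gen (fst l) \<circ> f) w id"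

lemma act_append: "act (u @ v) = act u \<circ> act v"
  by (induction u) (auto simp: act_def)

lemma act_Nil [simp]: "act [] = id" and act_Cons [simp]: "act (l # w) = act_gen (fst l) \<circ> act w"
  by (auto simp: act_def)

lemma hact_hact: "hact s (hact s x) = x"
  by (induction s arbitrary: x) auto

lemma g_act_simps [simp]:
  "g_act i (i ## r) = (\<not> i) ## i ## r"
  "g_act i ((\<not> i) ## i ## r) = i ## r"
  "g_act i ((\<not> i) ## (\<not> i) ## r) = (\<not> i) ## (\<not> i) ## r"
  by (auto simp: g_act_def)

lemma g_act_g_act: "g_act i (g_act i x) = x"
proof -
  obtain a b c where "x = a ## b ## c" by (metis stream.collapse)
  then show ?thesis by (auto simp: g_act_def)
qed

lemma act_gen_act_gen: "act_gen x (act_gen x r) = r"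
  by (cases x) (auto simp: hact_hact g_act_g_act)

text \<open>A recursive form of the prefix condition, parallel to the recursion of
  \<open>hact\<close>. It passes through the empty prefix, although \<open>h []\<close> is not an
  element of the group.\<close>

lemma hconj_simps [simp]:
  "hconj [] (b # j) = (\<not> b) # j"
  "hconj [] [] = []"
  "hconj (a # i) (b # j) = b # (if a = b then hconj i j else j)"
  by (auto simp: hconj_def)

lemma hact_conj: "length i \<le> length j \<Longrightarrow> hact i (hact j (hact i x)) = hact (hconj i j) x"
proof (induction i arbitrary: j x)
  case Nil
  then show ?case by (cases j) auto
next
  case (Cons a i)
  then obtain b j' where "j = b # j'" by (cases j) auto
  moreover obtain c y where "x = c ## y" by (metis stream.collapse)
  ultimately show ?case using Cons by (auto simp: hact_hact)
qed

lemma act_relator: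
  assumes "r \<in> relators"
  shows "act r = id"
proof
  fix x :: "bool stream"
  obtain a b c where x: "x = a ## b ## c" by (metis stream.collapse)
  show "act r x = id x"
    using assms
  proof cases
    case (h_conj i j)
    then show ?thesis using hact_conj[of i j] hact_hact by simp
  qed (use x in \<open>auto simp: hact_hact g_act_g_act g_act_def\<close>)
qed

lemma act_weq: "weq u v \<Longrightarrow> act u = act v"
proof (induction rule: weq.induct)
  case (cancel u x b v)
  then show ?case by (auto simp: act_append act_gen_act_gen fun_eq_iff)
qed (auto simp: act_append act_relator)

definition gact :: "letter list set \<Rightarrow> bool stream \<Rightarrow> bool stream" where
  "gact A = act (SOME w. w \<in> A)"

lemma gact_wclass: "gact (wclass w) = act w"
proof -
  have "w \<in> wclass w" by (simp add: wclass_def weq.refl)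
  then have "(SOME v. v \<in> wclass w) \<in> wclass w" by (rule someI)
  then show ?thesis unfolding gact_def using act_weq by (auto simp: wclass_def)
qed

lemma gact_mult:
  "x \<in> carrier Gamma \<Longrightarrow> y \<in> carrier Gamma \<Longrightarrow> gact (x \<cdot> y) r = gact x (gact y r)"
  by (elim Gamma_cases) (simp add: wclass_mult gact_wclass act_append)

lemma gact_one [simp]: "gact \<e> r = r"
  by (simp add: Gamma_one gact_wclass)

lemma gact_gen: "gact (gen_el x) = act_gen x"
  by (simp add: gen_el_def gact_wclass)

lemma gact_h [simp]: "gact (h s) = hact s"
  by (simp add: h_def gact_gen)

lemma gact_g [simp]: "gact (g i) = g_act i"
  by (simp add: g_def gact_gen)

lemma gact_inv [simp]:
  assumes "x \<in> carrier Gamma"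
  shows "gact (inv\<^bsub>Gamma\<^esub> x) (gact x r) = r" "gact x (gact (inv\<^bsub>Gamma\<^esub> x) r) = r"
  using gact_mult[of "inv\<^bsub>Gamma\<^esub> x" x r] gact_mult[of x "inv\<^bsub>Gamma\<^esub> x" r] assms by simp_all

subsection \<open>Subgroups generated by involutions \<open>h(s)\<close>\<close>

definition hs :: "bool list set \<Rightarrow> letter list set set" where
  "hs A = generate Gamma (h ` A)"

lemma hs_carrier: "[] \<notin> A \<Longrightarrow> x \<in> hs A \<Longrightarrow> x \<in> carrier Gamma"
  unfolding hs_def by (rule Gamma.generate_in_carrier[of "h ` A"]) (auto intro!: h_closed)

lemma hs_subgroup: "[] \<notin> A \<Longrightarrow> subgroup (hs A) Gamma"
  unfolding hs_def by (rule Gamma.generate_is_subgroup) (auto intro!: h_closed)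

lemma hs_mono: "A \<subseteq> B \<Longrightarrow> hs A \<subseteq> hs B"
  unfolding hs_def by (rule Gamma.mono_generate) blast

lemma hs_one [simp]: "\<e> \<in> hs A"
  unfolding hs_def by (rule generate.one)

lemma hs_incl [simp]: "s \<in> A \<Longrightarrow> h s \<in> hs A"
  unfolding hs_def by (rule generate.incl) simp

lemma hs_mult: "x \<in> hs A \<Longrightarrow> y \<in> hs A \<Longrightarrow> x \<cdot> y \<in> hs A"
  unfolding hs_def by (rule generate.eng)

text \<open>The case of inverses disappears because the generators are involutions.\<close>

lemma hs_induct [consumes 2, case_names one gen mult]:
  assumes "x \<in> hs A" "[] \<notin> A" "P \<e>" "\<And>s. s \<in> A \<Longrightarrow> P (h s)"
    and mult: "\<And>x y. x \<in> hs A \<Longrightarrow> y \<in> hs A \<Longrightarrow> P x \<Longrightarrow> P y \<Longrightarrow> P (x \<cdot> y)"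
  shows "P x"
  using assms(1) unfolding hs_def
proof (induction rule: generate.induct)
  case (inv k)
  then obtain s where s: "s \<in> A" "k = h s" by blast
  then have "s \<noteq> []" using assms(2) by blast
  then show ?case using s assms(4) h_inv by simp
qed (use assms in \<open>auto simp: hs_def\<close>)

lemma conj_mult:
  assumes "u \<in> carrier Gamma" "u \<cdot> u = \<e>" "x \<in> carrier Gamma" "y \<in> carrier Gamma"
  shows "u \<cdot> (x \<cdot> y) \<cdot> u = (u \<cdot> x \<cdot> u) \<cdot> (u \<cdot> y \<cdot> u)"
proof -
  have "(u \<cdot> x \<cdot> u) \<cdot> (u \<cdot> y \<cdot> u) = u \<cdot> x \<cdot> (u \<cdot> u) \<cdot> y \<cdot> u"
    using assms(1,3,4) by (simp only: Gamma.m_assoc Gamma.m_closed)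
  then show ?thesis using assms by (simp add: Gamma.m_assoc)
qed

lemma hs_conj:
  assumes "u \<in> carrier Gamma" "u \<cdot> u = \<e>" "[] \<notin> A" "[] \<notin> B"
    and "\<And>s. s \<in> A \<Longrightarrow> u \<cdot> h s \<cdot> u \<in> hs B" and "x \<in> hs A"
  shows "u \<cdot> x \<cdot> u \<in> hs B"
  using assms(6,3)
proof (induction rule: hs_induct)
  case one
  then show ?case using assms by simp
next
  case (gen s)
  then show ?case by (rule assms)
next
  case (mult x y)
  then show ?case
    using assms hs_carrier by (simp add: conj_mult hs_mult)
qed

section \<open>Splitting off a generator with shortest prefix\<close>

definition hconj_closed :: "bool list set \<Rightarrow> bool" where
  "hconj_closed A \<longleftrightarrow> [] \<notin> A \<and> (\<forall>i\<in>A. \<forall>j\<in>A. length i \<le> length j \<longrightarrow> hconj i j \<in> A)"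

lemma length_hconj [simp]: "length (hconj i j) = length j"
  by (simp add: hconj_def)

lemma hconj_eq_Nil [simp]: "hconj i j = [] \<longleftrightarrow> j = []"
  by (simp add: hconj_def)

text \<open>Conjugation keeps the length and changes only prefixes strictly longer than the
  conjugating one; hence it never produces a prefix of minimal length from a different one.\<close>

lemma hconj_closed_remove:
  assumes "hconj_closed A" "s \<in> A" "\<And>t. t \<in> A \<Longrightarrow> length s \<le> length t"
  shows "hconj_closed (A - {s})"
    and "\<And>i t. i \<in> A \<Longrightarrow> t \<in> A - {s} \<Longrightarrow> length i \<le> length t \<Longrightarrow> hconj i t \<in> A - {s}"
proof -
  show *: "hconj i t \<in> A - {s}" if "i \<in> A" "t \<in> A - {s}" "length i \<le> length t" for i t
  proof -
    have "hconj i t \<noteq> s"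
    proof
      assume eq: "hconj i t = s"
      then have "length t = length s" by (metis length_hconj)
      then have "hconj i t = t" using assms(3)[OF that(1)] that(3) by (simp add: hconj_def)
      then show False using eq that by simp
    qed
    then show ?thesis using assms(1) that by (auto simp: hconj_closed_def)
  qed
  show "hconj_closed (A - {s})"
    using assms(1) * by (auto simp: hconj_closed_def)
qed

text \<open>\<open>h s\<close> normalises the subgroup generated by the remaining involutions, which
  therefore has index at most 2. The set \<open>A\<close> may be infinite: besides finiteness and
  faithfulness, this also gives the decomposition of \<open>H\<close> used to collapse
  words.\<close>

lemma hs_remove:
  assumes A: "hconj_closed A" "s \<in> A" "\<And>t. t \<in> A \<Longrightarrow> length s \<le> length t" and "x \<in> hs A"
  shows "x \<in> hs (A - {s}) \<or> x \<cdot> h s \<in> hs (A - {s})"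
proof -
  have ne: "[] \<notin> A" "s \<noteq> []" using A by (auto simp: hconj_closed_def)
  let ?A = "A - {s}"
  have norm: "h s \<cdot> y \<cdot> h s \<in> hs ?A" if "y \<in> hs ?A" for y
  proof (rule hs_conj[OF h_closed[OF ne(2)] h_sq[OF ne(2)] _ _ _ that])
    fix t assume "t \<in> ?A"
    then have "hconj s t \<in> ?A" "length s \<le> length t"
      using hconj_closed_remove(2)[OF A A(2)] A(3) by auto
    then show "h s \<cdot> h t \<cdot> h s \<in> hs ?A" using h_conj[OF ne(2)] by simp
  qed (use ne in auto)
  have car: "y \<in> carrier Gamma" if "y \<in> hs A" for y using that hs_carrier ne by blast
  show ?thesis
    using assms(4) ne(1)
  proof (induction rule: hs_induct)
    case (gen t)
    then show ?case by (cases "t = s") (auto simp: h_sq ne)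
  next
    case (mult x y)
    note c = car[OF mult(1)] car[OF mult(2)] h_closed[OF ne(2)]
    have e1: "x \<cdot> y = (x \<cdot> h s) \<cdot> (h s \<cdot> y)" and e2: "x \<cdot> y \<cdot> h s = x \<cdot> (y \<cdot> h s)"
      and e3: "h s \<cdot> y = h s \<cdot> (y \<cdot> h s) \<cdot> h s"
    proof -
      have "(x \<cdot> h s) \<cdot> (h s \<cdot> y) = x \<cdot> (h s \<cdot> h s) \<cdot> y" using c by (simp add: Gamma.m_assoc)
      then show "x \<cdot> y = (x \<cdot> h s) \<cdot> (h s \<cdot> y)" using c h_sq[OF ne(2)] by simp
      show "x \<cdot> y \<cdot> h s = x \<cdot> (y \<cdot> h s)" using c by (simp add: Gamma.m_assoc)
      have "h s \<cdot> (y \<cdot> h s) \<cdot> h s = h s \<cdot> y \<cdot> (h s \<cdot> h s)" using c by (simp add: Gamma.m_assoc)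
      then show "h s \<cdot> y = h s \<cdot> (y \<cdot> h s) \<cdot> h s" using c h_sq[OF ne(2)] by simp
    qed
    have e4: "x \<cdot> y \<cdot> h s = (x \<cdot> h s) \<cdot> (h s \<cdot> y \<cdot> h s)" 
      using c by (simp add: e1 Gamma.m_assoc)
    from mult(3) show ?case
    proof
      assume x: "x \<in> hs ?A"
      from mult(4) show ?case using x hs_mult e2 by metis
    next
      assume x: "x \<cdot> h s \<in> hs ?A"
      from mult(4) show ?case
      proof
        assume "y \<in> hs ?A"
        then show ?case using x hs_mult norm e4 by metis
      next
        assume "y \<cdot> h s \<in> hs ?A"
        then show ?case using x hs_mult norm e1 e3 by metis
      qed
    qed
  qed simp
qed

lemma min_length_exists:
  assumes "A \<noteq> {}"
  obtains s :: "bool list" where "s \<in> A" "\<And>t. t \<in> A \<Longrightarrow> length s \<le> length t"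
  using assms arg_min_nat_lemma[of "\<lambda>s. s \<in> A" _ length] by blast

text \<open>Each removed prefix at most halves the group, so its order is at most 2 to the number of
  generators.\<close>

lemma hs_finite:
  assumes "finite A" "hconj_closed A"
  shows "finite (hs A)"
  using assms
proof (induction "card A" arbitrary: A)
  case 0
  then have "A = {}" by simp
  then show ?case using Gamma.generate_empty by (simp add: hs_def)
next
  case (Suc n)
  then have "A \<noteq> {}" by auto
  then obtain s where s: "s \<in> A" "\<And>t. t \<in> A \<Longrightarrow> length s \<le> length t"
    using min_length_exists by blast
  have ne: "[] \<notin> A" "s \<noteq> []" using s Suc.prems by (auto simp: hconj_closed_def)
  have "finite (hs (A - {s}))"
    using Suc.hyps(2) Suc.prems s hconj_closed_remove(1)[OF Suc.prems(2) s] by (intro Suc.hyps(1)) auto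
  moreover have "hs A \<subseteq> hs (A - {s}) \<union> (\<lambda>x. x \<cdot> h s) ` hs (A - {s})"
  proof
    fix x assume x: "x \<in> hs A"
    have "x = (x \<cdot> h s) \<cdot> h s"
      using hs_carrier[OF ne(1) x] ne by (simp add: Gamma.m_assoc h_sq)
    then show "x \<in> hs (A - {s}) \<union> (\<lambda>x. x \<cdot> h s) ` hs (A - {s})"
      using hs_remove[OF Suc.prems(2) s x] by blast
  qed
  ultimately show ?case using finite_subset by blast
qed

lemma hact_prefix: "hact s (s @- r) = s @- ((\<not> shd r) ## stl r)"
  by (induction s) auto

lemma hact_cases: "hact t r = r \<or> (\<exists>q. r = t @- q \<and> hact t r = t @- ((\<not> shd q) ## stl q))"
proof (induction t arbitrary: r)
  case (Cons b t)
  obtain a q where "r = a ## q" by (metis stream.collapse)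
  then show ?case using Cons[of q] by auto
qed auto

text \<open>The digit following a shortest prefix \<open>s\<close> can be flipped only by
  \<open>h s\<close>, so an element acting trivially contains no \<open>h s\<close> and lies in the
  subgroup without it.\<close>

lemma hs_faithful:
  assumes "finite A" "hconj_closed A" "x \<in> hs A" "\<And>r. gact x r = r"
  shows "x = \<e>"
  using assms
proof (induction "card A" arbitrary: A)
  case 0
  then have "A = {}" by simp
  then show ?case using 0 Gamma.generate_empty by (simp add: hs_def)
next
  case (Suc n)
  then have "A \<noteq> {}" by auto
  then obtain s where s: "s \<in> A" "\<And>t. t \<in> A \<Longrightarrow> length s \<le> length t"
    using min_length_exists by blast
  have ne: "[] \<notin> A" "s \<noteq> []" using s Suc.prems by (auto simp: hconj_closed_def)
  let ?l = "length s"
  \<comment> \<open>The other prefixes are at least as long as \<open>s\<close>. A strictly longer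
    one leaves the digit at position \<open>?l\<close> alone, and a different one of equal length
    does not apply to sequences beginning with \<open>s\<close>.\<close>
  have fixes_bits: "\<forall>r. stake ?l (gact y r) = stake ?l r \<and> (stake ?l r = s \<longrightarrow> gact y r !! ?l = r !! ?l)"
    if "y \<in> hs (A - {s})" for y
  proof -
    have "[] \<notin> A - {s}" using ne by blast
    with that show ?thesis
    proof (induction rule: hs_induct)
      case (gen t)
      then have t: "?l \<le> length t" "t \<noteq> s" using s by auto
      show ?case
      proof (intro allI)
        fix r
        from hact_cases[of t r]
        show "stake ?l (gact (h t) r) = stake ?l r \<and> (stake ?l r = s \<longrightarrow> gact (h t) r !! ?l = r !! ?l)"
        proof (elim disjE exE conjE)
          fix q assume q: "r = t @- q" "hact t r = t @- ((\<not> shd q) ## stl q)"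
          show ?thesis
          proof (cases "?l = length t")
            case True
            then show ?thesis using q t by (simp add: stake_shift)
          next
            case False
            then show ?thesis using q t by (simp add: stake_shift)
          qed
        qed simp
      qed
    next
      case (mult x y)
      then have c: "x \<in> carrier Gamma" "y \<in> carrier Gamma" using hs_carrier ne by blast+
      show ?case using mult(3,4) by (simp add: gact_mult[OF c])
    qed simp
  qed
  have xc: "x \<in> carrier Gamma" using hs_carrier ne Suc.prems by blast
  have "x \<cdot> h s \<notin> hs (A - {s})"
  proof
    assume "x \<cdot> h s \<in> hs (A - {s})"
    from fixes_bits[OF this] have "gact (x \<cdot> h s) (s @- sconst True) !! ?l = (s @- sconst True) !! ?l"
      by (simp add: stake_shift)
    then show False
      using Suc.prems(4) xc ne by (simp add: gact_mult hact_prefix)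
  qed
  then have "x \<in> hs (A - {s})" using hs_remove[OF Suc.prems(2) s Suc.prems(3)] by blast
  then show ?case
    using Suc.hyps(2) Suc.prems s hconj_closed_remove(1)[OF Suc.prems(2) s]
    by (intro Suc.hyps(1)[of "A - {s}"]) auto
qed

section \<open>\<open>H\<close> as an increasing union of finite groups\<close>

definition short :: "nat \<Rightarrow> bool list set" where
  "short n = {s. s \<noteq> [] \<and> length s \<le> n}"

lemma short_finite: "finite (short n)"
  using finite_lists_length_le[of "UNIV :: bool set" n] by (rule rev_finite_subset) (auto simp: short_def)

lemma short_closed: "hconj_closed (short n)"
  by (simp add: hconj_closed_def short_def)

abbreviation H :: "letter list set set" where
  "H \<equiv> hs {s. s \<noteq> []}"

lemma H_carrier: "x \<in> H \<Longrightarrow> x \<in> carrier Gamma"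
  using hs_carrier[of "{s. s \<noteq> []}" x] by simp

lemma H_induct [consumes 1, case_names one gen mult]:
  assumes "x \<in> H" "P \<e>" "\<And>s. s \<noteq> [] \<Longrightarrow> P (h s)"
    and "\<And>x y. x \<in> H \<Longrightarrow> y \<in> H \<Longrightarrow> P x \<Longrightarrow> P y \<Longrightarrow> P (x \<cdot> y)"
  shows "P x"
  by (rule hs_induct[OF assms(1)]) (use assms in auto)

lemma H_in_hs_short: "x \<in> H \<Longrightarrow> \<exists>n. x \<in> hs (short n)"
proof (induction rule: H_induct)
  case (gen s)
  then have "h s \<in> hs (short (length s))" by (simp add: short_def)
  then show ?case by blast
next
  case (mult x y)
  then obtain m n where "x \<in> hs (short m)" "y \<in> hs (short n)" by blast
  moreover have "short m \<subseteq> short (max m n)" "short n \<subseteq> short (max m n)" by (auto simp: short_def)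
  ultimately have "x \<cdot> y \<in> hs (short (max m n))"
    using hs_mono[of "short m" "short (max m n)"] hs_mono[of "short n" "short (max m n)"]
    by (intro hs_mult) auto
  then show ?case by blast
qed auto

lemma H_faithful:
  assumes "x \<in> H" "\<And>r. gact x r = r"
  shows "x = \<e>"
proof -
  obtain n where "x \<in> hs (short n)" using H_in_hs_short[OF assms(1)] by blast
  then show ?thesis using hs_faithful[OF short_finite short_closed _ assms(2)] by simp
qed

subsection \<open>Alternating products\<close>

text \<open>The index names the leftmost \<open>g\<close>. One occurrence of \<open>g i\<close> per
  syllable is enough, since the subgroup generated by \<open>H\<close> and \<open>g i\<close> is the
  union of \<open>H\<close> and the double coset \<open>H (g i) H\<close>; this is what
  \<open>g_mult_alt\<close> establishes. The elements of \<open>H\<close> between the syllables are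
  arbitrary.\<close>

inductive alt :: "bool \<Rightarrow> letter list set \<Rightarrow> bool" where
  base: "x \<in> H \<Longrightarrow> y \<in> H \<Longrightarrow> alt i (x \<cdot> g i \<cdot> y)"
| step: "x \<in> H \<Longrightarrow> alt (\<not> i) y \<Longrightarrow> alt i (x \<cdot> g i \<cdot> y)"

lemma alt_carrier: "alt i z \<Longrightarrow> z \<in> carrier Gamma"
  by (induction rule: alt.induct) (auto simp: H_carrier)

lemma alt_left_mult:
  assumes "alt i z" "x \<in> H" shows "alt i (x \<cdot> z)"
  using assms(1)
proof cases
  case (base x' y)
  then have "x \<cdot> z = (x \<cdot> x') \<cdot> g i \<cdot> y"
    using assms(2) by (simp add: Gamma.m_assoc H_carrier)
  then show ?thesis using alt.base[OF hs_mult[OF assms(2) base(2)] base(3)] by simp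
next
  case (step x' y)
  then have "x \<cdot> z = (x \<cdot> x') \<cdot> g i \<cdot> y"
    using assms(2) by (simp add: Gamma.m_assoc H_carrier alt_carrier)
  then show ?thesis using alt.step[OF hs_mult[OF assms(2) step(2)] step(3)] by simp
qed

text \<open>Every nonempty prefix other than \<open>[\<not> i]\<close> begins with \<open>i\<close>,
  with \<open>\<not> i, i\<close> or with \<open>\<not> i, \<not> i\<close>, and for each of these a
  relation puts the conjugate by \<open>g i\<close> into \<open>H\<close>.\<close>

lemma g_conj_subgroup:
  assumes "x \<in> hs ({s. s \<noteq> []} - {[\<not> i]})"
  shows "g i \<cdot> x \<cdot> g i \<in> H"
  using g_closed g_sq _ _ _ assms
proof (rule hs_conj)
  fix s assume s: "s \<in> {s. s \<noteq> []} - {[\<not> i]}"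
  then obtain b t where bt: "s = b # t" by (cases s) auto
  show "g i \<cdot> h s \<cdot> g i \<in> H"
  proof (cases "b = i")
    case True
    then show ?thesis using bt g_conj_h by simp
  next
    case False
    then obtain c u where "t = c # u" using s bt by (cases t) auto
    then show ?thesis using False bt g_conj_h' g_conj_h_fixed by (cases "c = i") auto
  qed
qed auto

text \<open>Two equal \<open>g i\<close> meet across \<open>x\<close>. Either \<open>x\<close> can
  be conjugated through and both vanish, or \<open>x\<close> contributes one factor
  \<open>h [\<not> i]\<close> and the braid relation leaves a single \<open>g i\<close>.\<close>

lemma g_mult_alt:
  assumes "x \<in> H" "y \<in> H \<or> alt (\<not> i) y"
  shows "g i \<cdot> (x \<cdot> g i \<cdot> y) \<in> H \<or> (\<exists>j. alt j (g i \<cdot> (x \<cdot> g i \<cdot> y)))"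
proof -
  let ?A = "{s. s \<noteq> []} - {[\<not> i]}"
  have cl: "hconj_closed {s. s \<noteq> []}"
    by (simp add: hconj_closed_def)
  have c: "x \<in> carrier Gamma" "y \<in> carrier Gamma" "g i \<in> carrier Gamma" "h [\<not> i] \<in> carrier Gamma"
    using assms H_carrier alt_carrier by auto
  have "x \<in> hs ?A \<or> x \<cdot> h [\<not> i] \<in> hs ?A"
    \<comment> \<open>\<open>[\<not> i]\<close> is among the shortest nonempty prefixes, so it can
      be split off from all of \<open>H\<close>.\<close>
    using assms(1) by (intro hs_remove[OF cl]) (auto simp: Suc_le_eq)
  then show ?thesis
  proof
    assume "x \<in> hs ?A"
    then have "g i \<cdot> x \<cdot> g i \<in> H" by (rule g_conj_subgroup)
    moreover have "g i \<cdot> (x \<cdot> g i \<cdot> y) = (g i \<cdot> x \<cdot> g i) \<cdot> y" using c by (simp add: Gamma.m_assoc)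
    ultimately show ?thesis
      using assms(2) hs_mult[of "g i \<cdot> x \<cdot> g i" _ y] alt_left_mult[of _ y "g i \<cdot> x \<cdot> g i"] by auto
  next
    assume "x \<cdot> h [\<not> i] \<in> hs ?A"
    then have w: "g i \<cdot> (x \<cdot> h [\<not> i]) \<cdot> g i \<in> H" (is "?w \<in> H") by (rule g_conj_subgroup)
    have "?w \<cdot> (g i \<cdot> h [\<not> i] \<cdot> g i) = g i \<cdot> x \<cdot> (h [\<not> i] \<cdot> (g i \<cdot> g i) \<cdot> h [\<not> i]) \<cdot> g i"
      using c by (simp only: Gamma.m_assoc Gamma.m_closed)
    also have "\<dots> = g i \<cdot> x \<cdot> g i" using c by (simp add: g_sq h_sq)
    finally have "g i \<cdot> (x \<cdot> g i \<cdot> y) = ?w \<cdot> (g i \<cdot> h [\<not> i] \<cdot> g i) \<cdot> y"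
      using c by (simp add: Gamma.m_assoc)
    also have "\<dots> = (?w \<cdot> h [\<not> i]) \<cdot> g i \<cdot> (h [\<not> i] \<cdot> y)"
      unfolding g_braid using c by (simp add: Gamma.m_assoc)
    finally have eq: "g i \<cdot> (x \<cdot> g i \<cdot> y) = (?w \<cdot> h [\<not> i]) \<cdot> g i \<cdot> (h [\<not> i] \<cdot> y)" .
    have hH: "h [\<not> i] \<in> H" by simp
    have "alt i ((?w \<cdot> h [\<not> i]) \<cdot> g i \<cdot> (h [\<not> i] \<cdot> y))"
      using assms(2) alt.base[OF hs_mult[OF w hH] hs_mult[OF hH]]
        alt.step[OF hs_mult[OF w hH] alt_left_mult[OF _ hH]] by blast
    then show ?thesis using eq by metis
  qed
qed

text \<open>Only existence is asserted; what uniqueness of reduced words would give is supplied by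
  the action.\<close>

lemma Gamma_normal_form: "z \<in> carrier Gamma \<Longrightarrow> z \<in> H \<or> (\<exists>i. alt i z)"
proof (induction rule: Gamma_induct)
  case one
  then show ?case by simp
next
  case (gen x z)
  consider s where "s \<noteq> []" "gen_el x = h s" | i where "gen_el x = g i"
  proof (cases x)
    case (Hg s)
    then show thesis using that(1)[of s] gen(1) by (simp add: h_def)
  next
    case G0
    then show thesis using that(2)[of False] by (simp add: g_def)
  next
    case G1
    then show thesis using that(2)[of True] by (simp add: g_def)
  qed
  then show ?case
  proof cases
    case 1
    then have "gen_el x \<in> H" by simp
    then show ?thesis using gen(3) hs_mult[of "gen_el x"] alt_left_mult[of _ z "gen_el x"] by blast
  next
    case (2 i)
    have "alt (\<not> i) z \<or> alt i z" if "alt j z" for j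
      using that by (cases "j = i") auto
    then consider "z \<in> H" | "alt (\<not> i) z" | "alt i z" using gen(3) by blast
    then show ?thesis
    proof cases
      case 1
      then show ?thesis using alt.base[OF hs_one 1, of i] \<open>gen_el x = g i\<close> by auto
    next
      case 2
      then show ?thesis using alt.step[OF hs_one 2] \<open>gen_el x = g i\<close> by auto
    next
      case 3
      then show ?thesis
        by cases (use g_mult_alt \<open>gen_el x = g i\<close> in auto)
    qed
  qed
qed

section \<open>First digits and faithfulness of the action\<close>

lemma H_act:
  assumes "x \<in> H"
  shows "\<exists>d'. \<forall>r. \<exists>r'. gact x (a ## d ## r) = a ## d' ## r'"
proof -
  \<comment> \<open>Nonempty prefixes never flip the first digit, and whether the second one is
    flipped depends only on the first. The statement is generalised over \<open>d\<close> because in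
    a product the second digit may already have changed.\<close>
  have "\<forall>a d. \<exists>d'. \<forall>r. \<exists>r'. gact x (a ## d ## r) = a ## d' ## r'"
    using assms
  proof (induction rule: H_induct)
    case (gen s)
    then obtain b t where s: "s = b # t" by (cases s) auto
    show ?case
    proof (intro allI)
      fix a d
      show "\<exists>d'. \<forall>r. \<exists>r'. gact (h s) (a ## d ## r) = a ## d' ## r'"
        using s by (cases t) auto
    qed
  next
    case (mult x y)
    show ?case
    proof (intro allI)
      fix a d
      obtain d1 where d1: "\<forall>r. \<exists>r'. gact y (a ## d ## r) = a ## d1 ## r'" using mult(4) by blast
      obtain d2 where d2: "\<forall>r. \<exists>r'. gact x (a ## d1 ## r) = a ## d2 ## r'" using mult(3) by blast
      have "\<exists>r'. gact (x \<cdot> y) (a ## d ## r) = a ## d2 ## r'" for r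
      proof -
        obtain q where "gact y (a ## d ## r) = a ## d1 ## q" using d1 by blast
        then show ?thesis using d2 mult(1,2) by (simp add: gact_mult H_carrier)
      qed
      then show "\<exists>d'. \<forall>r. \<exists>r'. gact (x \<cdot> y) (a ## d ## r) = a ## d' ## r'" by blast
    qed
  qed auto
  then show ?thesis by blast
qed

lemma H_act_shd:
  assumes "x \<in> H"
  obtains q where "gact x (a ## r) = a ## q"
proof -
  obtain d r' where "r = d ## r'" by (cases r)
  then show thesis using H_act[OF assms, of a d] that by blast
qed

text \<open>Ping-pong: each \<open>g i\<close> sends the cone of \<open>i\<close> into that of
  \<open>\<not> i\<close>, where the next syllable to the left takes over, while \<open>H\<close>
  preserves first digits. The image is followed to depth two, uniformly in \<open>r\<close>: it is
  then strictly smaller than a whole first-digit cone, which rules out the identity even if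
  \<open>c\<close> equals \<open>\<not> i\<close>.\<close>

lemma alt_act: "alt i z \<Longrightarrow> \<exists>c d. \<forall>r. \<exists>r'. gact z (c ## r) = (\<not> i) ## d ## r'"
proof (induction rule: alt.induct)
  case (base x y i)
  obtain d where d: "\<forall>r. \<exists>r'. gact x ((\<not> i) ## i ## r) = (\<not> i) ## d ## r'" using H_act base by blast
  have "\<exists>r'. gact (x \<cdot> g i \<cdot> y) (i ## r) = (\<not> i) ## d ## r'" for r
  proof -
    obtain q where "gact y (i ## r) = i ## q" by (rule H_act_shd[OF base(2)])
    then show ?thesis using d base by (simp add: gact_mult H_carrier)
  qed
  then show ?case by blast
next
  case (step x i y)
  obtain c e where y: "\<forall>r. \<exists>r'. gact y (c ## r) = i ## e ## r'" using step by auto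
  obtain d where d: "\<forall>r. \<exists>r'. gact x ((\<not> i) ## i ## r) = (\<not> i) ## d ## r'" using H_act step by blast
  have "\<exists>r'. gact (x \<cdot> g i \<cdot> y) (c ## r) = (\<not> i) ## d ## r'" for r
  proof -
    obtain q where "gact y (c ## r) = i ## q" using y by blast
    then show ?thesis using d step alt_carrier[of "\<not> i" y] by (simp add: gact_mult H_carrier)
  qed
  then show ?case by blast
qed

lemma gact_faithful:
  assumes "z \<in> carrier Gamma" "z \<noteq> \<e>"
  obtains r where "gact z r \<noteq> r"
proof -
  have "\<exists>r. gact z r \<noteq> r"
  proof (cases "z \<in> H")
    case True
    then show ?thesis using H_faithful assms by blast
  next
    case False
    then obtain i where "alt i z" using Gamma_normal_form assms by blast
    then obtain c d where cd: "\<forall>r. \<exists>r'. gact z (c ## r) = (\<not> i) ## d ## r'" using alt_act by blast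
    \<comment> \<open>The second digit is chosen to differ from the one forced on the image.\<close>
    then obtain r' where "gact z (c ## (\<not> d) ## sconst True) = (\<not> i) ## d ## r'" by blast
    then have "gact z (c ## (\<not> d) ## sconst True) \<noteq> c ## (\<not> d) ## sconst True" by simp
    then show ?thesis by blast
  qed
  then show thesis using that by blast
qed

subsection \<open>Conjugating \<open>h(0)\<close> and \<open>h(1)\<close> into \<open>H\<close>\<close>

text \<open>Its generators move only sequences inside the cone of \<open>i\<close>.\<close>

definition cone_hs :: "bool \<Rightarrow> letter list set set" where
  "cone_hs i = hs (range (Cons i))"

lemma cone_hs_H: "x \<in> cone_hs i \<Longrightarrow> x \<in> H"
  unfolding cone_hs_def using hs_mono[of "range (Cons i)" "{s. s \<noteq> []}"] by blast

text \<open>When \<open>s\<close> is the longer prefix the conjugation relation runs the other way,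
  so \<open>h s \<cdot> h t \<cdot> h s\<close> is rewritten as
  \<open>h s \<cdot> h (hconj t s) \<cdot> h t\<close>. Either this collapses to \<open>h t\<close>,
  or \<open>s\<close> itself begins with \<open>i\<close>.\<close>

lemma cone_hs_normal_gen:
  assumes "s \<noteq> []" "x \<in> cone_hs i"
  shows "h s \<cdot> x \<cdot> h s \<in> cone_hs i"
  using h_closed[OF assms(1)] h_sq[OF assms(1)] _ _ _ assms(2) unfolding cone_hs_def
proof (rule hs_conj)
  fix t assume "t \<in> range (Cons i)"
  then obtain r where t: "t = i # r" by blast
  show "h s \<cdot> h t \<cdot> h s \<in> hs (range (Cons i))"
  proof (cases "length s \<le> length t")
    case True
    obtain b u where "s = b # u" using assms(1) by (cases s) auto
    then have "hconj s t \<in> range (Cons i)" using t by auto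
    then show ?thesis using h_conj[OF assms(1) True] by simp
  next
    case False
    have c: "h s \<in> carrier Gamma" "h t \<in> carrier Gamma" using assms t by auto
    have "h t \<cdot> h s \<cdot> h t = h (hconj t s)" using False t by (intro h_conj) auto
    then have "h s \<cdot> h t \<cdot> h s = h s \<cdot> (h (hconj t s) \<cdot> h t)"
      using c h_sq[of t] t by (metis Gamma.m_assoc Gamma.m_closed Gamma.r_one list.distinct(1))
    moreover have "h s \<cdot> (h (hconj t s) \<cdot> h t) \<in> hs (range (Cons i))"
    proof (cases "hconj t s = s")
      case True
      then have "h s \<cdot> (h (hconj t s) \<cdot> h t) = h t"
        using c assms(1) by (simp add: Gamma.m_assoc[symmetric] h_sq)
      then show ?thesis using t by simp
    next
      case False
      obtain b u where bu: "s = b # u" using assms(1) by (cases s) auto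
      then have "b = i" using False t by (auto split: if_splits)
      then show ?thesis using t bu by (auto intro!: hs_mult)
    qed
    ultimately show ?thesis by simp
  qed
qed auto

lemma cone_hs_normal:
  assumes "x \<in> H" "y \<in> cone_hs i"
  shows "inv\<^bsub>Gamma\<^esub> x \<cdot> y \<cdot> x \<in> cone_hs i"
proof -
  have "\<forall>y\<in>cone_hs i. inv\<^bsub>Gamma\<^esub> x \<cdot> y \<cdot> x \<in> cone_hs i"
    using assms(1)
  proof (induction rule: H_induct)
    case one
    then show ?case using cone_hs_H H_carrier by auto
  next
    case (gen s)
    then show ?case using cone_hs_normal_gen h_inv by simp
  next
    case (mult x x')
    show ?case
    proof
      fix y assume y: "y \<in> cone_hs i"
      have "inv\<^bsub>Gamma\<^esub> (x \<cdot> x') \<cdot> y \<cdot> (x \<cdot> x') = inv\<^bsub>Gamma\<^esub> x' \<cdot> (inv\<^bsub>Gamma\<^esub> x \<cdot> y \<cdot> x) \<cdot> x'"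
        using mult(1,2) cone_hs_H[OF y] by (simp add: H_carrier Gamma.inv_mult_group Gamma.m_assoc)
      then show "inv\<^bsub>Gamma\<^esub> (x \<cdot> x') \<cdot> y \<cdot> (x \<cdot> x') \<in> cone_hs i" using mult(3,4) y by simp
    qed
  qed
  then show ?thesis using assms(2) by blast
qed

lemma g_conj_cone_hs:
  assumes "x \<in> cone_hs i"
  shows "g i \<cdot> x \<cdot> g i \<in> cone_hs (\<not> i)"
  using g_closed g_sq _ _ _ assms unfolding cone_hs_def
  by (rule hs_conj) (auto simp: g_conj_h)

text \<open>Peeling \<open>z\<close> from the left, factors from \<open>H\<close> preserve
  \<open>cone_hs i\<close> and \<open>g i\<close> carries it into \<open>cone_hs (\<not> i)\<close>,
  which fits the next \<open>g\<close>. Alternation is exactly what keeps the conjugates inside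
  \<open>H\<close>.\<close>

lemma alt_conj_cone_hs: "alt i z \<Longrightarrow> n \<in> cone_hs i \<Longrightarrow> inv\<^bsub>Gamma\<^esub> z \<cdot> n \<cdot> z \<in> H"
proof (induction arbitrary: n rule: alt.induct)
  case (base x y i)
  have "inv\<^bsub>Gamma\<^esub> (x \<cdot> g i \<cdot> y) \<cdot> n \<cdot> (x \<cdot> g i \<cdot> y)
      = inv\<^bsub>Gamma\<^esub> y \<cdot> (g i \<cdot> (inv\<^bsub>Gamma\<^esub> x \<cdot> n \<cdot> x) \<cdot> g i) \<cdot> y"
    using base cone_hs_H[OF base(3)] by (simp add: H_carrier Gamma.inv_mult_group Gamma.m_assoc g_inv)
  then show ?case
    using cone_hs_normal[OF base(2) g_conj_cone_hs[OF cone_hs_normal[OF base(1,3)]]] cone_hs_H by simp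
next
  case (step x i y)
  have "inv\<^bsub>Gamma\<^esub> (x \<cdot> g i \<cdot> y) \<cdot> n \<cdot> (x \<cdot> g i \<cdot> y)
      = inv\<^bsub>Gamma\<^esub> y \<cdot> (g i \<cdot> (inv\<^bsub>Gamma\<^esub> x \<cdot> n \<cdot> x) \<cdot> g i) \<cdot> y"
    using step(1) alt_carrier[OF step(2)] cone_hs_H[OF step(4)]
    by (simp add: H_carrier Gamma.inv_mult_group Gamma.m_assoc g_inv)
  then show ?case
    using step(3)[OF g_conj_cone_hs[OF cone_hs_normal[OF step(1,4)]]] by simp
qed

text \<open>The right digit is the index of the leftmost \<open>g\<close> in an alternating form of
  \<open>z\<close>; if \<open>z\<close> is in \<open>H\<close>, both digits work.\<close>

lemma conj_h_in_H:
  assumes "z \<in> carrier Gamma"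
  shows "\<exists>i. inv\<^bsub>Gamma\<^esub> z \<cdot> h [i] \<cdot> z \<in> H"
proof -
  have hc: "h [i] \<in> cone_hs i" for i by (simp add: cone_hs_def)
  from Gamma_normal_form[OF assms] show ?thesis
    using cone_hs_H[OF cone_hs_normal[OF _ hc]] alt_conj_cone_hs[OF _ hc] by blast
qed

subsection \<open>Dynamics of cones\<close>

lemma stake_hact:
  assumes "stake m r = stake m r'" "length t < m"
  shows "stake m (hact t r) = stake m (hact t r')"
  using assms
proof (induction t arbitrary: m r r')
  case Nil
  then show ?case by (cases m) auto
next
  case (Cons b t)
  then obtain k where k: "m = Suc k" by (cases m) auto
  with Cons.prems have "shd r = shd r'" "stake k (stl r) = stake k (stl r')" "length t < k" by simp_all
  then show ?case using Cons.IH[of k "stl r" "stl r'"] Cons.prems k by simp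
qed

lemma stake_mono: "stake m r = stake m r' \<Longrightarrow> n \<le> m \<Longrightarrow> stake n r = stake n r'"
  by (metis min_absorb1 take_stake)

text \<open>Two digits decide which branch of \<open>g_act\<close> applies, and one branch drops a
  digit.\<close>

lemma stake_g_act:
  assumes "stake (Suc (Suc n)) r = stake (Suc (Suc n)) r'"
  shows "stake n (g_act i r) = stake n (g_act i r')"
proof -
  have s: "shd r = shd r'" "shd (stl r) = shd (stl r')" using assms by auto
  have 1: "stake n ((\<not> i) ## r) = stake n ((\<not> i) ## r')"
    using stake_mono[OF assms, of "n - 1"] by (cases n) auto
  have 2: "stake n (stl r) = stake n (stl r')"
    using stake_mono[of "Suc n" "stl r" "stl r'" n] assms by simp
  have 3: "stake n r = stake n r'" using stake_mono[OF assms] by simp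
  show ?thesis using s 1 2 3 by (simp add: g_act_def)
qed

text \<open>Continuity with a modulus \<open>m\<close> independent of the point; it upgrades a moved
  point to a moved cone.\<close>

lemma gact_continuous:
  "z \<in> carrier Gamma \<Longrightarrow> \<exists>m. \<forall>r r'. stake m r = stake m r' \<longrightarrow> stake n (gact z r) = stake n (gact z r')"
proof (induction arbitrary: n rule: Gamma_induct)
  case one
  then show ?case by auto
next
  case (gen x z)
  have "\<exists>k. \<forall>r r'. stake k r = stake k r' \<longrightarrow> stake n (act_gen x r) = stake n (act_gen x r')"
  proof (cases x)
    case (Hg s)
    have "stake n (hact s r) = stake n (hact s r')"
      if "stake (n + length s + 1) r = stake (n + length s + 1) r'" for r r'
      using stake_hact[OF that, of s] stake_mono[of "n + length s + 1" _ _ n] by simp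
    then show ?thesis unfolding Hg act_gen.simps by blast
  next
    case G0
    show ?thesis unfolding G0 act_gen.simps using stake_g_act by blast
  next
    case G1
    show ?thesis unfolding G1 act_gen.simps using stake_g_act by blast
  qed
  then obtain k where k: "\<And>r r'. stake k r = stake k r' \<Longrightarrow> stake n (act_gen x r) = stake n (act_gen x r')"
    by blast
  obtain m where m: "\<forall>r r'. stake m r = stake m r' \<longrightarrow> stake k (gact z r) = stake k (gact z r')"
    using gen(3) by blast
  have act: "gact (gen_el x \<cdot> z) r = act_gen x (gact z r)" for r
    using gen(1,2) by (simp add: gact_mult gact_gen)
  show ?case unfolding act using k m by blast
qed

text \<open>The prefix \<open>s\<close> of a moved point \<open>x\<close> is long enough to
  determine the first \<open>n\<close> digits both of the sequence and of its image, and these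
  already differ at \<open>x\<close>.\<close>

lemma gact_moves_cone:
  assumes "z \<in> carrier Gamma" "z \<noteq> \<e>"
  obtains s where "s \<noteq> []" "\<And>r q. gact z (s @- r) \<noteq> s @- q"
proof -
  obtain x where "gact z x \<noteq> x" using gact_faithful[OF assms] by blast
  then obtain k where "gact z x !! k \<noteq> x !! k"
    using smap_alt[of id "gact z x" x] by (auto simp: stream.map_id)
  moreover define n where "n = Suc k"
  ultimately have n: "stake n (gact z x) \<noteq> stake n x"
    by (metis lessI stake_nth)
  obtain m where m: "\<And>r r'. stake m r = stake m r' \<Longrightarrow> stake n (gact z r) = stake n (gact z r')"
    using gact_continuous[OF assms(1)] by blast
  define N where "N = Suc (max m n)"
  define s where "s = stake N x"
  have pre: "stake k (s @- r) = stake k x" if "k \<le> max m n" for k r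
  proof -
    have "k \<le> N" using that by (simp add: N_def)
    then show ?thesis by (simp add: s_def stake_shift take_stake)
  qed
  have "gact z (s @- r) \<noteq> s @- q" for r q
    using m[of "s @- r" x] pre[of m r] pre[of n q] n by auto
  moreover have "s \<noteq> []" by (simp add: s_def N_def)
  ultimately show thesis using that by blast
qed

text \<open>Up to the action there are two types of cones, distinguished by the parity of the depth of
  the cone plus its first digit.\<close>
lemma gact_cone_transitive:
  "\<exists>k\<in>carrier Gamma. \<forall>r. gact k ((a # t) @- r) = (a = even (length t)) ## r"
proof (induction t arbitrary: a)
  case Nil
  show ?case by (rule bexI[of _ "\<e>"]) auto
next
  case (Cons b t)
  obtain k where k: "k \<in> carrier Gamma" "\<And>r. gact k (((\<not> a) # t) @- r) = ((\<not> a) = even (length t)) ## r"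
    using Cons[of "\<not> a"] by blast
  \<comment> \<open>\<open>l\<close> makes the second digit \<open>\<not> a\<close>, so that
    \<open>g (\<not> a)\<close> can drop the first one. The depth falls by one and the leading digit
    flips, which preserves the type.\<close>
  define l where "l = (if b = a then h [a] else \<e>)"
  have l: "l \<in> carrier Gamma" "gact l (a ## b ## r) = a ## (\<not> a) ## r" for r
    by (auto simp: l_def)
  have "gact (k \<cdot> g (\<not> a) \<cdot> l) ((a # b # t) @- r) = (a = even (length (b # t))) ## r" for r
    using k l g_act_simps(2)[of "\<not> a"] by (auto simp: gact_mult)
  then show ?case using k(1) l(1) by (intro bexI[of _ "k \<cdot> g (\<not> a) \<cdot> l"]) auto
qed

lemma disjoint_translates:
  assumes "z \<in> carrier Gamma" "z \<noteq> \<e>"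
  shows "\<exists>C (s :: nat \<Rightarrow> letter list set).
      (\<forall>x\<in>C. z \<cdot> x \<notin> C) \<and> (\<forall>j. s j \<in> carrier Gamma) \<and>
      (\<forall>i j x. i \<noteq> j \<longrightarrow> x \<in> carrier Gamma \<longrightarrow>
        inv\<^bsub>Gamma\<^esub> (s i) \<cdot> x \<in> C \<or> inv\<^bsub>Gamma\<^esub> (s j) \<cdot> x \<in> C)"
proof -
  obtain w where w: "w \<noteq> []" "\<And>r q. gact z (w @- r) \<noteq> w @- q"
    using gact_moves_cone[OF assms] by blast
  obtain a u where "w = a # u" using w(1) by (cases w) auto
  then obtain k c where k: "k \<in> carrier Gamma" "\<And>r. gact k (w @- r) = c ## r"
    using gact_cone_transitive[of a u] by auto
  \<comment> \<open>Each cone \<open>c # t j\<close> consists of \<open>2 * j + 1\<close> digits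
    \<open>c\<close> followed by \<open>\<not> c\<close>, so these cones are pairwise disjoint. The
    odd length of \<open>t j\<close> gives them the type of the cone of \<open>\<not> c\<close>,
    whose complement is the cone of \<open>c\<close>.\<close>
  define t where "t j = replicate (2 * j) c @ [\<not> c]" for j :: nat
  have "\<exists>l\<in>carrier Gamma. \<forall>r. gact l ((c # t j) @- r) = (\<not> c) ## r" for j
    using gact_cone_transitive[of c "t j"] by (simp add: t_def)
  then obtain l where l: "\<And>j. l j \<in> carrier Gamma" "\<And>j r. gact (l j) ((c # t j) @- r) = (\<not> c) ## r"
    by metis
  \<comment> \<open>Any point would serve: the orbit map pulls subsets of the Cantor space back to
    subsets of the group.\<close>
  define base :: "bool stream" where "base = sconst True"
  define C where "C = {x \<in> carrier Gamma. \<exists>r. gact x base = w @- r}"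
  \<comment> \<open>\<open>k\<close> takes the cone of \<open>w\<close> to the cone of
    \<open>c\<close>, and the inverse of \<open>l j\<close> takes that to the complement of the cone
    \<open>c # t j\<close>. Thus \<open>s j\<close> translates \<open>C\<close> to the complement of
    one of the disjoint cones, pulled back to the group.\<close>
  define s where "s j = inv\<^bsub>Gamma\<^esub> l j \<cdot> k" for j
  have s: "s j \<in> carrier Gamma" for j using k l by (simp add: s_def)
  have moves: "z \<cdot> x \<notin> C" if "x \<in> C" for x
    using that w(2) assms by (auto simp: C_def gact_mult)
  have in_C: "inv\<^bsub>Gamma\<^esub> (s j) \<cdot> x \<in> C"
    if x: "x \<in> carrier Gamma" and out: "\<And>r. gact x base \<noteq> (c # t j) @- r" for j x
  proof -
    obtain b q where bq: "gact (l j) (gact x base) = b ## q" by (metis stream.collapse)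
    have "b = c"
    proof (rule ccontr)
      assume "b \<noteq> c"
      then have "b = (\<not> c)" by auto
      then have "gact (l j) (gact x base) = gact (l j) ((c # t j) @- q)" by (simp only: l(2) bq)
      then have "gact x base = (c # t j) @- q" using gact_inv(1)[OF l(1)] by metis
      then show False using out by blast
    qed
    with bq have "gact (l j) (gact x base) = c ## q" by simp
    then have "gact (l j) (gact x base) = gact k (w @- q)" by (simp only: k(2))
    then have "gact (inv\<^bsub>Gamma\<^esub> k) (gact (l j) (gact x base)) = w @- q" using k(1) by simp
    moreover have "inv\<^bsub>Gamma\<^esub> (s j) = inv\<^bsub>Gamma\<^esub> k \<cdot> l j"
      using k l by (simp add: s_def Gamma.inv_mult_group)
    ultimately show ?thesis using x k l s by (auto simp: C_def gact_mult)
  qed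
  have t_disj: "(c # t i) @- r \<noteq> (c # t j) @- q" if "i < j" for i j r q
  proof
    assume "(c # t i) @- r = (c # t j) @- q"
    then have "((c # t i) @- r) !! (2 * i + 1) = ((c # t j) @- q) !! (2 * i + 1)" by simp
    then show False using that by (simp add: t_def shift_snth nth_append)
  qed
  have "inv\<^bsub>Gamma\<^esub> (s i) \<cdot> x \<in> C \<or> inv\<^bsub>Gamma\<^esub> (s j) \<cdot> x \<in> C"
    if ij: "i \<noteq> j" and x: "x \<in> carrier Gamma" for i j x
  proof (rule ccontr)
    assume "\<not> ?thesis"
    then obtain r q where "gact x base = (c # t i) @- r" "gact x base = (c # t j) @- q"
      using in_C[OF x, of i] in_C[OF x, of j] by blast
    then show False
      using t_disj[of i j r q] t_disj[of j i q r] ij by (auto simp: nat_neq_iff)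
  qed
  then show ?thesis
    using s moves by (intro exI[of _ C] exI[of _ s]) simp
qed

lemma not_Cstar_simple_Gamma: "\<not> Cstar_simple Gamma"
proof (rule Gamma.not_Cstar_simpleI[where F = "\<lambda>n. hs (short n)" and a = "h [False]" and b = "h [True]"])
  show "subgroup (hs (short n)) Gamma" for n
    by (rule hs_subgroup) (simp add: short_def)
  show "finite (hs (short n))" for n
    by (rule hs_finite[OF short_finite short_closed])
  show "hs (short m) \<subseteq> hs (short n)" if "m \<le> n" for m n
    using that by (intro hs_mono) (auto simp: short_def)
  \<comment> \<open>Neither prefix extends the other, so the conjugation relation is trivial and the
    two involutions commute.\<close>
  have "h [False] \<cdot> h [True] \<cdot> h [False] = h [True]"
    using h_conj[of "[False]" "[True]"] by simp
  then have "h [False] \<cdot> h [True] = h [True] \<cdot> inv\<^bsub>Gamma\<^esub> h [False]"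
    by (intro Gamma.inv_solve_right[THEN iffD2]) simp_all
  then show "h [False] \<cdot> h [True] = h [True] \<cdot> h [False]"
    by (simp add: h_inv)
  show "(\<exists>n. inv\<^bsub>Gamma\<^esub> z \<cdot> h [False] \<cdot> z \<in> hs (short n)) \<or>
      (\<exists>n. inv\<^bsub>Gamma\<^esub> z \<cdot> h [True] \<cdot> z \<in> hs (short n))" if z: "z \<in> carrier Gamma" for z
  proof -
    obtain i where "inv\<^bsub>Gamma\<^esub> z \<cdot> h [i] \<cdot> z \<in> H" using conj_h_in_H[OF z] by blast
    then obtain n where "inv\<^bsub>Gamma\<^esub> z \<cdot> h [i] \<cdot> z \<in> hs (short n)" using H_in_hs_short by blast
    then show ?thesis by (cases i) auto
  qed
qed (simp_all add: h_def gen_el_neq_one)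

theorem theorem4p4:
  shows "unique_trace Gamma \<and> \<not> Cstar_simple Gamma"
  using Gamma.unique_traceI[OF disjoint_translates] not_Cstar_simple_Gamma by blast

end
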